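(* Let $n\ge 1$ and $\mu=(n-k,k)$ a partition of $n$ with at most two rows ($0\le k\le n-k$). Let $R_\mu=\mathbb{Q}[x_1,\ldots,x_n]/I_\mu$ be the Garsia–Procesi module. Then the set $$\mathcal{B}_\mu=\left\{F_T^S \,:\, (S,T)\in \bigcup_{\lambda\vdash n} \mathrm{SSYT}(\lambda,\mu)\times \mathrm{SYT}(\lambda)\right\}$$ descends to a higher Specht basis of $R_\mu$.
   Context: $S_n$ acts on $\mathbb{Q}[x_1,\ldots,x_n]$ by $\omega\cdot x_i=x_{\omega(i)}$. For a set $X$ of variables, $e_r(X)$ is the elementary symmetric polynomial of degree $r$ in the variables of $X$. For a partition $\mu$ with conjugate $\mu'$ (with $\mu'_j=0$ for $j>\mu_1$), let $c_t(\mu)=\mu'_1+\cdots+\mu'_t-t$ (so $c_0=0$). Then $I_\mu=\langle e_r(X): X\subseteq\{x_1,\ldots,x_n\},\ c_{n-|X|}(\mu)<r\le |X|\rangle$. Tableaux use French convention (first row at bottom). $\mathrm{SSYT}(\lambda,\mu)$ is the set of semistandard tableaux of shape $\lambda$ (rows weakly increasing left to right, columns strictly increasing bottom to top) with content $\mu$ (exactly $\mu_i$ entries equal to $i$); $\mathrm{SYT}(\lambda)$ is the set of standard ones (content $(1^n)$). Cocharge for words: for a standard word (each of $1,\ldots,m$ once), label $1$ by $0$, and if $i$ has label $j$, give $i+1$ label $j$ if $i+1$ is to the right of $i$, else $j+1$. For a word $w$ with partition content $\mu$: for an entry $w_j$ and value $m$, $\mathrm{cprev}(m,w_j)$ is the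 rightmost $m$ strictly left of $w_j$ if one exists, otherwise the rightmost $m$ in $w$. The first standard subword is obtained by taking the rightmost $1$, then recursively the $\mathrm{cprev}(j+1,\cdot)$ of the previously chosen letter $j$, for $j+1\le \ell(\mu)$. The standard subword decomposition is obtained by repeatedly extracting first standard subwords from the remaining letters. Each letter of $w$ gets the cocharge label it receives within its standard subword; $\mathrm{cc}(w)$ is the sum of labels. For $S$ semistandard, its reading word is the concatenation of rows from top to bottom, each left to right; $\mathrm{cw}_S(s)$ denotes the label of the letter corresponding to box $s$. For $S\in\mathrm{SSYT}(\lambda,\mu)$ and a filling $T$ of shape $\lambda$ by $1,\ldots,n$ each once, $\mathbf{x}_T^S=\prod_{s} x_{T(s)}^{\mathrm{cw}_S(s)}$ over boxes $s$ of $\lambda$, and $F_T^S=\varepsilon_T\cdot\mathbf{x}_T^S$ where $\varepsilon_T=\sum_{\tau\in C(T)}\sum_{\sigma\in R(T)}\mathrm{sgn}(\tau)\tau\sigma$, with $C(T)$, $R(T)$ the column- and row-stabilizing subgroups of $S_n$. A set of polynomials descends to a higher Specht basis of $R$ if its images form a basis of $R$ and can be partitioned into subsets each of which is a basis of an $S_n$-submodule isomorphic to an irreducible $V_\lambda$, these submodules forming a direct sum decomposition of $R$. *)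

theory Defs
  imports
    "HOL-Library.Poly_Mapping"
    "HOL-Library.Disjoint_Sets"
    "HOL-Combinatorics.Permutations"
    "HOL-Algebra.QuotRing"
    "Jordan_Normal_Form.VS_Connect"
begin

section \<open>Polynomials and the action of the symmetric group\<close>

text \<open>
  A monomial is a finitely supported exponent vector. The variables are indexed by all
  of \<^typ>\<open>nat\<close>; the ring in the variables \<open>x\<^sub>1, \<dots>, x\<^sub>n\<close> is cut out by its carrier.
  \<^term>\<open>class_ring\<close> at type \<^typ>\<open>rat\<close> is the field of rational numbers.
\<close>

type_synonym qpoly = "(nat \<Rightarrow>\<^sub>0 nat) \<Rightarrow>\<^sub>0 rat"

definition const_poly :: "rat \<Rightarrow> qpoly" where
  "const_poly c = Poly_Mapping.single 0 c"

definition xvar :: "nat \<Rightarrow> qpoly" where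
  "xvar i = Poly_Mapping.single (Poly_Mapping.single i 1) 1"

definition poly_ring :: "nat \<Rightarrow> qpoly ring" where
  "poly_ring n =
     class_ring\<lparr>carrier := {p. \<forall>m\<in>Poly_Mapping.keys p. Poly_Mapping.keys m \<subseteq> {1..n}}\<rparr>"

definition poly_module :: "nat \<Rightarrow> (rat, qpoly) module" where
  "poly_module n =
     \<lparr>carrier = carrier (poly_ring n), mult = (*), one = 1, zero = 0, add = (+),
      smult = (\<lambda>c p. const_poly c * p)\<rparr>"

text \<open>The substitution \<open>x\<^sub>i \<mapsto> x\<^bsub>\<sigma>(i)\<^esub>\<close>.\<close>

definition perm_act :: "(nat \<Rightarrow> nat) \<Rightarrow> qpoly \<Rightarrow> qpoly" where
  "perm_act \<sigma> p =
     (\<Sum>m\<in>Poly_Mapping.keys p.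
        const_poly (Poly_Mapping.lookup p m) *
        (\<Prod>i\<in>Poly_Mapping.keys m. xvar (\<sigma> i) ^ Poly_Mapping.lookup m i))"

definition elem_sym :: "nat \<Rightarrow> nat set \<Rightarrow> qpoly" where
  "elem_sym r X = (\<Sum>Y | Y \<subseteq> X \<and> card Y = r. \<Prod>i\<in>Y. xvar i)"


section \<open>Partitions and the Garsia--Procesi module\<close>

text \<open>Partitions are weakly decreasing lists of positive parts, so the length of the
  list is the number of parts.\<close>

definition is_partition :: "nat \<Rightarrow> nat list \<Rightarrow> bool" where
  "is_partition n \<mu> \<longleftrightarrow> sorted_wrt (\<ge>) \<mu> \<and> 0 \<notin> set \<mu> \<and> sum_list \<mu> = n"

definition conj_part :: "nat list \<Rightarrow> nat \<Rightarrow> nat" where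
  "conj_part \<mu> j = card {i. i < length \<mu> \<and> j \<le> \<mu> ! i}"

definition GP_bound :: "nat list \<Rightarrow> nat \<Rightarrow> int" where
  "GP_bound \<mu> t = (\<Sum>j=1..t. int (conj_part \<mu> j)) - int t"

definition GP_ideal :: "nat \<Rightarrow> nat list \<Rightarrow> qpoly set" where
  "GP_ideal n \<mu> =
     genideal (poly_ring n)
       {elem_sym r X | r X. X \<subseteq> {1..n} \<and> GP_bound \<mu> (n - card X) < int r \<and> r \<le> card X}"

definition GP_proj :: "nat \<Rightarrow> nat list \<Rightarrow> qpoly \<Rightarrow> qpoly set" where
  "GP_proj n \<mu> p = GP_ideal n \<mu> +>\<^bsub>poly_ring n\<^esub> p"

text \<open>The quotient ring, whose elements are cosets, as a module over the rationals.\<close>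

definition GP_module :: "nat \<Rightarrow> nat list \<Rightarrow> (rat, qpoly set) module" where
  "GP_module n \<mu> =
     (let Q = poly_ring n Quot GP_ideal n \<mu> in
      \<lparr>carrier = carrier Q, mult = mult Q, one = one Q, zero = zero Q, add = add Q,
       smult = (\<lambda>c A. GP_proj n \<mu> (const_poly c) \<otimes>\<^bsub>Q\<^esub> A)\<rparr>)"

text \<open>The ideal is stable under the permutations of \<open>{1..n}\<close>, so the elementwise image
  of the coset of \<open>p\<close> under \<open>\<sigma>\<close> is the coset of \<open>\<sigma> \<cdot> p\<close>.\<close>

definition coset_act :: "(nat \<Rightarrow> nat) \<Rightarrow> qpoly set \<Rightarrow> qpoly set" where
  "coset_act \<sigma> A = perm_act \<sigma> ` A"


section \<open>Representations of the symmetric group over the rationals\<close>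

text \<open>A representation of the symmetric group on \<open>{1..n}\<close> is a module \<open>V\<close> over the
  rationals together with a function \<open>act\<close>, relevant only on permutations of \<open>{1..n}\<close>
  and on the carrier of \<open>V\<close>.\<close>

definition Sn_rep ::
  "nat \<Rightarrow> (rat, 'v) module \<Rightarrow> ((nat \<Rightarrow> nat) \<Rightarrow> 'v \<Rightarrow> 'v) \<Rightarrow> bool" where
  "Sn_rep n V act \<longleftrightarrow>
     vectorspace class_ring V \<and>
     (\<forall>\<sigma>. \<sigma> permutes {1..n} \<longrightarrow> linear_map class_ring V V (act \<sigma>)) \<and>
     (\<forall>v\<in>carrier V. act id v = v) \<and>
     (\<forall>\<sigma> \<tau>. \<sigma> permutes {1..n} \<longrightarrow> \<tau> permutes {1..n} \<longrightarrow>
        (\<forall>v\<in>carrier V. act (\<sigma> \<circ> \<tau>) v = act \<sigma> (act \<tau> v)))"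

definition Sn_submodule ::
  "nat \<Rightarrow> (rat, 'v) module \<Rightarrow> ((nat \<Rightarrow> nat) \<Rightarrow> 'v \<Rightarrow> 'v) \<Rightarrow> 'v set \<Rightarrow> bool" where
  "Sn_submodule n V act W \<longleftrightarrow>
     subspace class_ring W V \<and>
     (\<forall>\<sigma>. \<sigma> permutes {1..n} \<longrightarrow> (\<forall>w\<in>W. act \<sigma> w \<in> W))"

definition Sn_irreducible ::
  "nat \<Rightarrow> (rat, 'v) module \<Rightarrow> ((nat \<Rightarrow> nat) \<Rightarrow> 'v \<Rightarrow> 'v) \<Rightarrow> 'v set \<Rightarrow> bool" where
  "Sn_irreducible n V act W \<longleftrightarrow>
     Sn_submodule n V act W \<and> W \<noteq> {\<zero>\<^bsub>V\<^esub>} \<and>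
     (\<forall>U. Sn_submodule n V act U \<and> U \<subseteq> W \<longrightarrow> U = {\<zero>\<^bsub>V\<^esub>} \<or> U = W)"

definition Sn_iso ::
  "nat \<Rightarrow> (rat, 'v) module \<Rightarrow> ((nat \<Rightarrow> nat) \<Rightarrow> 'v \<Rightarrow> 'v) \<Rightarrow>
   (rat, 'w) module \<Rightarrow> ((nat \<Rightarrow> nat) \<Rightarrow> 'w \<Rightarrow> 'w) \<Rightarrow> bool" where
  "Sn_iso n V actV W actW \<longleftrightarrow>
     (\<exists>\<phi>. linear_map class_ring V W \<phi> \<and> bij_betw \<phi> (carrier V) (carrier W) \<and>
       (\<forall>\<sigma>. \<sigma> permutes {1..n} \<longrightarrow> (\<forall>v\<in>carrier V. \<phi> (actV \<sigma> v) = actW \<sigma> (\<phi> v))))"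

definition direct_sum_decomposition ::
  "(rat, 'v) module \<Rightarrow> 'i set \<Rightarrow> ('i \<Rightarrow> 'v set) \<Rightarrow> bool" where
  "direct_sum_decomposition V P W \<longleftrightarrow>
     finite P \<and> (\<forall>i\<in>P. W i \<subseteq> carrier V) \<and>
     (\<forall>v\<in>carrier V. \<exists>!w. w \<in> (\<Pi>\<^sub>E i\<in>P. W i) \<and> v = finsum V w P)"


section \<open>Tableaux\<close>

text \<open>The box \<open>(r, c)\<close> lies in row \<open>r\<close> from the bottom and column \<open>c\<close> from the left, both
  counted from 0. Fillings are functions on boxes; tableaux are normalised outside their
  shape, so that distinct tableaux are distinct functions.\<close>

definition boxes :: "nat list \<Rightarrow> (nat \<times> nat) set" where
  "boxes \<nu> = {(r, c). r < length \<nu> \<and> c < \<nu> ! r}"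

definition SSYT :: "nat list \<Rightarrow> nat list \<Rightarrow> (nat \<times> nat \<Rightarrow> nat) set" where
  "SSYT \<nu> \<mu> = {S. S \<in> extensional (boxes \<nu>) \<and>
     (\<forall>r c c'. (r, c) \<in> boxes \<nu> \<longrightarrow> (r, c') \<in> boxes \<nu> \<longrightarrow> c < c' \<longrightarrow> S (r, c) \<le> S (r, c')) \<and>
     (\<forall>r r' c. (r, c) \<in> boxes \<nu> \<longrightarrow> (r', c) \<in> boxes \<nu> \<longrightarrow> r < r' \<longrightarrow> S (r, c) < S (r', c)) \<and>
     (\<forall>i. card {s \<in> boxes \<nu>. S s = i} =
            (if 1 \<le> i \<and> i \<le> length \<mu> then \<mu> ! (i - 1) else 0))}"

definition SYT :: "nat list \<Rightarrow> (nat \<times> nat \<Rightarrow> nat) set" where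
  "SYT \<nu> = SSYT \<nu> (replicate (sum_list \<nu>) 1)"

definition reading_order :: "nat list \<Rightarrow> (nat \<times> nat) list" where
  "reading_order \<nu> = concat (map (\<lambda>r. map (\<lambda>c. (r, c)) [0..<\<nu> ! r]) (rev [0..<length \<nu>]))"

definition row_stab :: "nat \<Rightarrow> nat list \<Rightarrow> (nat \<times> nat \<Rightarrow> nat) \<Rightarrow> (nat \<Rightarrow> nat) set" where
  "row_stab n \<nu> T = {\<sigma>. \<sigma> permutes {1..n} \<and>
     (\<forall>r. \<sigma> ` {T (r, c) | c. (r, c) \<in> boxes \<nu>} = {T (r, c) | c. (r, c) \<in> boxes \<nu>})}"

definition col_stab :: "nat \<Rightarrow> nat list \<Rightarrow> (nat \<times> nat \<Rightarrow> nat) \<Rightarrow> (nat \<Rightarrow> nat) set" where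
  "col_stab n \<nu> T = {\<tau>. \<tau> permutes {1..n} \<and>
     (\<forall>c. \<tau> ` {T (r, c) | r. (r, c) \<in> boxes \<nu>} = {T (r, c) | r. (r, c) \<in> boxes \<nu>})}"


section \<open>Cocharge labels\<close>

text \<open>A subword of \<open>w\<close> is given by its set of positions. In the following functions \<open>A\<close> is
  the set of positions not yet used by earlier standard subwords.\<close>

definition cprev :: "nat list \<Rightarrow> nat set \<Rightarrow> nat \<Rightarrow> nat \<Rightarrow> nat" where
  "cprev w A m j =
     (if \<exists>i\<in>A. i < j \<and> w ! i = m
      then Max {i \<in> A. i < j \<and> w ! i = m}
      else Max {i \<in> A. w ! i = m})"

text \<open>\<open>subword_pos w A m\<close> is the position of the letter \<open>m + 1\<close> in the first standard
  subword of the letters at positions in \<open>A\<close>.\<close>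

primrec subword_pos :: "nat list \<Rightarrow> nat set \<Rightarrow> nat \<Rightarrow> nat" where
  "subword_pos w A 0 = Max {i \<in> A. w ! i = 1}"
| "subword_pos w A (Suc m) = cprev w A (Suc (Suc m)) (subword_pos w A m)"

text \<open>As the letters at positions in \<open>A\<close> have partition content, the largest of them is
  the number of distinct ones, \<^term>\<open>card ((!) w ` A)\<close>.\<close>

definition first_subword :: "nat list \<Rightarrow> nat set \<Rightarrow> nat set" where
  "first_subword w A = subword_pos w A ` {..<card ((!) w ` A)}"

primrec remaining :: "nat list \<Rightarrow> nat \<Rightarrow> nat set" where
  "remaining w 0 = {..<length w}"
| "remaining w (Suc t) = remaining w t - first_subword w (remaining w t)"

text \<open>\<open>standard_label p m\<close> is the label of the letter \<open>m + 1\<close> in a standard word whose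
  letter \<open>i + 1\<close> is at position \<open>p i\<close>.\<close>

primrec standard_label :: "(nat \<Rightarrow> nat) \<Rightarrow> nat \<Rightarrow> nat" where
  "standard_label p 0 = 0"
| "standard_label p (Suc m) =
     (if p m < p (Suc m) then standard_label p m else standard_label p m + 1)"

definition cocharge_label :: "nat list \<Rightarrow> nat \<Rightarrow> nat" where
  "cocharge_label w i =
     (let A = remaining w (LEAST t. i \<notin> remaining w (Suc t))
      in standard_label (subword_pos w A) (w ! i - 1))"

definition cw :: "nat list \<Rightarrow> (nat \<times> nat \<Rightarrow> nat) \<Rightarrow> nat \<times> nat \<Rightarrow> nat" where
  "cw \<nu> S s =
     cocharge_label (map S (reading_order \<nu>))
       (THE i. i < length (reading_order \<nu>) \<and> reading_order \<nu> ! i = s)"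


section \<open>Higher Specht polynomials\<close>

definition xmono :: "nat list \<Rightarrow> (nat \<times> nat \<Rightarrow> nat) \<Rightarrow> (nat \<times> nat \<Rightarrow> nat) \<Rightarrow> qpoly" where
  "xmono \<nu> S T = (\<Prod>s\<in>boxes \<nu>. xvar (T s) ^ cw \<nu> S s)"

definition eps_act :: "nat \<Rightarrow> nat list \<Rightarrow> (nat \<times> nat \<Rightarrow> nat) \<Rightarrow> qpoly \<Rightarrow> qpoly" where
  "eps_act n \<nu> T p =
     (\<Sum>\<tau>\<in>col_stab n \<nu> T. \<Sum>\<sigma>\<in>row_stab n \<nu> T. of_int (sign \<tau>) * perm_act (\<tau> \<circ> \<sigma>) p)"

definition higher_specht_poly ::
  "nat \<Rightarrow> nat list \<Rightarrow> (nat \<times> nat \<Rightarrow> nat) \<Rightarrow> (nat \<times> nat \<Rightarrow> nat) \<Rightarrow> qpoly" where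
  "higher_specht_poly n \<nu> S T = eps_act n \<nu> T (xmono \<nu> S T)"

definition B_set :: "nat \<Rightarrow> nat list \<Rightarrow> qpoly set" where
  "B_set n \<mu> = {higher_specht_poly n \<nu> S T | \<nu> S T.
     is_partition n \<nu> \<and> S \<in> SSYT \<nu> \<mu> \<and> T \<in> SYT \<nu>}"


section \<open>Specht modules and higher Specht bases\<close>

text \<open>The irreducible module \<open>V\<^sub>\<nu>\<close> in Specht's realisation: the span of the products of the
  column Vandermonde determinants of all fillings of \<open>\<nu>\<close> by \<open>1, \<dots>, n\<close>. Since the exponents
  in the monomials of such a product record rows, these monomials correspond to row tabloids
  and the product to a polytabloid (column antisymmetrisation).\<close>

definition specht_poly :: "nat list \<Rightarrow> (nat \<times> nat \<Rightarrow> nat) \<Rightarrow> qpoly" where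
  "specht_poly \<nu> T =
     (\<Prod>(r, r', c) | (r, c) \<in> boxes \<nu> \<and> (r', c) \<in> boxes \<nu> \<and> r < r'.
        xvar (T (r', c)) - xvar (T (r, c)))"

definition specht_module :: "nat \<Rightarrow> nat list \<Rightarrow> (rat, qpoly) module" where
  "specht_module n \<nu> =
     (poly_module n)\<lparr>carrier :=
        LinearCombinations.module.span class_ring (poly_module n)
          {specht_poly \<nu> T | T. bij_betw T (boxes \<nu>) {1..n}}\<rparr>"

definition higher_specht_basis ::
  "nat \<Rightarrow> (rat, 'v) module \<Rightarrow> ((nat \<Rightarrow> nat) \<Rightarrow> 'v \<Rightarrow> 'v) \<Rightarrow> 'v set \<Rightarrow> bool" where
  "higher_specht_basis n V act B \<longleftrightarrow>
     Sn_rep n V act \<and> vectorspace.basis class_ring V B \<and>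
     (\<exists>P W. partition_on B P \<and>
        (\<forall>C\<in>P. Sn_irreducible n V act (W C) \<and>
           vectorspace.basis class_ring (V\<lparr>carrier := W C\<rparr>) C \<and>
           (\<exists>\<nu>. is_partition n \<nu> \<and>
              Sn_iso n (V\<lparr>carrier := W C\<rparr>) act (specht_module n \<nu>) perm_act)) \<and>
        direct_sum_decomposition V P W)"

text \<open>Injectivity of the projection on \<open>B\<close> makes the images a basis as a family indexed
  by \<open>B\<close>.\<close>

definition descends_to_higher_specht_basis :: "nat \<Rightarrow> nat list \<Rightarrow> qpoly set \<Rightarrow> bool" where
  "descends_to_higher_specht_basis n \<mu> B \<longleftrightarrow>
     B \<subseteq> carrier (poly_ring n) \<and> inj_on (GP_proj n \<mu>) B \<and>
     higher_specht_basis n (GP_module n \<mu>) coset_act (GP_proj n \<mu> ` B)"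

end

theory Submission
  imports Defs
begin

text \<open>
  A semistandard tableau of content \<open>(n - k, k)\<close> has shape \<open>(n - j, j)\<close> with
  \<open>j \<le> k\<close> and is unique; its reading word is \<open>2\<^sup>j 1\<^bsup>n - k\<^esup> 2\<^bsup>k - j\<^esup>\<close>, whose cocharge labels are 1
  on the top row and 0 elsewhere. Hence \<open>F\<^sub>T\<^sup>S\<close> is a positive multiple of the Specht polynomial
  \<open>\<Prod>(x\<^sub>b - x\<^sub>a)\<close> over the columns \<open>(a, b)\<close> of \<open>T\<close>, and everything reduces to showing that the
  polynomial ring is the direct sum of the ideal and the Specht modules \<open>S\<^sub>0, \<dots>, S\<^sub>k\<close>.

  For the inner product with orthonormal monomials, the Specht polynomials are orthogonal to the
  ideal (by antisymmetry or for reasons of degree), and the form is definite, so they are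
  independent modulo the ideal. Modulo the ideal the squares \<open>x\<^sub>i\<^sup>2\<close> and the sum of all variables
  vanish, which expresses every squarefree monomial through Specht polynomials. Within one degree,
  a quadratic straightening relation and the leading monomials give the basis of standard tableaux.
  Irreducibility holds because the column antisymmetriser maps a polynomial \<open>f\<close> of \<open>S\<^sub>d\<close> to
  \<open>\<langle>f, P\<rangle> P\<close>, where \<open>P\<close> is its Specht polynomial.
\<close>

section \<open>Polynomials, monomials and the permutation action\<close>

text \<open>The Specht polynomial of a two-row filling sees only the columns of height two. The
  proof therefore works with sets of disjoint ordered pairs; tableaux return only to identify the
  generators of \<open>specht_module\<close> and the set \<open>B_set\<close>. No dimension count of
  the quotient and no hook formula enters. Independence rests on a definite form, and there the
  obstacle is that a Specht polynomial must be orthogonal to every multiple of a generator, not only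
  to the generator itself. The complement \<open>H\<close> of the ideal consists of honest
  polynomials, so irreducibility is proved there and only then carried along the projection.\<close>

abbreviation (input) "keys \<equiv> Poly_Mapping.keys"
abbreviation (input) "lookup \<equiv> Poly_Mapping.lookup"
abbreviation (input) "single \<equiv> Poly_Mapping.single"

abbreviation coef :: "qpoly \<Rightarrow> (nat \<Rightarrow>\<^sub>0 nat) \<Rightarrow> rat" where
  "coef \<equiv> lookup"

abbreviation monomial :: "(nat \<Rightarrow>\<^sub>0 nat) \<Rightarrow> qpoly" where
  "monomial m \<equiv> single m 1"

definition poly_carrier :: "nat \<Rightarrow> qpoly set" where
  "poly_carrier n = {p. \<forall>m\<in>keys p. keys m \<subseteq> {1..n}}"

lemma const_poly_0 [simp]: "const_poly 0 = 0"
  and const_poly_1 [simp]: "const_poly 1 = 1"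
  and const_poly_add: "const_poly (a + b) = const_poly a + const_poly b"
  and const_poly_mult: "const_poly (a * b) = const_poly a * const_poly b"
  and const_poly_minus: "const_poly (- a) = - const_poly a"
  and const_poly_diff: "const_poly (a - b) = const_poly a - const_poly b"
  by (simp_all add: const_poly_def single_add mult_single single_uminus single_diff)

lemma const_poly_of_nat: "const_poly (of_nat a) = of_nat a"
  by (simp add: const_poly_def)

lemma const_poly_of_int: "const_poly (of_int a) = of_int a"
  by (simp add: const_poly_def)

lemma const_poly_mult_monomial [simp]: "const_poly c * monomial m = single m c"
  by (simp add: const_poly_def mult_single)

lemma coef_const_poly_mult [simp]: "coef (const_poly c * p) m = c * coef p m"
proof -
  have "const_poly c * p = Poly_Mapping.map ((*) c) p"
    by (simp add: const_poly_def mult_map_scale_conv_mult)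
  then show ?thesis by (simp add: Poly_Mapping.map.rep_eq when_def)
qed

text \<open>Spans and subspaces of polynomials are taken in this type-based vector space; the
  carrier-based modules enter only with the quotient and with \<open>specht_module\<close>.\<close>

interpretation Q: vector_space "\<lambda>c p. const_poly c * p :: qpoly"
  by unfold_locales (simp_all add: algebra_simps const_poly_add const_poly_mult)

lemma qpoly_expand: "p = (\<Sum>m\<in>keys p. single m (coef p m))"
proof (rule poly_mapping_eqI)
  fix k
  show "coef p k = coef (\<Sum>m\<in>keys p. single m (coef p m)) k"
    by (cases "k \<in> keys p")
      (auto simp: lookup_sum lookup_single when_def sum.delta in_keys_iff)
qed

text \<open>The case of single terms is limited to monomials of \<open>p\<close> itself, so that
  assumptions about the support of \<open>p\<close> stay available; \<open>subspace_qpolyI\<close>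
  lives on this.\<close>

lemma qpoly_induct [case_names zero add single]:
  assumes "P 0" and "\<And>p q. P p \<Longrightarrow> P q \<Longrightarrow> P (p + q)"
    and "\<And>c m. m \<in> keys p \<Longrightarrow> P (single m c)"
  shows "P (p :: qpoly)"
proof -
  have "P (\<Sum>m\<in>A. single m (coef p m))" if "A \<subseteq> keys p" for A
    using finite_subset[OF that finite_keys] that
    by (induction A rule: finite_induct) (auto intro: assms)
  from this[OF subset_refl] show ?thesis by (simp flip: qpoly_expand)
qed

lemma subspace_qpolyI:
  assumes "Q.subspace W" and "\<And>m. m \<in> keys p \<Longrightarrow> monomial m \<in> W"
  shows "p \<in> W"
proof (induction p rule: qpoly_induct)
  case (single c m)
  then show ?case using Q.subspace_scale[OF assms(1) assms(2), of m c] by simp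
qed (auto intro: Q.subspace_0 Q.subspace_add assms)

lemma xvar_power: "xvar i ^ e = monomial (single i e)"
proof (induction e)
  case (Suc e)
  then show ?case by (simp add: xvar_def mult_single single_add[symmetric])
qed simp

lemma prod_monomial: "(\<Prod>i\<in>A. monomial (f i)) = monomial (\<Sum>i\<in>A. f i)"
  by (induction A rule: infinite_finite_induct) (auto simp: mult_single)

text \<open>Written as a sum rather than as a composition with an inverse, this is additive for
  every function \<sigma>, and so \<open>perm_act\<close> is multiplicative for every \<sigma>.
  Injectivity is asked only where exponents, coefficients or index sets are compared.\<close>

definition perm_exp :: "(nat \<Rightarrow> nat) \<Rightarrow> (nat \<Rightarrow>\<^sub>0 nat) \<Rightarrow> (nat \<Rightarrow>\<^sub>0 nat)" where
  "perm_exp \<sigma> m =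
     (\<Sum>i\<in>keys m. single (\<sigma> i) (lookup m i))"

lemma perm_act_alt:
  "perm_act \<sigma> p = (\<Sum>m\<in>keys p. single (perm_exp \<sigma> m) (coef p m))"
  unfolding perm_act_def xvar_power prod_monomial perm_exp_def by simp

lemma perm_exp_0 [simp]: "perm_exp \<sigma> 0 = 0"
  by (simp add: perm_exp_def)

lemma perm_exp_single [simp]:
  "perm_exp \<sigma> (single i e) = single (\<sigma> i) e"
  by (simp add: perm_exp_def)

lemma perm_exp_add: "perm_exp \<sigma> (m + m') = perm_exp \<sigma> m + perm_exp \<sigma> m'"
  unfolding perm_exp_def by (rule setsum_keys_plus_distrib) (auto simp: single_add)

lemma perm_exp_sum: "perm_exp \<sigma> (sum f A) = (\<Sum>a\<in>A. perm_exp \<sigma> (f a))"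
  by (induction A rule: infinite_finite_induct) (auto simp: perm_exp_add)

lemma perm_exp_comp: "perm_exp \<sigma> (perm_exp \<tau> m) = perm_exp (\<sigma> \<circ> \<tau>) m"
proof -
  have "perm_exp \<sigma> (perm_exp \<tau> m) =
      perm_exp \<sigma> (\<Sum>i\<in>keys m. single (\<tau> i) (lookup m i))"
    by (simp add: perm_exp_def[of \<tau>])
  also have "\<dots> = perm_exp (\<sigma> \<circ> \<tau>) m"
    unfolding perm_exp_sum by (simp add: perm_exp_def[of "\<sigma> \<circ> \<tau>"])
  finally show ?thesis .
qed

lemma exponent_expand:
  "m = (\<Sum>i\<in>keys m. single i (lookup m i))"
proof (rule poly_mapping_eqI)
  fix k
  show "lookup m k = lookup
    (\<Sum>i\<in>keys m. single i (lookup m i)) k"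
    by (cases "k \<in> keys m")
      (auto simp: lookup_sum lookup_single when_def sum.delta in_keys_iff)
qed

lemma perm_exp_id [simp]: "perm_exp id m = m"
  using exponent_expand[of m] by (simp add: perm_exp_def)

lemma lookup_perm_exp:
  assumes "inj \<sigma>"
  shows "lookup (perm_exp \<sigma> m) (\<sigma> i) = lookup m i"
  using injD[OF assms]
  by (cases "i \<in> keys m")
    (auto simp: perm_exp_def lookup_sum lookup_single when_def sum.delta' in_keys_iff
      inj_eq[OF assms])

lemma perm_exp_inj: "inj \<sigma> \<Longrightarrow> perm_exp \<sigma> m = perm_exp \<sigma> m' \<longleftrightarrow> m = m'"
  by (metis lookup_perm_exp poly_mapping_eqI)

lemma keys_perm_exp: "keys (perm_exp \<sigma> m) \<subseteq> \<sigma> ` keys m"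
proof
  fix x assume "x \<in> keys (perm_exp \<sigma> m)"
  then have "lookup (perm_exp \<sigma> m) x \<noteq> 0" by (simp add: in_keys_iff)
  then obtain i where "i \<in> keys m"
      "lookup (single (\<sigma> i) (lookup m i)) x \<noteq> 0"
    unfolding perm_exp_def lookup_sum by (meson sum.neutral)
  then show "x \<in> \<sigma> ` keys m"
    by (auto simp: lookup_single when_def split: if_splits)
qed

lemma perm_act_0 [simp]: "perm_act \<sigma> 0 = 0"
  by (simp add: perm_act_alt)

lemma perm_act_single [simp]:
  "perm_act \<sigma> (single m c) = single (perm_exp \<sigma> m) c"
  by (simp add: perm_act_alt)

lemma perm_act_add: "perm_act \<sigma> (p + q) = perm_act \<sigma> p + perm_act \<sigma> q"
  unfolding perm_act_alt by (rule setsum_keys_plus_distrib) (auto simp: single_add)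

lemma perm_act_sum: "perm_act \<sigma> (sum f A) = (\<Sum>a\<in>A. perm_act \<sigma> (f a))"
  by (induction A rule: infinite_finite_induct) (auto simp: perm_act_add)

lemma perm_act_mult: "perm_act \<sigma> (p * q) = perm_act \<sigma> p * perm_act \<sigma> q"
proof (induction p rule: qpoly_induct)
  case (single c m)
  show ?case
    by (induction q rule: qpoly_induct)
      (auto simp: algebra_simps perm_act_add mult_single perm_exp_add)
qed (auto simp: algebra_simps perm_act_add)

lemma perm_act_const [simp]: "perm_act \<sigma> (const_poly c) = const_poly c"
  by (simp add: const_poly_def)

lemma perm_act_1 [simp]: "perm_act \<sigma> 1 = 1"
  using perm_act_const[of \<sigma> 1] by simp

lemma perm_act_minus: "perm_act \<sigma> (- p) = - perm_act \<sigma> p"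
  using perm_act_add[of \<sigma> "- p" p] by (simp add: eq_neg_iff_add_eq_0)

lemma perm_act_diff: "perm_act \<sigma> (p - q) = perm_act \<sigma> p - perm_act \<sigma> q"
  using perm_act_add[of \<sigma> p "- q"] by (simp add: perm_act_minus)

lemma perm_act_xvar [simp]: "perm_act \<sigma> (xvar i) = xvar (\<sigma> i)"
  by (simp add: xvar_def)

lemma perm_act_prod: "perm_act \<sigma> (prod f A) = (\<Prod>a\<in>A. perm_act \<sigma> (f a))"
  by (induction A rule: infinite_finite_induct) (auto simp: perm_act_mult)

lemma perm_act_id [simp]: "perm_act id p = p"
  using qpoly_expand[of p] by (simp add: perm_act_alt)

lemma perm_act_comp: "perm_act \<sigma> (perm_act \<tau> p) = perm_act (\<sigma> \<circ> \<tau>) p"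
  by (induction p rule: qpoly_induct) (auto simp: perm_act_add perm_exp_comp simp del: comp_apply)

lemma coef_perm_act:
  assumes "inj \<sigma>"
  shows "coef (perm_act \<sigma> p) (perm_exp \<sigma> m) = coef p m"
  by (induction p rule: qpoly_induct)
    (auto simp: perm_act_add lookup_add lookup_single when_def perm_exp_inj[OF assms])

section \<open>The polynomials in the first n variables as a subspace and subring\<close>

lemma carrier_poly_ring [simp]: "carrier (poly_ring n) = poly_carrier n"
  by (simp add: poly_ring_def poly_carrier_def)

lemma poly_carrier_subspace: "Q.subspace (poly_carrier n)"
  unfolding Q.subspace_def
proof (intro conjI ballI allI)
  fix p q assume "p \<in> poly_carrier n" "q \<in> poly_carrier n"
  then show "p + q \<in> poly_carrier n" using keys_add[of p q] unfolding poly_carrier_def by blast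
next
  fix c p assume "p \<in> poly_carrier n"
  then show "const_poly c * p \<in> poly_carrier n" by (auto simp: in_keys_iff poly_carrier_def)
qed (auto simp: poly_carrier_def)

lemmas poly_carrier_0 = Q.subspace_0[OF poly_carrier_subspace]
  and poly_carrier_add = Q.subspace_add[OF poly_carrier_subspace]
  and poly_carrier_diff = Q.subspace_diff[OF poly_carrier_subspace]
  and poly_carrier_neg = Q.subspace_neg[OF poly_carrier_subspace]
  and poly_carrier_scale = Q.subspace_scale[OF poly_carrier_subspace]
  and poly_carrier_sum = Q.subspace_sum[OF poly_carrier_subspace]

lemma keys_exponent_add:
  "keys (a + b) = keys a \<union> keys (b :: nat \<Rightarrow>\<^sub>0 nat)"
  by (auto simp: in_keys_iff lookup_add)

lemma poly_carrier_mult: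
  assumes "p \<in> poly_carrier n" "q \<in> poly_carrier n"
  shows "p * q \<in> poly_carrier n"
  unfolding poly_carrier_def
proof (clarify)
  fix m x assume "m \<in> keys (p * q)" "x \<in> keys m"
  then obtain a b where "m = a + b" "a \<in> keys p" "b \<in> keys q"
    using keys_mult[of p q] by blast
  then show "x \<in> {1..n}"
    using assms \<open>x \<in> keys m\<close> unfolding poly_carrier_def
    by (auto simp del: atLeastAtMost_iff simp: keys_exponent_add)
qed

lemma poly_carrier_1 [simp]: "1 \<in> poly_carrier n"
  by (simp add: poly_carrier_def)

lemma poly_carrier_const [simp]: "const_poly c \<in> poly_carrier n"
  by (simp add: const_poly_def poly_carrier_def)

lemma poly_carrier_xvar: "i \<in> {1..n} \<Longrightarrow> xvar i \<in> poly_carrier n"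
  by (simp add: xvar_def poly_carrier_def)

lemma poly_carrier_prod:
  "(\<And>a. a \<in> A \<Longrightarrow> f a \<in> poly_carrier n) \<Longrightarrow> prod f A \<in> poly_carrier n"
  by (induction A rule: infinite_finite_induct)
    (auto intro: poly_carrier_mult)

lemma poly_carrier_perm_act:
  assumes "\<sigma> permutes {1..n}" "p \<in> poly_carrier n"
  shows "perm_act \<sigma> p \<in> poly_carrier n"
  unfolding perm_act_alt
proof (rule poly_carrier_sum)
  fix m assume "m \<in> keys p"
  then have "keys m \<subseteq> {1..n}" using assms(2) unfolding poly_carrier_def by blast
  then have "keys (perm_exp \<sigma> m) \<subseteq> {1..n}"
    using keys_perm_exp[of \<sigma> m] permutes_image[OF assms(1)] by blast
  then show "single (perm_exp \<sigma> m) (coef p m) \<in> poly_carrier n"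
    by (simp add: poly_carrier_def)
qed

subsection \<open>Squarefree monomials\<close>

definition ind_exp :: "nat set \<Rightarrow> (nat \<Rightarrow>\<^sub>0 nat)" where
  "ind_exp A = (\<Sum>i\<in>A. single i 1)"

definition sqfree_mon :: "nat set \<Rightarrow> qpoly" where
  "sqfree_mon A = (\<Prod>i\<in>A. xvar i)"

lemma sqfree_mon_eq: "sqfree_mon A = monomial (ind_exp A)"
  unfolding sqfree_mon_def xvar_def prod_monomial ind_exp_def ..

lemma lookup_ind_exp:
  "finite A \<Longrightarrow> lookup (ind_exp A) i = (if i \<in> A then 1 else 0)"
  by (simp add: ind_exp_def lookup_sum lookup_single when_def sum.delta)

lemma keys_ind_exp: "finite A \<Longrightarrow> keys (ind_exp A) = A"
  by (auto simp: in_keys_iff lookup_ind_exp split: if_splits)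

lemma ind_exp_inj: "finite A \<Longrightarrow> finite B \<Longrightarrow> ind_exp A = ind_exp B \<longleftrightarrow> A = B"
  by (metis keys_ind_exp)

lemma perm_exp_ind_exp: "inj \<sigma> \<Longrightarrow> perm_exp \<sigma> (ind_exp A) = ind_exp (\<sigma> ` A)"
  unfolding ind_exp_def perm_exp_sum by (subst sum.reindex) (auto intro: inj_on_subset)

lemma perm_act_sqfree_mon: "inj \<sigma> \<Longrightarrow> perm_act \<sigma> (sqfree_mon A) = sqfree_mon (\<sigma> ` A)"
  by (simp add: sqfree_mon_eq perm_exp_ind_exp)

lemma poly_carrier_sqfree_mon: "A \<subseteq> {1..n} \<Longrightarrow> sqfree_mon A \<in> poly_carrier n"
  unfolding sqfree_mon_def by (intro poly_carrier_prod poly_carrier_xvar) blast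

definition exp_deg :: "(nat \<Rightarrow>\<^sub>0 nat) \<Rightarrow> nat" where
  "exp_deg m = (\<Sum>i\<in>keys m. lookup m i)"

lemma exp_deg_add: "exp_deg (a + b) = exp_deg a + exp_deg b"
  unfolding exp_deg_def by (rule setsum_keys_plus_distrib) auto

lemma exp_deg_ind_exp: "finite A \<Longrightarrow> exp_deg (ind_exp A) = card A"
  by (simp add: exp_deg_def keys_ind_exp lookup_ind_exp)

lemma card_keys_le_exp_deg: "card (keys m) \<le> exp_deg m"
proof -
  have "(\<Sum>i\<in>keys m. 1) \<le> exp_deg m"
    unfolding exp_deg_def by (rule sum_mono) (auto simp: in_keys_iff)
  then show ?thesis by simp
qed

subsection \<open>The inner product with orthonormal monomials\<close>

definition ip :: "qpoly \<Rightarrow> qpoly \<Rightarrow> rat" where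
  "ip p q = (\<Sum>m\<in>keys p. coef p m * coef q m)"

lemma ip_superset:
  "finite A \<Longrightarrow> keys p \<subseteq> A \<Longrightarrow> ip p q = (\<Sum>m\<in>A. coef p m * coef q m)"
  unfolding ip_def by (rule sum.mono_neutral_left) (auto simp: in_keys_iff)

lemma ip_commute: "ip p q = ip q p"
proof -
  let ?A = "keys p \<union> keys q"
  have "ip p q = (\<Sum>m\<in>?A. coef p m * coef q m)" "ip q p = (\<Sum>m\<in>?A. coef q m * coef p m)"
    by (rule ip_superset; simp)+
  then show ?thesis by (simp add: mult.commute)
qed

lemma ip_add_right: "ip p (q + r) = ip p q + ip p r"
  by (simp add: ip_def lookup_add algebra_simps sum.distrib)

lemma ip_add_left: "ip (p + q) r = ip p r + ip q r"
  by (metis ip_add_right ip_commute)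

lemma ip_scale_right: "ip p (const_poly c * q) = c * ip p q"
  by (simp add: ip_def sum_distrib_left mult.left_commute)

lemma ip_scale_left: "ip (const_poly c * p) q = c * ip p q"
  by (metis ip_scale_right ip_commute)

lemma ip_0 [simp]: "ip p 0 = 0" "ip 0 p = 0"
  by (simp_all add: ip_def)

lemma ip_uminus_left: "ip (- p) q = - ip p q"
  using ip_scale_left[of "-1" p q] by (simp add: const_poly_minus)

lemma ip_single_left: "ip (single m c) q = c * coef q m"
  by (simp add: ip_def)

text \<open>A sum of squares of rationals vanishes only if every square does. Both the independence
  modulo the ideal and the irreducibility go back to this.\<close>

lemma ip_self_eq_0: "ip p p = 0 \<Longrightarrow> p = 0"
proof -
  assume "ip p p = 0"
  then have "\<forall>m\<in>keys p. coef p m * coef p m = 0"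
    unfolding ip_def by (subst (asm) sum_nonneg_eq_0_iff) auto
  then show ?thesis by (intro poly_mapping_eqI) (auto simp: in_keys_iff)
qed

lemma ip_perm_act:
  assumes "inj \<sigma>"
  shows "ip (perm_act \<sigma> p) (perm_act \<sigma> q) = ip p q"
  by (induction p rule: qpoly_induct)
    (auto simp: perm_act_add ip_add_left ip_single_left coef_perm_act[OF assms])

lemma ip_orthogonal_subspace: "Q.subspace {q. \<forall>p\<in>A. ip p q = 0}"
  by (auto simp: Q.subspace_def ip_add_right ip_scale_right)

section \<open>Products of differences over disjoint pairs\<close>

definition cover :: "(nat \<times> nat) set \<Rightarrow> nat set" where
  "cover M = fst ` M \<union> snd ` M"

text \<open>An oriented matching: \<open>(a, b)\<close> stands for a column with bottom entry
  \<open>a\<close> and top entry \<open>b\<close>. Columns of height one are left out because they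
  contribute no factor to a Specht polynomial.\<close>

definition pairing :: "nat \<Rightarrow> (nat \<times> nat) set \<Rightarrow> bool" where
  "pairing n M \<longleftrightarrow> M \<subseteq> {1..n} \<times> {1..n} \<and> (\<forall>p\<in>M. fst p \<noteq> snd p) \<and>
     (\<forall>p\<in>M. \<forall>q\<in>M. p \<noteq> q \<longrightarrow> {fst p, snd p} \<inter> {fst q, snd q} = {})"

definition pair_poly :: "(nat \<times> nat) set \<Rightarrow> qpoly" where
  "pair_poly M = (\<Prod>p\<in>M. xvar (snd p) - xvar (fst p))"

lemma pairing_finite: "pairing n M \<Longrightarrow> finite M"
  unfolding pairing_def by (meson finite_SigmaI finite_atLeastAtMost finite_subset)

lemma finite_cover: "finite M \<Longrightarrow> finite (cover M)"
  by (simp add: cover_def)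

lemma pairing_cover: "pairing n M \<Longrightarrow> cover M \<subseteq> {1..n}"
  unfolding pairing_def cover_def by force

lemma cover_empty [simp]: "cover {} = {}"
  and cover_insert [simp]: "cover (insert p M) = insert (fst p) (insert (snd p) (cover M))"
  by (auto simp: cover_def)

lemma coverI: "p \<in> M \<Longrightarrow> fst p \<in> cover M" "p \<in> M \<Longrightarrow> snd p \<in> cover M"
  by (auto simp: cover_def)

lemma pairing_empty [simp]: "pairing n {}"
  by (simp add: pairing_def)

lemma pairing_subset: "pairing n M \<Longrightarrow> N \<subseteq> M \<Longrightarrow> pairing n N"
  unfolding pairing_def by blast

lemma pairing_insertI:
  assumes "pairing n M" "a \<in> {1..n}" "b \<in> {1..n}" "a \<noteq> b" "a \<notin> cover M" "b \<notin> cover M"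
  shows "pairing n (insert (a, b) M)" and "(a, b) \<notin> M"
proof -
  have "{fst p, snd p} \<inter> {a, b} = {}" if "p \<in> M" for p
    using assms(5,6) coverI[OF that] by auto
  then show "pairing n (insert (a, b) M)"
    using assms(1-4) unfolding pairing_def by (auto simp del: insert_disjoint)
  show "(a, b) \<notin> M" using assms(5) by (auto simp: cover_def image_iff)
qed

lemma pairing_insertD:
  assumes "pairing n (insert p M)" "p \<notin> M"
  shows "pairing n M" "fst p \<in> {1..n}" "snd p \<in> {1..n}" "fst p \<noteq> snd p"
    "fst p \<notin> cover M" "snd p \<notin> cover M"
proof -
  have *: "{fst p, snd p} \<inter> {fst q, snd q} = {}" if "q \<in> M" for q
  proof -
    have "p \<noteq> q" using that assms(2) by auto
    then show ?thesis using assms(1) that unfolding pairing_def by (simp del: insert_disjoint Int_insert_left)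
  qed
  show "fst p \<notin> cover M" "snd p \<notin> cover M"
    using * unfolding cover_def by blast+
qed (use assms in \<open>auto simp: pairing_def\<close>)

lemma pairing_removeD:
  assumes "pairing n M" "(a, b) \<in> M"
  shows "pairing n (M - {(a, b)})" "a \<in> {1..n}" "b \<in> {1..n}" "a \<noteq> b"
    "a \<notin> cover (M - {(a, b)})" "b \<notin> cover (M - {(a, b)})"
  using pairing_insertD[of n "(a, b)" "M - {(a, b)}"] assms by (auto simp: insert_absorb)

lemma pairing_induct [consumes 1, case_names empty insert]:
  assumes "pairing n M" and "P {}"
    and "\<And>a b M. pairing n M \<Longrightarrow> a \<in> {1..n} \<Longrightarrow> b \<in> {1..n} \<Longrightarrow> a \<noteq> b \<Longrightarrow> a \<notin> cover M \<Longrightarrow>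
      b \<notin> cover M \<Longrightarrow> (a, b) \<notin> M \<Longrightarrow> P M \<Longrightarrow> P (insert (a, b) M)"
  shows "P M"
  using pairing_finite[OF assms(1)] assms(1)
proof (induction M rule: finite_induct)
  case (insert p M)
  then show ?case
    using assms(3)[of M "fst p" "snd p"] pairing_insertD[OF insert.prems insert.hyps(2)] by simp
qed (rule assms(2))

lemma card_cover: "pairing n M \<Longrightarrow> card (cover M) = 2 * card M"
  by (induction rule: pairing_induct) (auto simp: pairing_finite finite_cover)

lemma card_pairing_le: "pairing n M \<Longrightarrow> 2 * card M \<le> n"
  using card_cover[of n M] card_mono[OF _ pairing_cover, of n M] by simp

lemma pair_poly_empty [simp]: "pair_poly {} = 1"
  by (simp add: pair_poly_def)

lemma pair_poly_insert:
  "finite M \<Longrightarrow> p \<notin> M \<Longrightarrow> pair_poly (insert p M) = (xvar (snd p) - xvar (fst p)) * pair_poly M"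
  by (simp add: pair_poly_def)

lemma perm_act_pair_poly:
  "inj \<sigma> \<Longrightarrow> perm_act \<sigma> (pair_poly M) = pair_poly (map_prod \<sigma> \<sigma> ` M)"
  unfolding pair_poly_def perm_act_prod
  by (subst prod.reindex) (auto simp: perm_act_diff intro: inj_on_subset[OF prod.inj_map])

lemma pairing_image:
  assumes "\<sigma> permutes {1..n}" "pairing n M"
  shows "pairing n (map_prod \<sigma> \<sigma> ` M)"
proof -
  have in_iff: "\<sigma> x \<in> {1..n} \<longleftrightarrow> x \<in> {1..n}" for x by (rule permutes_in_image[OF assms(1)])
  have inj: "inj \<sigma>" using assms(1) by (rule permutes_inj)
  have "{\<sigma> (fst p), \<sigma> (snd p)} \<inter> {\<sigma> (fst q), \<sigma> (snd q)} = \<sigma> ` ({fst p, snd p} \<inter> {fst q, snd q})" for p q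
    by (simp only: image_Int[OF inj] image_insert image_empty)
  then show ?thesis using assms(2) unfolding pairing_def
    by (auto simp: in_iff inj_eq[OF inj] simp del: One_nat_def atLeastAtMost_iff insert_disjoint Int_insert_left Int_insert_right)
qed

lemma card_pairing_image: "inj \<sigma> \<Longrightarrow> card (map_prod \<sigma> \<sigma> ` M) = card M"
  by (intro card_image inj_on_subset[OF prod.inj_map]) auto

lemma perm_act_fixes_pair_poly:
  assumes "\<And>x. x \<in> cover M \<Longrightarrow> \<sigma> x = x"
  shows "perm_act \<sigma> (pair_poly M) = pair_poly M"
  unfolding pair_poly_def perm_act_prod
proof (rule prod.cong[OF refl])
  fix p assume "p \<in> M"
  then show "perm_act \<sigma> (xvar (snd p) - xvar (fst p)) = xvar (snd p) - xvar (fst p)"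
    using assms coverI[of p M] by (simp add: perm_act_diff)
qed

text \<open>Since the pairs are disjoint, the transposition touches only the factor of its own pair,
  and it negates that factor.\<close>

lemma pair_poly_antisymmetric:
  assumes "pairing n M" "(a, b) \<in> M"
  shows "perm_act (transpose a b) (pair_poly M) = - pair_poly M"
proof -
  define N where "N = M - {(a, b)}"
  have M: "M = insert (a, b) N" "(a, b) \<notin> N" and fin: "finite N"
    using assms pairing_finite[OF assms(1)] by (auto simp: N_def)
  note N = pairing_removeD[OF assms, folded N_def]
  have "perm_act (transpose a b) (pair_poly N) = pair_poly N"
    by (rule perm_act_fixes_pair_poly) (use N in \<open>auto simp: transpose_def\<close>)
  then show ?thesis
    by (simp add: M(1) pair_poly_insert[OF fin M(2)] perm_act_mult perm_act_diff algebra_simps)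
qed

subsection \<open>Expansion into monomials\<close>

text \<open>Zero unless \<open>A\<close> picks exactly one entry of each pair, and otherwise -1 to
  the number of first entries picked. Elements of \<open>A\<close> outside the cover are ignored, so
  the same number serves as coefficient of \<open>pair_poly M\<close> and as scalar in the formula
  for the antisymmetriser.\<close>

definition pair_coef :: "(nat \<times> nat) set \<Rightarrow> nat set \<Rightarrow> rat" where
  "pair_coef M A = (\<Prod>p\<in>M. of_bool (snd p \<in> A) - of_bool (fst p \<in> A))"

lemma pair_coef_cong:
  "(\<And>x. x \<in> cover M \<Longrightarrow> x \<in> A \<longleftrightarrow> x \<in> B) \<Longrightarrow> pair_coef M A = pair_coef M B"
  unfolding pair_coef_def by (rule prod.cong) (auto simp: cover_def)

lemma pair_coef_insert:
  "finite M \<Longrightarrow> p \<notin> M \<Longrightarrow>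
   pair_coef (insert p M) A = (of_bool (snd p \<in> A) - of_bool (fst p \<in> A)) * pair_coef M A"
  by (simp add: pair_coef_def)

lemma pair_coef_nonzero:
  "finite M \<Longrightarrow> pair_coef M A \<noteq> 0 \<longleftrightarrow> (\<forall>p\<in>M. snd p \<in> A \<longleftrightarrow> fst p \<notin> A)"
  by (auto simp: pair_coef_def of_bool_def split: if_splits)

lemma card_transversal:
  assumes "pairing n M" "pair_coef M A \<noteq> 0"
  shows "card (A \<inter> cover M) = card M"
  using assms
proof (induction rule: pairing_induct)
  case (insert a b M)
  note fin = pairing_finite[OF insert.hyps(1)]
  from insert.prems have c: "pair_coef M A \<noteq> 0" "b \<in> A \<longleftrightarrow> a \<notin> A"
    using insert.hyps by (auto simp: pair_coef_insert[OF fin] split: if_splits)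
  have "A \<inter> cover (insert (a, b) M) = insert (if a \<in> A then a else b) (A \<inter> cover M)"
    using c(2) by auto
  then show ?case using insert c fin by (auto simp: finite_cover)
qed simp

lemma sum_Pow_insert:
  assumes "finite C" "a \<notin> C"
  shows "(\<Sum>A\<in>Pow (insert a C). g A) = (\<Sum>A\<in>Pow C. g A + g (insert a A))"
proof -
  have "inj_on (insert a) (Pow C)" using assms(2) by (auto simp: inj_on_def)
  moreover have "Pow C \<inter> insert a ` Pow C = {}" using assms(2) by auto
  ultimately show ?thesis
    using assms(1) by (simp add: Pow_insert sum.union_disjoint sum.reindex sum.distrib)
qed

lemma sqfree_mon_insert:
  "finite A \<Longrightarrow> a \<notin> A \<Longrightarrow> sqfree_mon (insert a A) = xvar a * sqfree_mon A"
  by (simp add: sqfree_mon_def)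

lemma sqfree_mon_empty [simp]: "sqfree_mon {} = 1"
  by (simp add: sqfree_mon_def)

lemma pair_poly_expand:
  assumes "pairing n M"
  shows "pair_poly M = (\<Sum>A\<in>Pow (cover M). const_poly (pair_coef M A) * sqfree_mon A)"
  using assms
proof (induction rule: pairing_induct)
  case empty
  then show ?case by (simp add: pair_coef_def)
next
  case (insert a b M)
  note fin = pairing_finite[OF insert.hyps(1)]
  let ?g = "\<lambda>A. const_poly (pair_coef (insert (a, b) M) A) * sqfree_mon A"
  \<comment> \<open>The subsets of the enlarged cover come in groups of four, according to which of
    \<open>a\<close> and \<open>b\<close> they contain. Those with neither or both have coefficient
    0, and the other two make up the new factor.\<close>
  have expand: "?g A + ?g (insert a A) + (?g (insert b A) + ?g (insert a (insert b A))) =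
      (xvar b - xvar a) * (const_poly (pair_coef M A) * sqfree_mon A)"
    if "A \<in> Pow (cover M)" for A
  proof -
    have A: "finite A" "a \<notin> A" "b \<notin> A"
      using that insert.hyps finite_subset[OF _ finite_cover[OF fin]] by auto
    have "pair_coef M (insert a A) = pair_coef M A" "pair_coef M (insert b A) = pair_coef M A"
      using insert.hyps by (auto intro!: pair_coef_cong)
    then show ?thesis using A insert.hyps
      by (simp add: pair_coef_insert[OF fin] sqfree_mon_insert const_poly_minus algebra_simps)
  qed
  have C: "finite (cover M)" "b \<notin> cover M" "finite (insert b (cover M))" "a \<notin> insert b (cover M)"
    using insert.hyps fin by (auto simp: finite_cover)
  have "pair_poly (insert (a, b) M) =
      (\<Sum>A\<in>Pow (cover M). (xvar b - xvar a) * (const_poly (pair_coef M A) * sqfree_mon A))"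
    using insert.hyps(7) fin by (simp add: pair_poly_insert insert.IH sum_distrib_left)
  also have "\<dots> = (\<Sum>A\<in>Pow (cover M).
      ?g A + ?g (insert a A) + (?g (insert b A) + ?g (insert a (insert b A))))"
    by (rule sum.cong[OF refl]) (rule expand[symmetric])
  also have "\<dots> = (\<Sum>A\<in>Pow (insert a (insert b (cover M))). ?g A)"
    by (simp only: sum_Pow_insert[OF C(3,4)] sum_Pow_insert[OF C(1,2)])
  finally show ?case by simp
qed

lemma coef_pair_poly:
  assumes "pairing n M" "finite A"
  shows "coef (pair_poly M) (ind_exp A) = (if A \<subseteq> cover M then pair_coef M A else 0)"
proof -
  have fin: "finite (cover M)" using assms(1) by (simp add: finite_cover pairing_finite)
  have "coef (pair_poly M) (ind_exp A) =
      (\<Sum>B\<in>Pow (cover M). if B = A then pair_coef M B else 0)"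
    unfolding pair_poly_expand[OF assms(1)] lookup_sum
    by (rule sum.cong)
      (use assms(2) in \<open>auto simp: sqfree_mon_eq lookup_single when_def
        ind_exp_inj finite_subset[OF _ fin]\<close>)
  then show ?thesis using fin by simp
qed

lemma keys_pair_poly:
  assumes "pairing n M" "m \<in> keys (pair_poly M)"
  obtains A where "A \<subseteq> cover M" "finite A" "pair_coef M A \<noteq> 0" "m = ind_exp A"
proof -
  have fin: "finite (cover M)" using assms(1) by (simp add: finite_cover pairing_finite)
  have "coef (pair_poly M) m \<noteq> 0" using assms(2) by (simp add: in_keys_iff)
  then obtain A where A: "A \<in> Pow (cover M)"
      "coef (const_poly (pair_coef M A) * sqfree_mon A) m \<noteq> 0"
    unfolding pair_poly_expand[OF assms(1)] lookup_sum by (meson sum.neutral)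
  then show ?thesis using finite_subset[OF _ fin, of A]
    by (intro that[of A]) (auto simp: sqfree_mon_eq lookup_single when_def split: if_splits)
qed

definition sqfree_homog :: "nat \<Rightarrow> qpoly set" where
  "sqfree_homog d =
     {p. \<forall>m\<in>keys p. \<exists>A. finite A \<and> card A = d \<and> m = ind_exp A}"

lemma sqfree_homog_subspace: "Q.subspace (sqfree_homog d)"
  unfolding Q.subspace_def
proof (intro conjI ballI allI)
  fix p q assume "p \<in> sqfree_homog d" "q \<in> sqfree_homog d"
  then show "p + q \<in> sqfree_homog d"
    using keys_add[of p q] unfolding sqfree_homog_def by blast
next
  fix c p assume "p \<in> sqfree_homog d"
  then show "const_poly c * p \<in> sqfree_homog d" by (auto simp: sqfree_homog_def in_keys_iff)
qed (auto simp: sqfree_homog_def)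

lemma pair_poly_sqfree_homog:
  assumes "pairing n M"
  shows "pair_poly M \<in> sqfree_homog (card M)"
  unfolding sqfree_homog_def
proof (clarify)
  fix m assume "m \<in> keys (pair_poly M)"
  then obtain A where A: "A \<subseteq> cover M" "finite A" "pair_coef M A \<noteq> 0" "m = ind_exp A"
    by (rule keys_pair_poly[OF assms])
  then have "card A = card M"
    using card_transversal[OF assms A(3)] by (simp add: Int_absorb2)
  then show "\<exists>A. finite A \<and> card A = card M \<and> m = ind_exp A" using A by blast
qed

lemma pair_poly_nonzero:
  assumes "pairing n M"
  shows "pair_poly M \<noteq> 0"
proof -
  have fin: "finite M" using assms by (rule pairing_finite)
  have "pair_coef M (snd ` M) \<noteq> 0"
    unfolding pair_coef_nonzero[OF fin]
  proof
    fix p assume p: "p \<in> M"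
    have "fst p \<noteq> snd q" if "q \<in> M" for q
      using assms p that unfolding pairing_def by (cases "p = q") (blast, fastforce)
    then show "snd p \<in> snd ` M \<longleftrightarrow> fst p \<notin> snd ` M" using p by blast
  qed
  then have "coef (pair_poly M) (ind_exp (snd ` M)) \<noteq> 0"
    using coef_pair_poly[OF assms, of "snd ` M"] fin by (simp add: cover_def)
  then show ?thesis by auto
qed

lemma pair_poly_carrier:
  assumes "pairing n M"
  shows "pair_poly M \<in> poly_carrier n"
  unfolding pair_poly_def using assms
  by (intro poly_carrier_prod poly_carrier_diff poly_carrier_xvar) (auto simp: pairing_def)

subsection \<open>The column antisymmetriser\<close>

text \<open>The column group of a filling with column pairs \<open>M\<close>: for a pairing it is
  the elementary abelian 2-group generated by the transpositions of the pairs.\<close>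

definition pair_stab :: "(nat \<times> nat) set \<Rightarrow> (nat \<Rightarrow> nat) set" where
  "pair_stab M = {\<tau>. \<tau> permutes cover M \<and> (\<forall>p\<in>M. \<tau> ` {fst p, snd p} = {fst p, snd p})}"

definition alternate :: "(nat \<times> nat) set \<Rightarrow> qpoly \<Rightarrow> qpoly" where
  "alternate M f = (\<Sum>\<tau>\<in>pair_stab M. of_int (sign \<tau>) * perm_act \<tau> f)"

lemma finite_pair_stab: "finite M \<Longrightarrow> finite (pair_stab M)"
  unfolding pair_stab_def
  by (rule finite_subset[OF _ finite_permutations[OF finite_cover]]) auto

text \<open>An element of the larger group either fixes \<open>a\<close>, and then also
  \<open>b\<close>, or does so after composition with \<open>transpose a b\<close>. The larger group
  thus consists of two cosets of the smaller one.\<close>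

lemma pair_stab_insert:
  assumes "pairing n (insert (a, b) M)" "(a, b) \<notin> M"
  shows "pair_stab (insert (a, b) M) = pair_stab M \<union> (\<lambda>\<tau>. transpose a b \<circ> \<tau>) ` pair_stab M"
    (is "?L = ?R")
    and "pair_stab M \<inter> (\<lambda>\<tau>. transpose a b \<circ> \<tau>) ` pair_stab M = {}"
proof -
  note ab = pairing_insertD[OF assms, simplified]
  have fixed: "\<tau> a = a" "\<tau> b = b" if "\<tau> \<in> pair_stab M" for \<tau>
    using that ab by (auto simp: pair_stab_def dest: permutes_not_in)
  have inv: "transpose a b \<circ> (transpose a b \<circ> \<tau>) = \<tau>" for \<tau>
    by (simp add: comp_assoc[symmetric])
  have tr_pair: "transpose a b ` {fst p, snd p} = {fst p, snd p}" if "p \<in> M" for p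
    using ab coverI[OF that] by (auto simp: transpose_def)
  have sub: "\<tau> \<in> pair_stab M" if "\<tau> \<in> ?L" "\<tau> a = a" for \<tau>
  proof -
    have "\<tau> ` {a, b} = {a, b}" and p: "\<tau> permutes insert a (insert b (cover M))"
      using that by (auto simp: pair_stab_def)
    then have "\<tau> b = b" using that(2) ab(4) injD[OF permutes_inj[OF p], of a b] by force
    then have "\<tau> permutes cover M"
      using that(2) by (intro permutes_superset[OF p]) auto
    then show ?thesis using that(1) by (auto simp: pair_stab_def)
  qed
  have tr_perm: "transpose a b permutes insert a (insert b (cover M))"
    by (rule permutes_swap_id) auto
  have tr_mem: "transpose a b \<circ> \<tau> \<in> ?L" if "\<tau> \<in> ?L" for \<tau>
  proof -
    have "(transpose a b \<circ> \<tau>) permutes insert a (insert b (cover M))"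
      using that tr_perm by (auto simp: pair_stab_def intro: permutes_compose)
    moreover have "(transpose a b \<circ> \<tau>) ` {a, b} = {a, b}"
    proof -
      have "\<tau> ` {a, b} = {a, b}" using that by (simp add: pair_stab_def del: image_insert)
      moreover have "transpose a b ` {a, b} = {a, b}" by auto
      ultimately show ?thesis by (simp only: image_comp[symmetric])
    qed
    moreover have "(transpose a b \<circ> \<tau>) ` {fst p, snd p} = {fst p, snd p}" if "p \<in> M" for p
    proof -
      have "\<tau> ` {fst p, snd p} = {fst p, snd p}"
        using that \<open>\<tau> \<in> ?L\<close> by (simp add: pair_stab_def del: image_insert)
      then show ?thesis by (simp only: image_comp[symmetric] tr_pair[OF that])
    qed
    ultimately show ?thesis by (simp add: pair_stab_def del: image_insert)
  qed
  have sup: "\<tau> \<in> ?L" if "\<tau> \<in> pair_stab M" for \<tau>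
    using that fixed[OF that] permutes_subset[of \<tau> "cover M" "insert a (insert b (cover M))"]
    by (auto simp: pair_stab_def)
  show "?L = ?R"
  proof (rule equalityI; rule subsetI)
    fix \<tau> assume L: "\<tau> \<in> ?L"
    then have "\<tau> a = a \<or> \<tau> a = b" by (auto simp: pair_stab_def)
    then show "\<tau> \<in> ?R"
    proof
      assume "\<tau> a = a"
      then show ?thesis using sub[OF L] by simp
    next
      assume "\<tau> a = b"
      then have "transpose a b \<circ> \<tau> \<in> pair_stab M" using sub[OF tr_mem[OF L]] by simp
      then show ?thesis using inv[of \<tau>] by (metis UnI2 imageI)
    qed
  next
    fix \<tau> assume "\<tau> \<in> ?R"
    then show "\<tau> \<in> ?L" using sup tr_mem[OF sup] by blast
  qed
  show "pair_stab M \<inter> (\<lambda>\<tau>. transpose a b \<circ> \<tau>) ` pair_stab M = {}"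
  proof -
    have "transpose a b \<circ> \<tau> \<notin> pair_stab M" if "\<tau> \<in> pair_stab M" for \<tau>
      using fixed(1)[OF that] fixed(1)[of "transpose a b \<circ> \<tau>"] ab(4) by auto
    then show ?thesis by blast
  qed
qed

text \<open>The two cosets of \<open>pair_stab_insert\<close> carry opposite signs. Iterated, the
  antisymmetriser is the product of the operators 1 - (a b) over all pairs, which is what makes
  induction over pairs possible.\<close>

lemma alternate_insert:
  assumes "pairing n (insert (a, b) M)" "(a, b) \<notin> M"
  shows "alternate (insert (a, b) M) f = alternate M f - perm_act (transpose a b) (alternate M f)"
proof -
  note ab = pairing_insertD[OF assms, simplified]
  have fin: "finite M" "finite (cover M)" using pairing_finite[OF ab(1)] finite_cover by auto
  have inj: "inj_on (\<lambda>\<tau>. transpose a b \<circ> \<tau>) (pair_stab M)"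
  proof (rule inj_onI)
    fix \<sigma> \<tau> assume "transpose a b \<circ> \<sigma> = transpose a b \<circ> \<tau>"
    then have "transpose a b \<circ> (transpose a b \<circ> \<sigma>) = transpose a b \<circ> (transpose a b \<circ> \<tau>)"
      by (rule arg_cong)
    then show "\<sigma> = \<tau>" by (simp add: comp_assoc[symmetric])
  qed
  have "sign (transpose a b \<circ> \<tau>) = - sign \<tau>" if "\<tau> \<in> pair_stab M" for \<tau>
    using that fin(2) ab(4)
    by (subst sign_compose) (auto simp: pair_stab_def sign_swap_id permutation_swap_id
        intro: permutation_permutes[THEN iffD2])
  then show ?thesis
    unfolding alternate_def pair_stab_insert(1)[OF assms]
    using pair_stab_insert(2)[OF assms] finite_pair_stab[OF fin(1)] inj
    by (simp add: sum.union_disjoint sum.reindex perm_act_sum perm_act_mult sum_negf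
        perm_act_comp flip: const_poly_of_int)
qed

text \<open>A pair with none or both of its entries in \<open>A\<close> kills the monomial, because
  its transposition fixes it. A pair with one entry in \<open>A\<close> turns that variable into
  plus or minus the difference, and variables outside the cover are not moved at all.\<close>

lemma alternate_sqfree_mon:
  assumes "pairing n M" "finite A"
  shows "alternate M (sqfree_mon A) =
    const_poly (pair_coef M A) * pair_poly M * sqfree_mon (A - cover M)"
  using assms(1)
proof (induction rule: pairing_induct)
  case empty
  have "pair_stab {} = {id}" by (auto simp: pair_stab_def)
  then show ?case by (simp add: alternate_def pair_coef_def)
next
  case (insert a b M)
  note fin = pairing_finite[OF insert.hyps(1)]
  have ins: "pairing n (insert (a, b) M)" using insert.hyps by (intro pairing_insertI)
  define A' where "A' = A - cover M - {a, b}"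
  \<comment> \<open>The part of the monomial in the variables of the new pair. The new transposition
    acts on \<open>u\<close> alone, since it fixes \<open>pair_poly M\<close> and the remaining
    variables \<open>A'\<close>.\<close>
  define u where "u = (if a \<in> A then xvar a else 1) * (if b \<in> A then xvar b else 1)"
  have "sqfree_mon (A - cover M) = u * sqfree_mon A'"
  proof -
    have A': "finite A'" "a \<notin> A'" "b \<notin> A'" using assms(2) by (auto simp: A'_def)
    have "A - cover M = (if a \<in> A then {a} else {}) \<union> (if b \<in> A then {b} else {}) \<union> A'"
      using insert.hyps by (auto simp: A'_def)
    then show ?thesis using A' insert.hyps(4)
      by (cases "a \<in> A"; cases "b \<in> A") (simp_all add: u_def sqfree_mon_insert)
  qed
  moreover have "perm_act (transpose a b) (sqfree_mon A') = sqfree_mon A'"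
  proof -
    have "transpose a b ` A' = A'"
      by (auto simp: A'_def transpose_def image_iff)
    then show ?thesis by (simp add: perm_act_sqfree_mon)
  qed
  moreover have "perm_act (transpose a b) (pair_poly M) = pair_poly M"
    using insert.hyps by (intro perm_act_fixes_pair_poly) (auto simp: transpose_def)
  moreover have diff: "u - perm_act (transpose a b) u =
      const_poly (of_bool (b \<in> A) - of_bool (a \<in> A)) * (xvar b - xvar a)"
    by (cases "a \<in> A"; cases "b \<in> A") (simp_all add: u_def perm_act_mult const_poly_minus)
  moreover have rest: "A - cover (insert (a, b) M) = A'" by (auto simp: A'_def)
  ultimately have "alternate (insert (a, b) M) (sqfree_mon A) =
      const_poly (pair_coef M A) * pair_poly M * (u * sqfree_mon A') -
      const_poly (pair_coef M A) * pair_poly M * (perm_act (transpose a b) u * sqfree_mon A')"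
    unfolding alternate_insert[OF ins insert.hyps(7)] insert.IH
    by (simp only: perm_act_mult perm_act_const)
  also have "\<dots> =
      const_poly (pair_coef M A) * pair_poly M * (u - perm_act (transpose a b) u) * sqfree_mon A'"
    by (simp only: algebra_simps)
  also have "\<dots> = const_poly (pair_coef (insert (a, b) M) A) * pair_poly (insert (a, b) M) *
      sqfree_mon (A - cover (insert (a, b) M))"
    unfolding diff rest
    by (simp only: pair_coef_insert[OF fin insert.hyps(7)] pair_poly_insert[OF fin insert.hyps(7)]
        const_poly_mult fst_conv snd_conv mult_ac)
  finally show ?case .
qed

lemma alternate_add: "alternate M (f + g) = alternate M f + alternate M g"
  by (simp add: alternate_def perm_act_add distrib_left sum.distrib)

lemma alternate_scale: "alternate M (const_poly c * f) = const_poly c * alternate M f"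
  by (simp add: alternate_def perm_act_mult sum_distrib_left mult.left_commute)

lemma alternate_0 [simp]: "alternate M 0 = 0"
  by (simp add: alternate_def)

text \<open>A surviving monomial meets every pair once; having degree \<open>card M\<close> it then
  lies inside the cover and leaves no extra factor. The scalar is its coefficient in the Specht
  polynomial, so on this degree the antisymmetriser has rank one.\<close>

lemma alternate_sqfree_homog:
  assumes "pairing n M" "f \<in> sqfree_homog (card M)"
  shows "alternate M f = const_poly (ip (pair_poly M) f) * pair_poly M"
proof -
  have "Q.subspace {f. alternate M f = const_poly (ip (pair_poly M) f) * pair_poly M}"
    unfolding Q.subspace_def
    by (simp add: alternate_add alternate_scale ip_add_right ip_scale_right const_poly_add
        distrib_right)
  moreover have "monomial m \<in> {f. alternate M f = const_poly (ip (pair_poly M) f) * pair_poly M}"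
    if m: "m \<in> keys f" for m
  proof -
    obtain A where A: "finite A" "card A = card M" "m = ind_exp A"
      using assms(2) m unfolding sqfree_homog_def by blast
    have ip: "ip (pair_poly M) (monomial m) = (if A \<subseteq> cover M then pair_coef M A else 0)"
      using coef_pair_poly[OF assms(1) A(1)]
      by (subst ip_commute) (simp add: ip_single_left A(3))
    have alt: "alternate M (monomial m) =
        const_poly (pair_coef M A) * pair_poly M * sqfree_mon (A - cover M)"
      using alternate_sqfree_mon[OF assms(1) A(1)] by (simp only: A(3) sqfree_mon_eq)
    show ?thesis
    proof (cases "pair_coef M A = 0")
      case True
      then show ?thesis by (simp add: alt ip)
    next
      case False
      then have "card (A \<inter> cover M) = card A"
        using card_transversal[OF assms(1) False] A(2) by simp
      then have "A \<inter> cover M = A" using A(1) by (intro card_subset_eq) auto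
      then have sub: "A \<subseteq> cover M" by blast
      then have "sqfree_mon (A - cover M) = 1" by (metis Diff_eq_empty_iff sqfree_mon_empty)
      then show ?thesis using sub by (simp add: alt ip)
    qed
  qed
  ultimately have "f \<in> {f. alternate M f = const_poly (ip (pair_poly M) f) * pair_poly M}"
    by (rule subspace_qpolyI)
  then show ?thesis by simp
qed

subsection \<open>Irreducibility\<close>

text \<open>Spanned by the pairings of one size without any condition of order, so that stability
  under permutations is immediate; the reduction to standard pairings is the separate theorem
  \<open>specht_span_standard\<close>.\<close>

definition specht_span :: "nat \<Rightarrow> nat \<Rightarrow> qpoly set" where
  "specht_span n d = Q.span {pair_poly M | M. pairing n M \<and> card M = d}"

lemma specht_span_subspace [simp]: "Q.subspace (specht_span n d)"
  by (simp add: specht_span_def)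

lemma pair_poly_in_specht_span: "pairing n M \<Longrightarrow> pair_poly M \<in> specht_span n (card M)"
  unfolding specht_span_def by (rule Q.span_base) blast

lemma specht_span_leI:
  assumes "Q.subspace W" "\<And>M. pairing n M \<Longrightarrow> card M = d \<Longrightarrow> pair_poly M \<in> W"
  shows "specht_span n d \<subseteq> W"
  unfolding specht_span_def using assms by (intro Q.span_minimal) auto

lemma specht_span_sqfree_homog: "specht_span n d \<subseteq> sqfree_homog d"
  by (rule specht_span_leI[OF sqfree_homog_subspace]) (auto intro: pair_poly_sqfree_homog)

lemma specht_span_carrier: "specht_span n d \<subseteq> poly_carrier n"
  by (rule specht_span_leI[OF poly_carrier_subspace pair_poly_carrier])

lemma perm_act_subspace:
  "Q.subspace W \<Longrightarrow> Q.subspace {p. perm_act \<sigma> p \<in> W}"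
  by (auto simp: Q.subspace_def perm_act_add perm_act_mult)

lemma specht_span_perm_act:
  assumes "\<sigma> permutes {1..n}" "p \<in> specht_span n d"
  shows "perm_act \<sigma> p \<in> specht_span n d"
proof -
  have inj: "inj \<sigma>" using assms(1) by (rule permutes_inj)
  have "specht_span n d \<subseteq> {p. perm_act \<sigma> p \<in> specht_span n d}"
  proof (rule specht_span_leI[OF perm_act_subspace[OF specht_span_subspace]])
    fix M assume "pairing n M" "card M = d"
    then show "pair_poly M \<in> {p. perm_act \<sigma> p \<in> specht_span n d}"
      using pair_poly_in_specht_span[OF pairing_image[OF assms(1)], of M]
      by (simp add: perm_act_pair_poly[OF inj] card_pairing_image[OF inj])
  qed
  then show ?thesis using assms(2) by blast
qed

lemma permutes_extend:
  assumes "finite S" "A \<subseteq> S" "B \<subseteq> S" "bij_betw f A B"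
  obtains \<sigma> where "\<sigma> permutes S" "\<And>x. x \<in> A \<Longrightarrow> \<sigma> x = f x"
proof -
  have fin: "finite A" "finite B" using assms finite_subset by auto
  then have "card (S - A) = card (S - B)"
    using assms bij_betw_same_card[OF assms(4)] by (simp add: card_Diff_subset)
  then obtain g where g: "bij_betw g (S - A) (S - B)"
    using assms(1) by (meson finite_Diff finite_same_card_bij)
  define \<sigma> where "\<sigma> x = (if x \<in> A then f x else if x \<in> S then g x else x)" for x
  have "bij_betw \<sigma> (A \<union> (S - A)) (B \<union> (S - B))"
  proof (rule bij_betw_combine)
    show "bij_betw \<sigma> A B" using assms(4) by (subst bij_betw_cong[of A \<sigma> f]) (auto simp: \<sigma>_def)
    show "bij_betw \<sigma> (S - A) (S - B)"
      using g by (subst bij_betw_cong[of "S - A" \<sigma> g]) (auto simp: \<sigma>_def)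
  qed auto
  then have "bij_betw \<sigma> S S" using assms(2,3) by (simp add: Un_absorb1)
  then have "\<sigma> permutes S" by (rule bij_imp_permutes) (use assms(2) in \<open>auto simp: \<sigma>_def\<close>)
  then show thesis by (rule that) (simp add: \<sigma>_def)
qed

text \<open>All pairings of one size form a single orbit, orientation included. In the
  irreducibility proof this spreads one Specht polynomial to all of the same degree.\<close>

lemma pairing_transitive:
  assumes "pairing n M" "pairing n N" "card M = card N"
  obtains \<sigma> where "\<sigma> permutes {1..n}" "map_prod \<sigma> \<sigma> ` M = N"
proof -
  have "\<exists>f. bij_betw f (cover M) (cover N) \<and> map_prod f f ` M = N"
    using assms
  proof (induction arbitrary: N rule: pairing_induct)
    case empty
    then show ?case using pairing_finite[of n N] by (auto simp: bij_betw_def)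
  next
    case (insert a b M)
    have finM: "finite M" using insert.hyps(1) by (rule pairing_finite)
    have finN: "finite N" using insert.prems(1) by (rule pairing_finite)
    have "N \<noteq> {}" using insert.prems(2) insert.hyps(7) finM by auto
    then obtain a' b' where ab': "(a', b') \<in> N" by (metis equals0I surj_pair)
    define N' where "N' = N - {(a', b')}"
    note N' = pairing_removeD[OF insert.prems(1) ab', folded N'_def]
    have N: "N = insert (a', b') N'" using ab' by (auto simp: N'_def)
    have "card M = card N'" using insert.prems(2) insert.hyps(7) finM finN ab'
      by (simp add: N'_def)
    then obtain f where f: "bij_betw f (cover M) (cover N')" "map_prod f f ` M = N'"
      using insert.IH[OF N'(1)] by blast
    define g where "g = f(a := a', b := b')"
    have gf: "g x = f x" if "x \<in> cover M" for x
      using that insert.hyps by (auto simp: g_def)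
    have "bij_betw g (cover M) (cover N')"
      using f(1) gf by (subst bij_betw_cong[of _ g f]) auto
    moreover have "bij_betw g {a, b} {a', b'}"
      using insert.hyps(4) N'(4) by (auto simp: g_def bij_betw_def inj_on_def)
    ultimately have "bij_betw g (cover M \<union> {a, b}) (cover N' \<union> {a', b'})"
      using N' by (intro bij_betw_combine) auto
    moreover have "map_prod g g p = map_prod f f p" if "p \<in> M" for p
      using gf coverI[OF that] by (cases p) auto
    then have "map_prod g g ` M = map_prod f f ` M" by (rule image_cong[OF refl])
    moreover have "map_prod g g (a, b) = (a', b')" using insert.hyps(4) by (simp add: g_def)
    ultimately show ?case using f(2) unfolding N
      by (intro exI[of _ g]) (auto simp: Un_commute insert_commute)
  qed
  then obtain f where f: "bij_betw f (cover M) (cover N)" "map_prod f f ` M = N" by blast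
  obtain \<sigma> where \<sigma>: "\<sigma> permutes {1..n}" "\<And>x. x \<in> cover M \<Longrightarrow> \<sigma> x = f x"
    using permutes_extend[OF _ pairing_cover[OF assms(1)] pairing_cover[OF assms(2)] f(1)] by auto
  have "map_prod \<sigma> \<sigma> p = map_prod f f p" if "p \<in> M" for p
    using \<sigma>(2) coverI[OF that] by (cases p) auto
  then have "map_prod \<sigma> \<sigma> ` M = map_prod f f ` M" by (rule image_cong[OF refl])
  then show thesis using that \<sigma>(1) f(2) by simp
qed

lemma specht_span_irreducible:
  assumes "Q.subspace U" "U \<subseteq> specht_span n d"
    and stable: "\<And>\<sigma> u. \<sigma> permutes {1..n} \<Longrightarrow> u \<in> U \<Longrightarrow> perm_act \<sigma> u \<in> U"
  shows "U = {0} \<or> U = specht_span n d"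
proof (cases "U = {0}")
  case False
  then obtain u where u: "u \<in> U" "u \<noteq> 0" using Q.subspace_0[OF assms(1)] by blast
  \<comment> \<open>Otherwise \<open>u\<close> would be orthogonal to the whole span, hence to
    itself.\<close>
  have "\<exists>M. pairing n M \<and> card M = d \<and> ip u (pair_poly M) \<noteq> 0"
  proof (rule ccontr)
    assume "\<not> ?thesis"
    then have "specht_span n d \<subseteq> {q. \<forall>p\<in>{u}. ip p q = 0}"
      by (intro specht_span_leI ip_orthogonal_subspace) auto
    then have "ip u u = 0" using u(1) assms(2) by blast
    then show False using u(2) ip_self_eq_0 by blast
  qed
  then obtain M where M: "pairing n M" "card M = d" "ip u (pair_poly M) \<noteq> 0" by blast
  have "alternate M u \<in> U"
    unfolding alternate_def
  proof (rule Q.subspace_sum[OF assms(1)])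
    fix \<tau> assume "\<tau> \<in> pair_stab M"
    then have "\<tau> permutes {1..n}"
      using pairing_cover[OF M(1)] permutes_subset unfolding pair_stab_def by blast
    then show "of_int (sign \<tau>) * perm_act \<tau> u \<in> U"
      using Q.subspace_scale[OF assms(1) stable[OF _ u(1)]] const_poly_of_int by metis
  qed
  moreover have "alternate M u = const_poly (ip (pair_poly M) u) * pair_poly M"
    using u(1) assms(2) specht_span_sqfree_homog M(1,2) by (intro alternate_sqfree_homog) auto
  moreover define c where "c = ip (pair_poly M) u"
  ultimately have "const_poly (inverse c) * (const_poly c * pair_poly M) \<in> U"
    by (auto intro: Q.subspace_scale[OF assms(1)] simp del: Q.scale_scale)
  moreover have "const_poly (inverse c) * (const_poly c * pair_poly M) = pair_poly M"
    using M(3) unfolding mult.assoc[symmetric] const_poly_mult[symmetric]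
    by (simp add: c_def ip_commute[of u])
  ultimately have "pair_poly M \<in> U" by (simp only:)
  then have "pair_poly N \<in> U" if N: "pairing n N" "card N = d" for N
  proof -
    obtain \<sigma> where \<sigma>: "\<sigma> permutes {1..n}" "map_prod \<sigma> \<sigma> ` M = N"
      using pairing_transitive[OF M(1) N(1)] N(2) M(2) by auto
    then show ?thesis
      using stable[OF \<sigma>(1) \<open>pair_poly M \<in> U\<close>] by (simp add: perm_act_pair_poly permutes_inj)
  qed
  then have "specht_span n d \<subseteq> U" by (rule specht_span_leI[OF assms(1)])
  then show ?thesis using assms(2) by blast
qed simp

section \<open>Straightening\<close>

text \<open>The columns of height two of a standard tableau. The conditions after
  \<open>pairing\<close> say that columns increase, that the top row increases once the columns are
  ordered by their bottom entries, and that the bottom entries without partner come after those with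
  one.\<close>

definition standard_pairing :: "nat \<Rightarrow> (nat \<times> nat) set \<Rightarrow> bool" where
  "standard_pairing n M \<longleftrightarrow> pairing n M \<and> (\<forall>p\<in>M. fst p < snd p) \<and>
     (\<forall>p\<in>M. \<forall>q\<in>M. fst p < fst q \<longrightarrow> snd p < snd q) \<and>
     (\<forall>p\<in>M. \<forall>s\<in>{1..n} - cover M. fst p < s)"

lemma orient_pairing:
  assumes "pairing n M"
  shows "\<exists>N. pairing n N \<and> card N = card M \<and> cover N = cover M \<and> (\<forall>p\<in>N. fst p < snd p) \<and>
    (pair_poly M = pair_poly N \<or> pair_poly M = - pair_poly N)"
  using assms
proof (induction rule: pairing_induct)
  case empty
  then show ?case by (intro exI[of _ "{}"]) simp
next
  case (insert a b M)
  from insert.IH obtain N where N: "pairing n N" "card N = card M" "cover N = cover M"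
      "\<forall>p\<in>N. fst p < snd p" "pair_poly M = pair_poly N \<or> pair_poly M = - pair_poly N"
    by (elim exE conjE)
  have fin: "finite M" "finite N" using insert.hyps(1) N(1) pairing_finite by auto
  define q where "q = (min a b, max a b)"
  have q: "q = (a, b) \<or> q = (b, a)" "fst q < snd q"
    using insert.hyps(4) by (auto simp: q_def min_def max_def)
  have "a \<notin> cover N" "b \<notin> cover N" using insert.hyps N(3) by simp_all
  then have qN: "pairing n (insert q N)" "q \<notin> N"
    using q(1) pairing_insertI[OF N(1) insert.hyps(2,3)] insert.hyps(4)
      pairing_insertI[OF N(1) insert.hyps(3,2)] by metis+
  have "pair_poly (insert (a, b) M) = pair_poly (insert q N) \<or>
      pair_poly (insert (a, b) M) = - pair_poly (insert q N)"
    unfolding pair_poly_insert[OF fin(1) insert.hyps(7)] pair_poly_insert[OF fin(2) qN(2)]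
    using N(5) q(1) by (elim disjE) (simp_all add: algebra_simps)
  moreover have "cover (insert q N) = cover (insert (a, b) M)"
    using q(1) N(3) by (elim disjE) (simp_all add: insert_commute)
  moreover have "card (insert q N) = card (insert (a, b) M)"
    using qN(2) insert.hyps(7) fin N(2) by simp
  moreover have "\<forall>p\<in>insert q N. fst p < snd p" using N(4) q(2) by simp
  ultimately show ?case using qN(1) by (intro exI[of _ "insert q N"] conjI)
qed

text \<open>The weight that straightening increases. As \<open>n + 1 - a\<close> decreases in
  \<open>a\<close>, replacing an entry of a pair by a smaller number raises the weight; by the
  rearrangement inequality the nested matching of four numbers has the least weight of the three
  possible ones. The \<open>+ 1\<close> keeps all factors positive, which makes the increase
  strict.\<close>

definition pair_weight :: "nat \<Rightarrow> (nat \<times> nat) set \<Rightarrow> nat" where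
  "pair_weight n M = (\<Sum>p\<in>M. (n + 1 - fst p) * (n + 1 - snd p))"

lemma pair_weight_insert:
  "finite M \<Longrightarrow> p \<notin> M \<Longrightarrow>
   pair_weight n (insert p M) = (n + 1 - fst p) * (n + 1 - snd p) + pair_weight n M"
  by (simp add: pair_weight_def)

lemma pair_weight_le:
  assumes "finite M"
  shows "pair_weight n M \<le> card M * (n + 1)\<^sup>2"
proof -
  have "pair_weight n M \<le> (\<Sum>p\<in>M. (n + 1)\<^sup>2)"
    unfolding pair_weight_def power2_eq_square by (intro sum_mono mult_le_mono) auto
  then show ?thesis by simp
qed

lemma rearrangement:
  fixes a b c d :: nat
  assumes "c < a" "d < b"
  shows "a * d + c * b < a * b + c * d"
proof -
  obtain k i where "a = c + Suc k" "b = d + Suc i"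
    using assms by (metis add_Suc_right less_imp_Suc_add)
  then show ?thesis by (simp add: algebra_simps)
qed

lemma pairing_insert2:
  assumes "pairing n N" "distinct [a, b, c, d]" "{a, b, c, d} \<subseteq> {1..n} - cover N"
  shows "pairing n (insert (a, b) (insert (c, d) N))" "(a, b) \<notin> insert (c, d) N" "(c, d) \<notin> N"
proof -
  have "pairing n (insert (c, d) N)" and cd: "(c, d) \<notin> N"
    using assms(2,3) pairing_insertI[OF assms(1), of c d] by auto
  then have "pairing n (insert (a, b) (insert (c, d) N)) \<and> (a, b) \<notin> insert (c, d) N"
    using assms(2,3) pairing_insertI[of n "insert (c, d) N" a b] by auto
  then show "pairing n (insert (a, b) (insert (c, d) N))" "(a, b) \<notin> insert (c, d) N" "(c, d) \<notin> N"
    using cd by auto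
qed

lemma oriented_straighten_step:
  assumes M: "pairing n M" "\<forall>p\<in>M. fst p < snd p" "\<not> standard_pairing n M"
  obtains N N' where "pairing n N" "pairing n N'" "card N = card M" "card N' = card M"
    "\<forall>p\<in>N. fst p < snd p" "\<forall>p\<in>N'. fst p < snd p"
    "pair_weight n M < pair_weight n N" "pair_weight n M < pair_weight n N'"
    "pair_poly M = pair_poly N - pair_poly N'"
proof -
  note fin = pairing_finite[OF M(1)]
  consider (nested) p q where "p \<in> M" "q \<in> M" "fst p < fst q" "\<not> snd p < snd q"
    | (single) p s where "p \<in> M" "s \<in> {1..n} - cover M" "\<not> fst p < s"
    using M unfolding standard_pairing_def by blast
  then show thesis
  proof cases
    case nested
    define K where "K = M - {p, q}"
    have pq: "p \<noteq> q" using nested by auto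
    have Mpq: "M = insert p (insert q K)" and K: "p \<notin> insert q K" "q \<notin> K"
      using nested(1,2) pq by (auto simp: K_def)
    obtain a b a' b' where p: "p = (a, b)" and q: "q = (a', b')" by fastforce
    have pK: "pairing n K" using M(1) pairing_subset[of n M K] by (auto simp: K_def)
    have finK: "finite K" using fin by (simp add: K_def)
    note ins1 = pairing_insertD[of n p "insert q K", folded Mpq, OF M(1) K(1)]
    note ins2 = pairing_insertD[OF ins1(1) K(2)]
    have ab: "a < a'" "a' < b'" "b' < b" "b \<le> n" "1 \<le> a"
      and cov: "{a, b, a', b'} \<subseteq> {1..n} - cover K"
      using ins1 ins2 nested M(2) by (auto simp: p q)
    \<comment> \<open>Here a < a' < b' < b. The nested matching of these four numbers is replaced by
      the crossing one in \<open>N\<close> and by the side-by-side one in \<open>N'\<close>.\<close>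
    define N where "N = insert (a, b') (insert (a', b) K)"
    define N' where "N' = insert (a, a') (insert (b', b) K)"
    have "distinct [a, b', a', b]" "{a, b', a', b} \<subseteq> {1..n} - cover K"
      "distinct [a, a', b', b]" "{a, a', b', b} \<subseteq> {1..n} - cover K"
      using ab cov by auto
    note N = pairing_insert2[OF pK this(1,2), folded N_def]
      and N' = pairing_insert2[OF pK this(3,4), folded N'_def]
    have card: "card N = card M" "card N' = card M"
      using N N' K finK by (simp_all add: N_def N'_def Mpq)
    have "pair_weight n M =
        (n + 1 - a) * (n + 1 - b) + ((n + 1 - a') * (n + 1 - b') + pair_weight n K)"
      unfolding Mpq using K finK by (simp only: pair_weight_insert p q fst_conv snd_conv finite_insert not_False_eq_True)
    moreover have "pair_weight n N =
        (n + 1 - a) * (n + 1 - b') + ((n + 1 - a') * (n + 1 - b) + pair_weight n K)"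
      unfolding N_def using N finK
      by (simp only: pair_weight_insert fst_conv snd_conv finite_insert not_False_eq_True)
    moreover have "pair_weight n N' =
        (n + 1 - a) * (n + 1 - a') + ((n + 1 - b') * (n + 1 - b) + pair_weight n K)"
      unfolding N'_def using N' finK
      by (simp only: pair_weight_insert fst_conv snd_conv finite_insert not_False_eq_True)
    moreover have "n + 1 - a' < n + 1 - a" "n + 1 - b' < n + 1 - a" "n + 1 - b < n + 1 - b'"
      "n + 1 - b < n + 1 - a'"
      using ab by auto
    ultimately have w: "pair_weight n M < pair_weight n N" "pair_weight n M < pair_weight n N'"
      using rearrangement[of "n + 1 - a'" "n + 1 - a" "n + 1 - b" "n + 1 - b'"]
        rearrangement[of "n + 1 - b'" "n + 1 - a" "n + 1 - b" "n + 1 - a'"]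
        mult.commute[of "n + 1 - b'" "n + 1 - a'"]
      by linarith+
    have pp: "pair_poly M = pair_poly N - pair_poly N'"
      unfolding N_def N'_def Mpq using N N' K finK
      by (simp add: pair_poly_insert p q algebra_simps)
    have or: "\<forall>p\<in>N. fst p < snd p" "\<forall>p\<in>N'. fst p < snd p"
      using M(2) ab by (auto simp: N_def N'_def Mpq)
    show thesis by (rule that[OF N(1) N'(1) card or w pp])
  next
    case single
    define K where "K = M - {p}"
    have Mp: "M = insert p K" and K: "p \<notin> K" using single(1) by (auto simp: K_def)
    obtain a b where p: "p = (a, b)" by fastforce
    have finK: "finite K" using fin by (simp add: K_def)
    note ins = pairing_insertD[of n p K, folded Mp, OF M(1) K]
    have ab: "s < a" "a < b" "b \<le> n" "1 \<le> s" "s \<notin> cover K" "a \<notin> cover K" "b \<notin> cover K"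
      using ins single M(2) by (auto simp: p Mp)
    have N: "pairing n (insert (s, b) K)" "(s, b) \<notin> K"
      by (rule pairing_insertI[OF ins(1)]; use ab in auto)+
    have N': "pairing n (insert (s, a) K)" "(s, a) \<notin> K"
      by (rule pairing_insertI[OF ins(1)]; use ab in auto)+
    have w: "pair_weight n M < pair_weight n (insert (s, b) K)"
      "pair_weight n M < pair_weight n (insert (s, a) K)"
    proof -
      have "(n + 1 - a) * (n + 1 - b) < (n + 1 - s) * (n + 1 - b)"
        using ab by (intro mult_strict_right_mono) auto
      moreover have "(n + 1 - b) * (n + 1 - a) < (n + 1 - s) * (n + 1 - a)"
        using ab by (intro mult_strict_right_mono) auto
      ultimately show "pair_weight n M < pair_weight n (insert (s, b) K)"
        "pair_weight n M < pair_weight n (insert (s, a) K)"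
        using N N' K finK by (simp_all add: Mp pair_weight_insert p mult.commute)
    qed
    have pp: "pair_poly M = pair_poly (insert (s, b) K) - pair_poly (insert (s, a) K)"
      unfolding Mp using N N' K finK by (simp add: pair_poly_insert p algebra_simps)
    have card: "card (insert (s, b) K) = card M" "card (insert (s, a) K) = card M"
      using N N' K finK by (simp_all add: Mp)
    have or: "\<forall>p\<in>insert (s, b) K. fst p < snd p" "\<forall>p\<in>insert (s, a) K. fst p < snd p"
      using M(2) ab by (auto simp: Mp)
    show thesis by (rule that[OF N(1) N'(1) card or w pp])
  qed
qed

lemma oriented_straighten:
  assumes "pairing n M" "\<forall>p\<in>M. fst p < snd p"
  shows "pair_poly M \<in> Q.span {pair_poly N | N. standard_pairing n N \<and> card N = card M}"
  using assms
\<comment> \<open>The weight grows, so the quantity that decreases is its distance to the bound of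
  \<open>pair_weight_le\<close>. That bound depends only on the number of pairs, which a
  straightening step preserves.\<close>
proof (induction M rule: measure_induct_rule[of "\<lambda>M. card M * (n + 1)\<^sup>2 - pair_weight n M"])
  case (less M)
  show ?case
  proof (cases "standard_pairing n M")
    case True
    then show ?thesis by (intro Q.span_base) blast
  next
    case False
    then obtain N N' where N: "pairing n N" "pairing n N'" "card N = card M" "card N' = card M"
      "\<forall>p\<in>N. fst p < snd p" "\<forall>p\<in>N'. fst p < snd p"
      "pair_weight n M < pair_weight n N" "pair_weight n M < pair_weight n N'"
      "pair_poly M = pair_poly N - pair_poly N'"
      by (rule oriented_straighten_step[OF less.prems])
    have "pair_weight n N \<le> card M * (n + 1)\<^sup>2" "pair_weight n N' \<le> card M * (n + 1)\<^sup>2"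
      using pair_weight_le[OF pairing_finite[OF N(1)]] pair_weight_le[OF pairing_finite[OF N(2)]]
        N(3,4) by metis+
    then have "card N * (n + 1)\<^sup>2 - pair_weight n N < card M * (n + 1)\<^sup>2 - pair_weight n M"
      "card N' * (n + 1)\<^sup>2 - pair_weight n N' < card M * (n + 1)\<^sup>2 - pair_weight n M"
      unfolding N(3,4) using N(7,8) by linarith+
    then show ?thesis
      unfolding N(9) using less.IH[OF _ N(1,5)] less.IH[OF _ N(2,6)] N(3,4)
      by (intro Q.span_diff) simp_all
  qed
qed

theorem specht_span_standard:
  "specht_span n d = Q.span {pair_poly M | M. standard_pairing n M \<and> card M = d}"
proof
  show "specht_span n d \<subseteq> Q.span {pair_poly M | M. standard_pairing n M \<and> card M = d}"
  proof (rule specht_span_leI[OF Q.subspace_span])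
    fix M assume M: "pairing n M" "card M = d"
    from orient_pairing[OF M(1)] obtain N where N: "pairing n N" "card N = card M"
      "\<forall>p\<in>N. fst p < snd p" "pair_poly M = pair_poly N \<or> pair_poly M = - pair_poly N" by blast
    show "pair_poly M \<in> Q.span {pair_poly M | M. standard_pairing n M \<and> card M = d}"
      using oriented_straighten[OF N(1,3)] N(2,4) M(2) by (auto intro: Q.span_neg)
  qed
  show "Q.span {pair_poly M | M. standard_pairing n M \<and> card M = d} \<subseteq> specht_span n d"
    unfolding specht_span_def by (rule Q.span_mono) (auto simp: standard_pairing_def)
qed

subsection \<open>Linear independence\<close>

text \<open>Triangularity: take an index of maximal weight among those with nonzero coefficient. Its
  monomial \<open>L i\<close> then occurs in no other summand and cannot cancel.\<close>

lemma leading_coef_independent: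
  fixes wt :: "'i \<Rightarrow> nat" and c :: "'i \<Rightarrow> rat"
  assumes "finite J" and lead: "\<And>j. j \<in> J \<Longrightarrow> coef (f j) (L j) \<noteq> 0"
    and less: "\<And>i j. i \<in> J \<Longrightarrow> j \<in> J \<Longrightarrow> i \<noteq> j \<Longrightarrow> coef (f j) (L i) \<noteq> 0 \<Longrightarrow> wt i < wt j"
    and zero: "(\<Sum>j\<in>J. const_poly (c j) * f j) = 0"
  shows "\<forall>j\<in>J. c j = 0"
proof (rule ccontr)
  define J' where "J' = {j\<in>J. c j \<noteq> 0}"
  assume "\<not> (\<forall>j\<in>J. c j = 0)"
  then have J': "finite (wt ` J')" "wt ` J' \<noteq> {}" using assms(1) by (auto simp: J'_def)
  obtain i where i: "i \<in> J'" "wt i = Max (wt ` J')" using Max_in[OF J'] by auto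
  have "0 = (\<Sum>j\<in>J. c j * coef (f j) (L i))"
    using arg_cong[OF zero, of "\<lambda>p. coef p (L i)"] by (simp add: lookup_sum)
  also have "\<dots> = (\<Sum>j\<in>{i}. c j * coef (f j) (L i))"
  proof (rule sum.mono_neutral_right)
    show "\<forall>j\<in>J - {i}. c j * coef (f j) (L i) = 0"
    proof
      fix j assume j: "j \<in> J - {i}"
      show "c j * coef (f j) (L i) = 0"
      proof (rule ccontr)
        assume "c j * coef (f j) (L i) \<noteq> 0"
        then have "j \<in> J'" "wt i < wt j" using j i(1) less[of i j] by (auto simp: J'_def)
        then show False using i(2) Max_ge[OF J'(1), of "wt j"] by auto
      qed
    qed
  qed (use assms(1) i(1) in \<open>auto simp: J'_def\<close>)
  finally show False using lead i(1) by (auto simp: J'_def)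
qed

lemma pairing_disjoint:
  assumes "pairing n M" "p \<in> M" "q \<in> M" "p \<noteq> q"
  shows "{fst p, snd p} \<inter> {fst q, snd q} = {}"
  using assms unfolding pairing_def by (simp del: insert_disjoint Int_insert_left Int_insert_right)

lemma pairing_fst_neq_snd:
  assumes "pairing n M" "p \<in> M" "q \<in> M"
  shows "fst p \<noteq> snd q"
proof (cases "p = q")
  case True
  then show ?thesis using assms by (simp add: pairing_def)
next
  case False
  then show ?thesis using pairing_disjoint[OF assms False] by auto
qed

lemma pairing_inj:
  assumes "pairing n M"
  shows "inj_on fst M" "inj_on snd M"
proof -
  have "fst p \<noteq> fst q \<and> snd p \<noteq> snd q" if "p \<in> M" "q \<in> M" "p \<noteq> q" for p q
    using pairing_disjoint[OF assms that] by auto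
  then show "inj_on fst M" "inj_on snd M" unfolding inj_on_def by blast+
qed

text \<open>The map from bottom to top entries is increasing, so sorting both sets separately lines
  them up column by column. A standard pairing is thereby recovered from its two sets of
  entries.\<close>

lemma standard_pairing_zip:
  assumes "standard_pairing n M"
  shows "M = set (zip (sorted_list_of_set (fst ` M)) (sorted_list_of_set (snd ` M)))"
proof -
  have pM: "pairing n M" using assms by (simp add: standard_pairing_def)
  note fin = pairing_finite[OF pM]
  define f where "f x = (SOME y. (x, y) \<in> M)" for x
  have f: "f (fst p) = snd p" if "p \<in> M" for p
  proof -
    have "(fst p, f (fst p)) \<in> M" unfolding f_def by (rule someI[of _ "snd p"]) (use that in simp)
    then show ?thesis using inj_onD[OF pairing_inj(1)[OF pM], of "(fst p, f (fst p))" p] that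
      by (metis fst_conv snd_conv)
  qed
  define xs where "xs = sorted_list_of_set (fst ` M)"
  have xs: "set xs = fst ` M" "sorted_wrt (<) xs" using fin by (auto simp: xs_def)
  have "sorted_wrt (\<lambda>x y. f x < f y) xs"
  proof (rule sorted_wrt_mono_rel[OF _ xs(2)])
    fix x y assume "x \<in> set xs" "y \<in> set xs" "x < y"
    then obtain p q where "p \<in> M" "q \<in> M" "x = fst p" "y = fst q" using xs(1) by auto
    then show "f x < f y" using \<open>x < y\<close> assms f by (auto simp: standard_pairing_def)
  qed
  then have "sorted_wrt (<) (map f xs)" by (simp add: sorted_wrt_map)
  moreover have "set (map f xs) = snd ` M" unfolding set_map xs(1) image_image using f by simp
  ultimately have "map f xs = sorted_list_of_set (snd ` M)"
    using fin by (intro strict_sorted_equal) auto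
  moreover have "set (zip ys (map f ys)) = (\<lambda>x. (x, f x)) ` set ys" for ys
    by (induction ys) auto
  moreover have "(\<lambda>x. (x, f x)) ` fst ` M = M" unfolding image_image using f by force
  ultimately have "M = set (zip xs (sorted_list_of_set (snd ` M)))" using xs(1) by metis
  then show ?thesis by (simp only: xs_def[symmetric])
qed

lemma standard_pairing_unique:
  assumes "standard_pairing n M" "standard_pairing n N" "snd ` M = snd ` N"
  shows "M = N"
proof -
  have pM: "pairing n M" and pN: "pairing n N" using assms by (simp_all add: standard_pairing_def)
  have fin: "finite M" "finite N" using pM pN by (simp_all add: pairing_finite)
  have cards: "card (fst ` M) = card (fst ` N)"
    using card_image[OF pairing_inj(1)[OF pM]] card_image[OF pairing_inj(1)[OF pN]]
      card_image[OF pairing_inj(2)[OF pM]] card_image[OF pairing_inj(2)[OF pN]] assms(3) by simp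
  have less: "y < x" if "standard_pairing n M" "standard_pairing n N" "snd ` M = snd ` N"
    "x \<in> fst ` M - fst ` N" "y \<in> fst ` N" for x y M N
  proof -
    have "pairing n M" using that(1) by (simp add: standard_pairing_def)
    then have "cover M \<subseteq> {1..n}" by (rule pairing_cover)
    then have "x \<in> {1..n}" using that(4) coverI(1) by blast
    moreover have "x \<notin> snd ` M"
    proof
      assume "x \<in> snd ` M"
      then obtain q where "q \<in> M" "x = snd q" by (rule imageE)
      moreover from that(4) obtain p where "p \<in> M" "x = fst p" by (elim DiffE imageE)
      moreover have "pairing n M" using that(1) by (simp add: standard_pairing_def)
      ultimately show False using pairing_fst_neq_snd[of n M p q] by simp
    qed
    ultimately have "x \<in> {1..n} - cover N" using that(3,4) by (simp add: cover_def)
    moreover from that(5) obtain q where "q \<in> N" "y = fst q" by blast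
    moreover have "\<forall>p\<in>N. \<forall>s\<in>{1..n} - cover N. fst p < s"
      using that(2) unfolding standard_pairing_def by (elim conjE)
    ultimately show ?thesis by blast
  qed
  have fst_eq: "fst ` M = fst ` N"
  proof (rule ccontr)
    assume "fst ` M \<noteq> fst ` N"
    then have "\<not> fst ` M \<subseteq> fst ` N"
      using card_subset_eq[OF finite_imageI[OF fin(2)] _ cards] by blast
    moreover have "\<not> fst ` N \<subseteq> fst ` M"
      using card_subset_eq[OF finite_imageI[OF fin(1)] _ cards[symmetric]] \<open>fst ` M \<noteq> fst ` N\<close> by blast
    ultimately obtain x y where xy: "x \<in> fst ` M - fst ` N" "y \<in> fst ` N - fst ` M" by blast
    then have "y < x" using less[OF assms] by blast
    moreover have "x < y" using less[OF assms(2,1) assms(3)[symmetric]] xy by blast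
    ultimately show False by simp
  qed
  show ?thesis
    by (subst standard_pairing_zip[OF assms(1)], subst standard_pairing_zip[OF assms(2)])
      (simp only: fst_eq assms(3))
qed

text \<open>A monomial of the Specht polynomial picks one entry of each pair, and the second entry
  is the larger; picking it everywhere gives the unique maximal index sum.\<close>

lemma sum_transversal_less:
  assumes "pairing n N" "\<forall>p\<in>N. fst p < snd p" "A \<subseteq> cover N" "pair_coef N A \<noteq> 0" "A \<noteq> snd ` N"
  shows "\<Sum>A < \<Sum>(snd ` N)"
proof -
  note fin = pairing_finite[OF assms(1)]
  define g where "g p = (if snd p \<in> A then snd p else fst p)" for p
  have tr: "snd p \<in> A \<longleftrightarrow> fst p \<notin> A" if "p \<in> N" for p
    using assms(4) that by (simp add: pair_coef_nonzero[OF fin])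
  have A: "A = g ` N"
  proof (rule equalityI; rule subsetI)
    fix x assume "x \<in> A"
    then obtain p where "p \<in> N" "x = fst p \<or> x = snd p" using assms(3) by (auto simp: cover_def)
    then have "x = g p" using tr[of p] \<open>x \<in> A\<close> by (auto simp: g_def)
    then show "x \<in> g ` N" using \<open>p \<in> N\<close> by blast
  qed (use tr in \<open>auto simp: g_def\<close>)
  have "inj_on g N"
  proof (rule inj_onI, rule ccontr)
    fix p q assume pq: "p \<in> N" "q \<in> N" "g p = g q" "p \<noteq> q"
    have "g p \<in> {fst p, snd p}" "g q \<in> {fst q, snd q}" by (simp_all add: g_def)
    then show False using pairing_disjoint[OF assms(1) pq(1,2,4)] pq(3) by (metis IntI emptyE)
  qed
  then have "\<Sum>A = (\<Sum>p\<in>N. g p)" unfolding A by (subst sum.reindex) auto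
  also have "\<dots> < (\<Sum>p\<in>N. snd p)"
  proof (rule sum_strict_mono_ex1[OF fin])
    show "\<forall>p\<in>N. g p \<le> snd p" using assms(2) by (auto simp: g_def)
    show "\<exists>p\<in>N. g p < snd p"
    proof (rule ccontr)
      assume "\<not> ?thesis"
      then have "g p = snd p" if "p \<in> N" for p
        using that assms(2) by (auto simp: g_def split: if_splits)
      then have "A = snd ` N" unfolding A by simp
      then show False using assms(5) by simp
    qed
  qed
  also have "\<dots> = \<Sum>(snd ` N)"
    using pairing_inj(2)[OF assms(1)] by (simp add: sum.reindex)
  finally show ?thesis .
qed

text \<open>The leading monomial is that of the top row, weighted by its index sum;
  \<open>standard_pairing_unique\<close> keeps the leading monomials of different pairings
  apart.\<close>

lemma standard_independent:
  assumes "finite X" "\<And>M. M \<in> X \<Longrightarrow> standard_pairing n M"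
    and "(\<Sum>M\<in>X. const_poly (c M) * pair_poly M) = 0"
  shows "\<forall>M\<in>X. c M = 0"
proof (rule leading_coef_independent[where L = "\<lambda>M. ind_exp (snd ` M)" and wt = "\<lambda>M. \<Sum>(snd ` M)",
      OF assms(1) _ _ assms(3)])
  have pX: "pairing n M" if "M \<in> X" for M using assms(2)[OF that] by (simp add: standard_pairing_def)
  {
    fix M assume M: "M \<in> X"
    note fin = pairing_finite[OF pX[OF M]]
    have "fst p \<notin> snd ` M" if "p \<in> M" for p
      using pairing_fst_neq_snd[OF pX[OF M] that] by auto
    then have "pair_coef M (snd ` M) \<noteq> 0" by (auto simp: pair_coef_nonzero[OF fin])
    then show "coef (pair_poly M) (ind_exp (snd ` M)) \<noteq> 0"
      using coef_pair_poly[OF pX[OF M], of "snd ` M"] fin by (simp add: cover_def)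
  }
  fix M N assume MN: "M \<in> X" "N \<in> X" "M \<noteq> N" "coef (pair_poly N) (ind_exp (snd ` M)) \<noteq> 0"
  then have "snd ` M \<noteq> snd ` N" using standard_pairing_unique assms(2) by blast
  moreover have "snd ` M \<subseteq> cover N" "pair_coef N (snd ` M) \<noteq> 0"
    using MN(4) coef_pair_poly[OF pX[OF MN(2)], of "snd ` M"] pairing_finite[OF pX[OF MN(1)]]
    by (auto split: if_splits)
  ultimately show "\<Sum>(snd ` M) < \<Sum>(snd ` N)"
    using assms(2)[OF MN(2)] pX[OF MN(2)]
    by (intro sum_transversal_less) (auto simp: standard_pairing_def)
qed

section \<open>The Garsia--Procesi ideal of a two-row partition\<close>

subsection \<open>Ideals of the polynomial ring\<close>

lemma poly_ring_simps [simp]: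
  "mult (poly_ring n) = (*)" "add (poly_ring n) = (+)"
  "zero (poly_ring n) = 0" "one (poly_ring n) = 1"
  by (simp_all add: poly_ring_def)

lemma poly_ring_cring: "cring (poly_ring n)"
proof (rule cringI)
  show "abelian_group (poly_ring n)"
  proof (rule abelian_groupI)
    fix x assume "x \<in> carrier (poly_ring n)"
    then show "\<exists>y\<in>carrier (poly_ring n). y \<oplus>\<^bsub>poly_ring n\<^esub> x = \<zero>\<^bsub>poly_ring n\<^esub>"
      by (intro bexI[of _ "- x"]) (auto intro: poly_carrier_neg)
  qed (auto intro: poly_carrier_add poly_carrier_0)
  show "Group.comm_monoid (poly_ring n)"
    by (rule comm_monoidI) (auto intro: poly_carrier_mult)
qed (auto simp: algebra_simps)

lemma poly_ring_idealI:
  assumes "J \<subseteq> poly_carrier n" "0 \<in> J" "\<And>p q. p \<in> J \<Longrightarrow> q \<in> J \<Longrightarrow> p + q \<in> J"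
    and mult: "\<And>p q. p \<in> J \<Longrightarrow> q \<in> poly_carrier n \<Longrightarrow> p * q \<in> J"
  shows "ideal J (poly_ring n)"
proof -
  interpret cring "poly_ring n" by (rule poly_ring_cring)
  have neg: "\<ominus>\<^bsub>poly_ring n\<^esub> p = - p" if "p \<in> poly_carrier n" for p
    using that by (intro minus_equality) (auto intro: poly_carrier_neg)
  show ?thesis
  proof (rule idealI)
    show "subgroup J (add_monoid (poly_ring n))"
    proof (rule add.subgroupI)
      fix p assume "p \<in> J"
      then show "\<ominus>\<^bsub>poly_ring n\<^esub> p \<in> J"
        using neg[of p] assms(1) mult[of p "const_poly (-1)", OF _ poly_carrier_const]
        by (auto simp: const_poly_minus)
    qed (use assms in auto)
  qed (use mult in \<open>auto simp: mult.commute\<close>, unfold_locales)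
qed

lemma poly_ring_idealD:
  assumes "ideal J (poly_ring n)"
  shows "J \<subseteq> poly_carrier n" "0 \<in> J" "\<And>p q. p \<in> J \<Longrightarrow> q \<in> J \<Longrightarrow> p + q \<in> J"
    "\<And>p q. p \<in> J \<Longrightarrow> q \<in> poly_carrier n \<Longrightarrow> p * q \<in> J"
proof -
  interpret ideal J "poly_ring n" by (rule assms)
  show "J \<subseteq> poly_carrier n" using a_subset by simp
  show "0 \<in> J" using additive_subgroup.zero_closed[OF is_additive_subgroup] by simp
  show "p + q \<in> J" if "p \<in> J" "q \<in> J" for p q using additive_subgroup.a_closed[OF is_additive_subgroup that] by simp
  show "p * q \<in> J" if "p \<in> J" "q \<in> poly_carrier n" for p q using I_r_closed[OF that(1)] that(2) by simp
qed

subsection \<open>Elementary symmetric polynomials\<close>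

lemma elem_sym_eq: "elem_sym r X = (\<Sum>Y | Y \<subseteq> X \<and> card Y = r. sqfree_mon Y)"
  by (simp add: elem_sym_def sqfree_mon_def)

lemma elem_sym_carrier: "X \<subseteq> {1..n} \<Longrightarrow> elem_sym r X \<in> poly_carrier n"
  unfolding elem_sym_eq by (intro poly_carrier_sum poly_carrier_sqfree_mon) auto

lemma perm_act_elem_sym:
  assumes "inj \<sigma>"
  shows "perm_act \<sigma> (elem_sym r X) = elem_sym r (\<sigma> ` X)"
proof -
  have inj: "inj_on ((`) \<sigma>) A" for A using assms by (simp add: inj_on_def inj_image_eq_iff)
  have "{Y. Y \<subseteq> \<sigma> ` X \<and> card Y = r} = (`) \<sigma> ` {Y. Y \<subseteq> X \<and> card Y = r}"
  proof (rule equalityI; rule subsetI)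
    fix Y assume Y: "Y \<in> {Y. Y \<subseteq> \<sigma> ` X \<and> card Y = r}"
    then obtain Z where "Z \<subseteq> X" "Y = \<sigma> ` Z" by (auto simp: subset_image_iff)
    moreover have "card (\<sigma> ` Z) = card Z"
      by (rule card_image[OF inj_on_subset[OF assms subset_UNIV]])
    ultimately show "Y \<in> (`) \<sigma> ` {Y. Y \<subseteq> X \<and> card Y = r}" using Y by auto
  next
    fix Y assume "Y \<in> (`) \<sigma> ` {Y. Y \<subseteq> X \<and> card Y = r}"
    then obtain Z where "Z \<subseteq> X" "card Z = r" "Y = \<sigma> ` Z" by auto
    moreover have "card (\<sigma> ` Z) = card Z"
      by (rule card_image[OF inj_on_subset[OF assms subset_UNIV]])
    ultimately show "Y \<in> {Y. Y \<subseteq> \<sigma> ` X \<and> card Y = r}" by auto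
  qed
  then show ?thesis
    by (simp add: elem_sym_eq perm_act_sum perm_act_sqfree_mon[OF assms] sum.reindex[OF inj])
qed

lemma elem_sym_eq_0: "finite X \<Longrightarrow> card X < r \<Longrightarrow> elem_sym r X = 0"
  unfolding elem_sym_def by (rule sum.neutral) (auto dest: card_mono)

lemma elem_sym_card: "finite X \<Longrightarrow> elem_sym (card X) X = sqfree_mon X"
proof -
  assume "finite X"
  then have "{Y. Y \<subseteq> X \<and> card Y = card X} = {X}" using card_subset_eq by blast
  then show ?thesis by (simp add: elem_sym_eq)
qed

lemma elem_sym_Suc_insert:
  assumes "finite X" "i \<notin> X"
  shows "elem_sym (Suc r) (insert i X) = elem_sym (Suc r) X + xvar i * elem_sym r X"
proof -
  let ?S = "\<lambda>r. {Y. Y \<subseteq> X \<and> card Y = r}"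
  have fin: "finite (?S r)" for r using assms(1) by simp
  have "{Y. Y \<subseteq> insert i X \<and> card Y = Suc r} = ?S (Suc r) \<union> insert i ` ?S r"
  proof (rule equalityI; rule subsetI)
    fix Y assume Y: "Y \<in> {Y. Y \<subseteq> insert i X \<and> card Y = Suc r}"
    show "Y \<in> ?S (Suc r) \<union> insert i ` ?S r"
    proof (cases "i \<in> Y")
      case True
      then have "Y = insert i (Y - {i})" "Y - {i} \<subseteq> X" "card (Y - {i}) = r" using Y by auto
      then show ?thesis by blast
    qed (use Y in auto)
  next
    fix Y assume "Y \<in> ?S (Suc r) \<union> insert i ` ?S r"
    then show "Y \<in> {Y. Y \<subseteq> insert i X \<and> card Y = Suc r}"
      using assms by (auto simp: card_insert_if finite_subset)
  qed
  moreover have "?S (Suc r) \<inter> insert i ` ?S r = {}" using assms(2) by auto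
  moreover have "inj_on (insert i) (?S r)" using assms(2) by (auto simp: inj_on_def)
  moreover have "sqfree_mon (insert i Y) = xvar i * sqfree_mon Y" if "Y \<in> ?S r" for Y
    using that assms finite_subset by (intro sqfree_mon_insert) auto
  ultimately show ?thesis
    using fin by (simp add: elem_sym_eq sum.union_disjoint sum.reindex sum_distrib_left)
qed

lemma elem_sym_0: "finite X \<Longrightarrow> elem_sym 0 X = 1"
proof -
  assume "finite X"
  then have "Y = {}" if "Y \<subseteq> X" "card Y = 0" for Y
    using that finite_subset[OF that(1)] by simp
  then have "{Y. Y \<subseteq> X \<and> card Y = 0} = {{}}" by auto
  then show ?thesis by (simp add: elem_sym_eq)
qed

lemma elem_sym_1: "finite X \<Longrightarrow> elem_sym (Suc 0) X = (\<Sum>i\<in>X. xvar i)"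
  by (induction X rule: finite_induct)
    (simp_all add: elem_sym_Suc_insert elem_sym_0 elem_sym_eq_0)

text \<open>Disjoint pairs are hit in different points.\<close>

lemma card_pairing_le_hitting:
  assumes "pairing n M" "finite Z" "\<And>p. p \<in> M \<Longrightarrow> {fst p, snd p} \<inter> Z \<noteq> {}"
  shows "card M \<le> card Z"
proof -
  have "\<exists>x. x \<in> {fst p, snd p} \<inter> Z" if "p \<in> M" for p using assms(3)[OF that] by auto
  then obtain f where f: "\<And>p. p \<in> M \<Longrightarrow> f p \<in> {fst p, snd p} \<inter> Z" by metis
  have "inj_on f M"
  proof (rule inj_onI, rule ccontr)
    fix p q assume pq: "p \<in> M" "q \<in> M" "f p = f q" "p \<noteq> q"
    then show False
      using f[OF pq(1)] f[OF pq(2)] pairing_disjoint[OF assms(1) pq(1,2,4)] by (metis IntD1 IntI emptyE)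
  qed
  moreover have "f ` M \<subseteq> Z" using f by auto
  ultimately show ?thesis using assms(2) by (rule card_inj_on_le)
qed

text \<open>If some pair lies in \<open>X\<close> and avoids the support of \<open>m\<close>, the transposition of this pair
  fixes the second argument and negates the first; otherwise the degrees differ.\<close>

lemma ip_pair_poly_elem_sym:
  assumes "pairing n M" "X \<subseteq> {1..n}" "n - card X < r \<or> card M < r"
  shows "ip (pair_poly M) (elem_sym r X * monomial m) = 0"
proof (cases "\<exists>p\<in>M. {fst p, snd p} \<subseteq> X - keys m")
  case True
  then obtain a b where ab: "(a, b) \<in> M" "a \<in> X" "b \<in> X" "a \<notin> keys m"
    "b \<notin> keys m" by auto
  let ?\<tau> = "transpose a b"
  have "?\<tau> ` X = X" using ab(2,3) by (simp add: transpose_image_eq)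
  moreover have "perm_exp ?\<tau> m = m"
  proof -
    have "perm_exp ?\<tau> m = perm_exp id m"
      unfolding perm_exp_def using ab(4,5) by (intro sum.cong) (auto simp: transpose_def)
    then show ?thesis by simp
  qed
  ultimately have "perm_act ?\<tau> (elem_sym r X * monomial m) = elem_sym r X * monomial m"
    by (simp add: perm_act_mult perm_act_elem_sym)
  then have "ip (pair_poly M) (elem_sym r X * monomial m) =
      ip (- pair_poly M) (elem_sym r X * monomial m)"
    using ip_perm_act[of ?\<tau> "pair_poly M" "elem_sym r X * monomial m"]
      pair_poly_antisymmetric[OF assms(1) ab(1)] by simp
  then show ?thesis by (simp add: ip_uminus_left)
next
  case False
  show ?thesis
  proof (rule ccontr)
    assume nz: "ip (pair_poly M) (elem_sym r X * monomial m) \<noteq> 0"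
    have finX: "finite X" using assms(2) finite_subset by blast
    have "ip (pair_poly M) (elem_sym r X * monomial m) =
        (\<Sum>Y | Y \<subseteq> X \<and> card Y = r. coef (pair_poly M) (ind_exp Y + m))"
    proof -
      have sum: "ip p (sum f A) = (\<Sum>a\<in>A. ip p (f a))" for p f and A :: "nat set set"
        by (induction A rule: infinite_finite_induct) (auto simp: ip_add_right)
      have "ip (pair_poly M) (sqfree_mon Y * monomial m) = coef (pair_poly M) (ind_exp Y + m)" for Y
        by (subst ip_commute) (simp add: sqfree_mon_eq mult_single ip_single_left)
      then show ?thesis by (simp add: elem_sym_eq sum_distrib_right sum)
    qed
    then obtain Y where Y: "Y \<subseteq> X" "card Y = r" "coef (pair_poly M) (ind_exp Y + m) \<noteq> 0"
      using nz by (metis (mono_tags, lifting) mem_Collect_eq sum.neutral)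
    have "ind_exp Y + m \<in> keys (pair_poly M)" using Y(3) by (simp add: in_keys_iff)
    then obtain A where "finite A" "card A = card M" "ind_exp Y + m = ind_exp A"
      using pair_poly_sqfree_homog[OF assms(1)] unfolding sqfree_homog_def by blast
    then have "exp_deg (ind_exp Y) + exp_deg m = card M"
      by (metis exp_deg_add exp_deg_ind_exp)
    then have deg: "r + exp_deg m = card M"
      using exp_deg_ind_exp[of Y] Y(1,2) finite_subset[OF Y(1) finX] by simp
    \<comment> \<open>Every pair now leaves \<open>X\<close> or meets the support of
      \<open>m\<close>, so the number of pairs is at most \<open>n - card X\<close> plus the degree
      of \<open>m\<close>. Together with \<open>deg\<close> this gives
      \<open>r \<le> n - card X\<close>, while \<open>deg\<close> alone gives
      \<open>r \<le> card M\<close>.\<close>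
    have "card M \<le> card (({1..n} - X) \<union> keys m)"
    proof (rule card_pairing_le_hitting[OF assms(1)])
      fix p assume p: "p \<in> M"
      then have "{fst p, snd p} \<subseteq> {1..n}" using pairing_cover[OF assms(1)] coverI by blast
      then show "{fst p, snd p} \<inter> ({1..n} - X \<union> keys m) \<noteq> {}" using False p by blast
    qed simp
    also have "\<dots> \<le> card ({1..n} - X) + card (keys m)" by (rule card_Un_le)
    also have "\<dots> \<le> n - card X + exp_deg m"
      using card_keys_le_exp_deg[of m] assms(2) finX by (simp add: card_Diff_subset)
    finally show False using deg assms(3) by auto
  qed
qed

subsection \<open>The two-row case\<close>

locale two_row =
  fixes n k :: nat and \<mu> :: "nat list"
  assumes n_pos: "n \<ge> 1" and k_le: "k \<le> n - k" and \<mu>_eq: "\<mu> = (if k = 0 then [n] else [n - k, k])"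
begin

abbreviation I where "I \<equiv> GP_ideal n \<mu>"

definition H :: "qpoly set" where
  "H = Q.span {pair_poly M | M. standard_pairing n M \<and> card M \<le> k}"

lemma conj_part_two_row: "j \<ge> 1 \<Longrightarrow> conj_part \<mu> j = of_bool (j \<le> n - k) + of_bool (j \<le> k)"
proof -
  assume j: "j \<ge> 1"
  have "{i. i < length \<mu> \<and> j \<le> \<mu> ! i} = (if j \<le> n - k then {0} else {}) \<union> (if j \<le> k then {1} else {})"
    using j by (auto simp: \<mu>_eq less_Suc_eq split: if_splits)
  then show ?thesis by (simp add: conj_part_def)
qed

text \<open>The bound is \<open>t\<close> for \<open>t \<le> k\<close>, then constantly
  \<open>k\<close> up to \<open>t = n - k\<close>, and \<open>n - t\<close> from there on.\<close>

lemma GP_bound_two_row: "GP_bound \<mu> t = int (min t (n - k)) + int (min t k) - int t"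
proof -
  have "(\<Sum>j=1..t. int (conj_part \<mu> j)) = int (min t (n - k)) + int (min t k)"
  proof (induction t)
    case (Suc t)
    then show ?case using conj_part_two_row[of "Suc t"] by (auto simp: min_def)
  qed simp
  then show ?thesis by (simp add: GP_bound_def)
qed

lemma gens_carrier:
  "{elem_sym r X | r X. X \<subseteq> {1..n} \<and> GP_bound \<mu> (n - card X) < int r \<and> r \<le> card X}
    \<subseteq> carrier (poly_ring n)"
  using elem_sym_carrier by auto

lemma I_ideal: "ideal I (poly_ring n)"
  unfolding GP_ideal_def
  by (rule ring.genideal_ideal[OF cring.axioms(1)[OF poly_ring_cring] gens_carrier])

lemmas I_0 = poly_ring_idealD(2)[OF I_ideal]
  and I_add = poly_ring_idealD(3)[OF I_ideal]
  and I_mult = poly_ring_idealD(4)[OF I_ideal]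

lemma I_mult_left: "p \<in> I \<Longrightarrow> q \<in> poly_carrier n \<Longrightarrow> q * p \<in> I"
  using I_mult[of p q] by (simp add: mult.commute)

lemma I_subspace: "Q.subspace I"
  unfolding Q.subspace_def using I_0 I_add I_mult_left by auto

lemmas I_diff = Q.subspace_diff[OF I_subspace]
  and I_sum = Q.subspace_sum[OF I_subspace]

lemma I_gen:
  assumes "X \<subseteq> {1..n}" "GP_bound \<mu> (n - card X) < int r"
  shows "elem_sym r X \<in> I"
proof (cases "r \<le> card X")
  case True
  then have "elem_sym r X \<in> {elem_sym r X | r X.
      X \<subseteq> {1..n} \<and> GP_bound \<mu> (n - card X) < int r \<and> r \<le> card X}" using assms by blast
  then show ?thesis unfolding GP_ideal_def
    using ring.genideal_self[OF cring.axioms(1)[OF poly_ring_cring] gens_carrier] by blast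
next
  case False
  then show ?thesis using elem_sym_eq_0[of X r] assms(1) finite_subset I_0 by fastforce
qed

lemma I_minimal:
  assumes "ideal J (poly_ring n)"
    and "\<And>r X. X \<subseteq> {1..n} \<Longrightarrow> GP_bound \<mu> (n - card X) < int r \<Longrightarrow> r \<le> card X \<Longrightarrow> elem_sym r X \<in> J"
  shows "I \<subseteq> J"
  unfolding GP_ideal_def
  by (rule ring.genideal_minimal[OF cring.axioms(1)[OF poly_ring_cring] assms(1)])
    (use assms(2) in blast)

text \<open>The polynomials sent into the ideal by \<sigma> form an ideal themselves, and it
  contains the generators because \<sigma> maps the generator of a set of variables to that of a set
  of the same size.\<close>

lemma I_perm_act:
  assumes "\<sigma> permutes {1..n}" "p \<in> I"
  shows "perm_act \<sigma> p \<in> I"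
proof -
  have "ideal {p \<in> poly_carrier n. perm_act \<sigma> p \<in> I} (poly_ring n)"
    by (rule poly_ring_idealI)
      (auto intro: poly_carrier_0 poly_carrier_add poly_carrier_mult I_0 I_add I_mult
        poly_carrier_perm_act[OF assms(1)] simp: perm_act_add perm_act_mult)
  moreover have "elem_sym r X \<in> {p \<in> poly_carrier n. perm_act \<sigma> p \<in> I}"
    if "X \<subseteq> {1..n}" "GP_bound \<mu> (n - card X) < int r" for r X
  proof -
    have inj: "inj \<sigma>" using assms(1) by (rule permutes_inj)
    have "card (\<sigma> ` X) = card X" by (rule card_image[OF inj_on_subset[OF inj subset_UNIV]])
    moreover have "\<sigma> ` X \<subseteq> {1..n}" using that(1) permutes_image[OF assms(1)] by blast
    ultimately show ?thesis
      using that I_gen[of "\<sigma> ` X" r] elem_sym_carrier by (simp add: perm_act_elem_sym[OF inj])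
  qed
  ultimately have "I \<subseteq> {p \<in> poly_carrier n. perm_act \<sigma> p \<in> I}" by (intro I_minimal) auto
  then show ?thesis using assms(2) by blast
qed

lemma ip_pair_poly_I:
  assumes "pairing n M" "card M \<le> k" "q \<in> I"
  shows "ip (pair_poly M) q = 0"
proof -
  \<comment> \<open>The polynomials orthogonal to a Specht polynomial need not form an ideal. Those
    all of whose multiples are orthogonal to it do, and so only generators have to be
    checked.\<close>
  let ?J = "{q \<in> poly_carrier n. \<forall>g. ip (pair_poly M) (q * g) = 0}"
  have "ideal ?J (poly_ring n)"
    by (rule poly_ring_idealI)
      (auto intro: poly_carrier_0 poly_carrier_add poly_carrier_mult
        simp: ip_add_right distrib_right mult.assoc)
  moreover have "elem_sym r X \<in> ?J"
    if X: "X \<subseteq> {1..n}" "GP_bound \<mu> (n - card X) < int r" "r \<le> card X" for r X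
  proof -
    have "card X \<le> n" using card_mono[OF _ X(1)] by simp
    then have "n - card X < r \<or> k < r"
      using X(2,3) k_le unfolding GP_bound_two_row by (auto simp: min_def split: if_splits)
    then have "n - card X < r \<or> card M < r" using assms(2) by auto
    then have "ip (pair_poly M) (elem_sym r X * g) = 0" for g
      using ip_pair_poly_elem_sym[OF assms(1) X(1)]
    proof (induction g rule: qpoly_induct)
      case (single c m)
      then have "ip (pair_poly M) (const_poly c * (elem_sym r X * monomial m)) = 0"
        by (simp add: ip_scale_right)
      then show ?case by (metis const_poly_mult_monomial mult.left_commute)
    qed (auto simp: distrib_left ip_add_right)
    then show ?thesis using elem_sym_carrier[OF X(1)] by simp
  qed
  ultimately have "I \<subseteq> ?J" by (rule I_minimal)
  then have "ip (pair_poly M) (q * 1) = 0" using assms(3) by blast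
  then show ?thesis by simp
qed

lemma H_Int_I: "p \<in> H \<Longrightarrow> p \<in> I \<Longrightarrow> p = 0"
proof -
  assume p: "p \<in> H" "p \<in> I"
  have "H \<subseteq> {q. \<forall>g\<in>I. ip g q = 0}"
    unfolding H_def
  proof (rule Q.span_minimal[OF _ ip_orthogonal_subspace], clarify)
    fix M g assume "standard_pairing n M" "card M \<le> k" "g \<in> I"
    then show "ip g (pair_poly M) = 0"
      using ip_pair_poly_I[of M g] by (subst ip_commute) (simp add: standard_pairing_def)
  qed
  then have "ip p p = 0" using p by blast
  then show "p = 0" by (rule ip_self_eq_0)
qed

lemma specht_span_subset_H: "d \<le> k \<Longrightarrow> specht_span n d \<subseteq> H"
  unfolding specht_span_standard H_def by (rule Q.span_mono) auto

lemma sum_xvar_I: "(\<Sum>i\<in>{1..n}. xvar i) \<in> I"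
  using I_gen[of "{1..n}" 1] by (simp add: GP_bound_two_row elem_sym_1)

text \<open>Removing x_i from the variables changes e_2 by x_i (e_1 - x_i), where e_1 is the sum of
  all variables. Both versions of e_2 and also e_1 lie in the ideal.\<close>

lemma xvar_square_I:
  assumes "i \<in> {1..n}"
  shows "xvar i * xvar i \<in> I"
proof -
  let ?X = "{1..n} - {i}"
  have ins: "insert i ?X = {1..n}" using assms by auto
  have "elem_sym 1 {1..n} = elem_sym 1 ?X + xvar i"
    using elem_sym_Suc_insert[of ?X i 0, unfolded ins] by (simp add: elem_sym_0)
  moreover have "elem_sym 2 {1..n} = elem_sym 2 ?X + xvar i * elem_sym 1 ?X"
    using elem_sym_Suc_insert[of ?X i 1, unfolded ins] by (simp add: numeral_2_eq_2)
  ultimately have "xvar i * xvar i =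
      xvar i * elem_sym 1 {1..n} - (elem_sym 2 {1..n} - elem_sym 2 ?X)"
    by (simp add: algebra_simps)
  moreover have "elem_sym 1 {1..n} \<in> I" "elem_sym 2 {1..n} \<in> I" "elem_sym 2 ?X \<in> I"
  proof -
    have "card ?X = n - 1" using assms by simp
    \<comment> \<open>The bound at 1 is the number of parts minus 1, hence at most 1. This is where
      having at most two rows makes squares vanish.\<close>
    moreover have "GP_bound \<mu> (n - (n - 1)) < int 2"
      unfolding GP_bound_two_row using n_pos by simp
    ultimately show "elem_sym 2 ?X \<in> I" by (intro I_gen) auto
    show "elem_sym 1 {1..n} \<in> I" "elem_sym 2 {1..n} \<in> I"
      by (intro I_gen; simp add: GP_bound_two_row)+
  qed
  ultimately show ?thesis using poly_carrier_xvar[OF assms] by (simp add: I_diff I_mult_left)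
qed

lemma xvar_sqfree_mon_I:
  assumes "A \<subseteq> {1..n}" "b \<in> A"
  shows "xvar b * sqfree_mon A \<in> I"
proof -
  have "finite (A - {b})" using assms(1) finite_subset by blast
  then have "sqfree_mon A = xvar b * sqfree_mon (A - {b})"
    using sqfree_mon_insert[of "A - {b}" b] assms(2) by (simp add: insert_absorb)
  then have "xvar b * sqfree_mon A = xvar b * xvar b * sqfree_mon (A - {b})" by simp
  moreover have "b \<in> {1..n}" "A - {b} \<subseteq> {1..n}" using assms by auto
  ultimately show ?thesis
    using I_mult[OF xvar_square_I poly_carrier_sqfree_mon] by (simp only:)
qed

text \<open>For a single pair, (x_a + x_b)(x_b - x_a) is a difference of two squares, each in the
  ideal.\<close>

lemma sum_cover_pair_poly_I:
  assumes "pairing n M"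
  shows "(\<Sum>b\<in>cover M. xvar b) * pair_poly M \<in> I"
  using assms
proof (induction rule: pairing_induct)
  case empty
  then show ?case using I_0 by simp
next
  case (insert a b M)
  note fin = pairing_finite[OF insert.hyps(1)]
  have "(\<Sum>b\<in>cover (insert (a, b) M). xvar b) * pair_poly (insert (a, b) M) =
      (xvar b * xvar b - xvar a * xvar a) * pair_poly M +
      ((\<Sum>b\<in>cover M. xvar b) * pair_poly M) * (xvar b - xvar a)"
    using insert.hyps fin by (simp add: pair_poly_insert finite_cover algebra_simps)
  moreover have "(xvar b * xvar b - xvar a * xvar a) * pair_poly M \<in> I"
    using I_mult[OF I_diff[OF xvar_square_I xvar_square_I] pair_poly_carrier] insert.hyps by blast
  moreover have "((\<Sum>b\<in>cover M. xvar b) * pair_poly M) * (xvar b - xvar a) \<in> I"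
    using I_mult[OF insert.IH poly_carrier_diff[OF poly_carrier_xvar poly_carrier_xvar]] insert.hyps by blast
  ultimately show ?case by (simp add: I_add)
qed

section \<open>Spanning: reduction of monomials to Specht polynomials modulo the ideal\<close>

definition mod_specht :: "nat \<Rightarrow> qpoly set" where
  "mod_specht d = {f. \<exists>s\<in>specht_span n d. f - s \<in> I}"

lemma mod_I_subspace:
  assumes "Q.subspace S"
  shows "Q.subspace {f. \<exists>s\<in>S. f - s \<in> I}" (is "Q.subspace ?W")
  unfolding Q.subspace_def
proof (intro conjI ballI allI)
  show "0 \<in> ?W" using Q.subspace_0[OF assms] I_0 by (auto intro!: bexI[of _ 0])
next
  fix f g assume "f \<in> ?W" "g \<in> ?W"
  then obtain s t where "s \<in> S" "t \<in> S" "f - s \<in> I" "g - t \<in> I" by blast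
  then show "f + g \<in> ?W" using I_add[of "f - s" "g - t"] Q.subspace_add[OF assms, of s t]
    by (auto simp: algebra_simps intro!: bexI[of _ "s + t"])
next
  fix c f assume "f \<in> ?W"
  then obtain s where "s \<in> S" "f - s \<in> I" by blast
  then have "const_poly c * s \<in> S" "const_poly c * f - const_poly c * s \<in> I"
    using Q.subspace_scale[OF I_subspace, of "f - s" c] Q.subspace_scale[OF assms]
    by (auto simp: right_diff_distrib)
  then show "const_poly c * f \<in> ?W" by blast
qed

lemma mod_specht_subspace: "Q.subspace (mod_specht d)"
  unfolding mod_specht_def by (rule mod_I_subspace[OF specht_span_subspace])

lemma I_subset_mod_specht: "I \<subseteq> mod_specht d"
  unfolding mod_specht_def using Q.subspace_0[OF specht_span_subspace] by force

text \<open>Summing \<open>(x\<^sub>a - x\<^sub>b) q\<close> over all unused \<open>b\<close> and using that the sum of all variables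
  vanishes gives a positive multiple of \<open>x\<^sub>a q\<close>, because \<open>q\<close> is killed by the sum of the
  variables of each of its factors.\<close>

lemma pair_poly_sqfree_mon_reduce:
  assumes "finite A" "pairing n M" "A \<subseteq> {1..n} - cover M"
  shows "pair_poly M * sqfree_mon A \<in> mod_specht (card M + card A)"
  using assms
proof (induction A arbitrary: M rule: finite_induct)
  case empty
  then show ?case
    using pair_poly_in_specht_span[OF empty.prems(1)] I_0
    by (auto simp: mod_specht_def intro!: bexI[of _ "pair_poly M"])
next
  case (insert a A)
  note fin = pairing_finite[OF insert.prems(1)]
  let ?d = "card M + card (insert a A)"
  define q where "q = pair_poly M * sqfree_mon A"
  define U where "U = insert a (cover M \<union> A)"
  have q_carrier: "q \<in> poly_carrier n" unfolding q_def
    using insert.prems by (intro poly_carrier_mult pair_poly_carrier poly_carrier_sqfree_mon) auto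
  have U: "U \<subseteq> {1..n}" using insert.prems pairing_cover by (auto simp: U_def)
  have "(xvar a - xvar b) * q \<in> mod_specht ?d" if b: "b \<in> {1..n} - U" for b
  proof -
    have ba: "pairing n (insert (b, a) M)" "(b, a) \<notin> M"
      using pairing_insertI[OF insert.prems(1), of b a] b insert.prems by (auto simp: U_def)
    then have "pair_poly (insert (b, a) M) * sqfree_mon A
        \<in> mod_specht (card (insert (b, a) M) + card A)"
      using b insert.prems insert.hyps by (intro insert.IH) (auto simp: U_def)
    then show ?thesis
      using ba fin insert.hyps by (simp add: pair_poly_insert q_def mult.assoc)
  qed
  then have Specht: "(\<Sum>b\<in>{1..n} - U. (xvar a - xvar b) * q) \<in> mod_specht ?d"
    by (rule Q.subspace_sum[OF mod_specht_subspace])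
  have killed: "((\<Sum>b\<in>{1..n}. xvar b) - (\<Sum>b\<in>cover M. xvar b) - (\<Sum>b\<in>A. xvar b)) * q \<in> I"
  proof -
    have "(\<Sum>b\<in>{1..n}. xvar b) * q \<in> I" using sum_xvar_I q_carrier by (rule I_mult)
    moreover have "(\<Sum>b\<in>cover M. xvar b) * q \<in> I"
      unfolding q_def mult.assoc[symmetric]
      using insert.prems by (intro I_mult sum_cover_pair_poly_I poly_carrier_sqfree_mon) auto
    moreover have "(\<Sum>b\<in>A. xvar b) * q \<in> I"
    proof -
      have "pair_poly M * (xvar b * sqfree_mon A) \<in> I" if "b \<in> A" for b
        using that insert.prems by (intro I_mult_left xvar_sqfree_mon_I pair_poly_carrier) auto
      then have "(\<Sum>b\<in>A. pair_poly M * (xvar b * sqfree_mon A)) \<in> I" by (rule I_sum)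
      then show ?thesis unfolding q_def sum_distrib_right by (simp only: mult.left_commute)
    qed
    ultimately show ?thesis unfolding left_diff_distrib by (intro I_diff)
  qed
  have eq: "(\<Sum>b\<in>{1..n} - U. (xvar a - xvar b) * q) +
      ((\<Sum>b\<in>{1..n}. xvar b) - (\<Sum>b\<in>cover M. xvar b) - (\<Sum>b\<in>A. xvar b)) * q =
      const_poly (of_nat (card ({1..n} - U) + 1)) * (xvar a * q)"
  proof -
    have all: "(\<Sum>b\<in>{1..n}. xvar b) = (\<Sum>b\<in>{1..n} - U. xvar b) + (\<Sum>b\<in>U. xvar b)"
      by (rule sum.subset_diff[OF U]) simp
    have used: "(\<Sum>b\<in>U. xvar b) = xvar a + ((\<Sum>b\<in>cover M. xvar b) + (\<Sum>b\<in>A. xvar b))"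
      unfolding U_def using insert.prems insert.hyps fin
      by (subst sum.insert) (auto simp: finite_cover intro!: sum.union_disjoint)
    have unused: "(\<Sum>b\<in>{1..n} - U. (xvar a - xvar b) * q) =
        of_nat (card ({1..n} - U)) * (xvar a * q) - (\<Sum>b\<in>{1..n} - U. xvar b) * q"
      by (simp add: left_diff_distrib sum_subtractf sum_distrib_right)
    have const: "const_poly (of_nat (card ({1..n} - U) + 1)) = of_nat (card ({1..n} - U)) + 1"
      by (subst const_poly_of_nat) (simp only: of_nat_add of_nat_1)
    show ?thesis unfolding unused all used const
      by (simp only: algebra_simps mult_1_left mult_1_right)
  qed
  have "const_poly (of_nat (card ({1..n} - U) + 1)) * (xvar a * q) \<in> mod_specht ?d"
    using Q.subspace_add[OF mod_specht_subspace Specht subsetD[OF I_subset_mod_specht killed]]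
    unfolding eq .
  then have "const_poly (inverse (of_nat (card ({1..n} - U) + 1))) *
      (const_poly (of_nat (card ({1..n} - U) + 1)) * (xvar a * q)) \<in> mod_specht ?d"
    by (rule Q.subspace_scale[OF mod_specht_subspace])
  moreover have "const_poly (inverse (of_nat (card ({1..n} - U) + 1))) *
      (const_poly (of_nat (card ({1..n} - U) + 1)) * (xvar a * q)) = xvar a * q"
    unfolding Q.scale_scale by (subst left_inverse) (simp_all del: of_nat_add)
  ultimately have "xvar a * q \<in> mod_specht ?d" by (simp only:)
  then show ?case
    using insert.hyps by (simp add: q_def sqfree_mon_insert mult.left_commute)
qed

text \<open>The reduction yields Specht polynomials of degree \<open>card A\<close>, which belong to
  \<open>H\<close> only up to \<open>k\<close>. In higher degree either no pairing of that size
  exists or the monomial itself is in the ideal.\<close>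

lemma sqfree_mon_mod_H:
  assumes "A \<subseteq> {1..n}"
  shows "\<exists>h\<in>H. sqfree_mon A - h \<in> I"
proof -
  have finA: "finite A" using assms finite_subset by blast
  have "sqfree_mon A \<in> mod_specht (card A)"
    using pair_poly_sqfree_mon_reduce[OF finA pairing_empty] assms by simp
  then obtain s where s: "s \<in> specht_span n (card A)" "sqfree_mon A - s \<in> I"
    unfolding mod_specht_def by blast
  have H0: "0 \<in> H" unfolding H_def by (rule Q.span_zero)
  consider "card A \<le> k" | "k < card A" "n = 2 * k" | "k < card A" "2 * k < n"
    using k_le by linarith
  then show ?thesis
  proof cases
    case 1
    then show ?thesis using s specht_span_subset_H by blast
  next
    case 2
    \<comment> \<open>More than \<open>k\<close> disjoint pairs do not fit into \<open>2 * k\<close>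
      numbers, so the Specht span of this degree is zero.\<close>
    then have "{pair_poly M | M. pairing n M \<and> card M = card A} = {}"
      using card_pairing_le[of n] by fastforce
    then have "s \<in> Q.span {}" using s(1) unfolding specht_span_def by (simp only:)
    then have "s = 0" by simp
    then show ?thesis using s(2) H0 by blast
  next
    case 3
    then obtain B where B: "B \<subseteq> A" "card B = k + 1" using obtain_subset_with_card_n[of "k + 1" A] by auto
    have finB: "finite B" using B(1) finA finite_subset by blast
    \<comment> \<open>For a set of \<open>k + 1\<close> variables the bound is taken at
      \<open>n - k - 1\<close>. This is at least \<open>k\<close>, so the bound is \<open>k\<close>
      and the top elementary symmetric polynomial, a single monomial, is a generator.\<close>
    have "elem_sym (k + 1) B \<in> I"
      using B assms 3 by (intro I_gen) (auto simp: GP_bound_two_row)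
    then have "sqfree_mon B \<in> I" using elem_sym_card[OF finB] B(2) by simp
    moreover have "sqfree_mon A = sqfree_mon B * sqfree_mon (A - B)"
      unfolding sqfree_mon_def using B(1) finA by (subst prod.subset_diff[of B A]) (auto simp: mult.commute)
    moreover have "sqfree_mon (A - B) \<in> poly_carrier n"
      using assms by (intro poly_carrier_sqfree_mon) auto
    ultimately show ?thesis using H0 I_mult by (intro bexI[of _ 0]) auto
  qed
qed

lemma H_add_I:
  assumes "p \<in> poly_carrier n"
  shows "\<exists>h\<in>H. p - h \<in> I"
proof -
  have Hs: "Q.subspace H" by (simp add: H_def)
  let ?W = "{p. \<exists>h\<in>H. p - h \<in> I}"
  have "Q.subspace ?W" by (rule mod_I_subspace[OF Hs])
  moreover have "monomial m \<in> ?W" if "m \<in> keys p" for m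
  proof -
    have m: "keys m \<subseteq> {1..n}" using assms that by (auto simp: poly_carrier_def)
    show ?thesis
    proof (cases "\<exists>i. lookup m i \<ge> 2")
      case True
      then obtain i where i: "lookup m i \<ge> 2" by blast
      define m' where "m' = m - single i 2"
      have mm: "m = single i 2 + m'"
        using i by (intro poly_mapping_eqI) (auto simp: m'_def lookup_add lookup_minus lookup_single when_def)
      have "i \<in> keys m" using i by (simp add: in_keys_iff)
      then have in_range: "i \<in> {1..n}" using m by blast
      have "keys m' \<subseteq> {1..n}"
        using m unfolding mm keys_exponent_add by blast
      then have "monomial m' \<in> poly_carrier n" by (simp add: poly_carrier_def)
      then have "xvar i * xvar i * monomial m' \<in> I" by (rule I_mult[OF xvar_square_I[OF in_range]])
      moreover have "xvar i * xvar i * monomial m' = monomial m"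
        by (simp add: mm mult_single xvar_power power2_eq_square[symmetric])
      ultimately show ?thesis using Q.subspace_0[OF Hs] by (auto intro!: bexI[of _ 0])
    next
      case False
      have "m = ind_exp (keys m)"
      proof (rule poly_mapping_eqI)
        fix i
        have "lookup m i < 2" using False not_le by blast
        then show "lookup m i = lookup (ind_exp (keys m)) i"
          by (auto simp: lookup_ind_exp in_keys_iff less_2_cases_iff)
      qed
      then show ?thesis using sqfree_mon_mod_H[OF m] by (simp add: sqfree_mon_eq)
    qed
  qed
  ultimately have "p \<in> ?W" by (rule subspace_qpolyI)
  then show ?thesis by simp
qed

end

section \<open>Two-row tableaux\<close>

text \<open>The case of one row is separate because the parts of a partition are positive.\<close>

definition two_row_shape :: "nat \<Rightarrow> nat \<Rightarrow> nat list" where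
  "two_row_shape n j = (if j = 0 then [n] else [n - j, j])"

definition column_pairs :: "nat \<Rightarrow> (nat \<times> nat \<Rightarrow> nat) \<Rightarrow> (nat \<times> nat) set" where
  "column_pairs j T = (\<lambda>c. (T (0, c), T (1, c))) ` {..<j}"

lemma boxes_two_row:
  "boxes (two_row_shape n j) = Pair 0 ` {..<n - j} \<union> Pair 1 ` {..<j}"
  by (auto simp: boxes_def two_row_shape_def less_Suc_eq split: if_splits)

lemma mem_boxes_two_row:
  "(r, c) \<in> boxes (two_row_shape n j) \<longleftrightarrow> r = 0 \<and> c < n - j \<or> r = 1 \<and> c < j"
  by (auto simp: boxes_two_row)

lemma finite_boxes: "finite (boxes \<nu>)"
proof -
  have "boxes \<nu> = (\<Union>r<length \<nu>. Pair r ` {..<\<nu> ! r})" by (auto simp: boxes_def)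
  then show ?thesis by simp
qed

lemma card_boxes_two_row:
  assumes "j \<le> n"
  shows "card (boxes (two_row_shape n j)) = n"
proof -
  have "Pair 0 ` {..<n - j} \<inter> Pair (1::nat) ` {..<j} = {}" by auto
  then show ?thesis
    using assms by (simp add: boxes_two_row card_Un_disjoint card_image inj_on_def)
qed

lemma is_partition_two_row_shape:
  assumes "n \<ge> 1" "j \<le> n - j"
  shows "is_partition n (two_row_shape n j)"
  using assms by (auto simp: is_partition_def two_row_shape_def)

subsection \<open>Standard tableaux and standard pairings\<close>

text \<open>Content (1^n) means that each number fills exactly one box, that is, bijectivity;
  injectivity then turns the weak increase along rows into a strict one.\<close>

lemma mem_SYT_two_row:
  assumes "j \<le> n"
  shows "T \<in> SYT (two_row_shape n j) \<longleftrightarrow>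
    T \<in> extensional (boxes (two_row_shape n j)) \<and>
    bij_betw T (boxes (two_row_shape n j)) {1..n} \<and>
    (\<forall>c c'. c < c' \<longrightarrow> c' < n - j \<longrightarrow> T (0, c) < T (0, c')) \<and>
    (\<forall>c c'. c < c' \<longrightarrow> c' < j \<longrightarrow> T (1, c) < T (1, c')) \<and>
    (\<forall>c<j. c < n - j \<longrightarrow> T (0, c) < T (1, c))" (is "?L \<longleftrightarrow> ?R")
proof -
  let ?B = "boxes (two_row_shape n j)"
  have len: "sum_list (two_row_shape n j) = n" using assms by (simp add: two_row_shape_def)
  have content: "(\<forall>i. card {s \<in> ?B. T s = i} = (if 1 \<le> i \<and> i \<le> length (replicate n (1::nat))
      then replicate n 1 ! (i - 1) else 0)) \<longleftrightarrow> bij_betw T ?B {1..n}" (is "?C \<longleftrightarrow> _")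
  proof
    assume C: ?C
    have C1: "card {s \<in> ?B. T s = i} = of_bool (i \<in> {1..n})" for i
      using C[rule_format, of i] by (auto simp: of_bool_def split: if_splits)
    have "inj_on T ?B"
    proof (rule inj_onI)
      fix s s' assume s: "s \<in> ?B" "s' \<in> ?B" "T s = T s'"
      have "card {u \<in> ?B. T u = T s} \<le> 1" using C1[of "T s"] by simp
      then have "\<forall>u\<in>{u \<in> ?B. T u = T s}. \<forall>v\<in>{u \<in> ?B. T u = T s}. u = v"
        by (subst card_le_Suc0_iff_eq[symmetric]) (simp_all add: finite_boxes)
      moreover have "s \<in> {u \<in> ?B. T u = T s}" "s' \<in> {u \<in> ?B. T u = T s}" using s by simp_all
      ultimately show "s = s'" by blast
    qed
    moreover have "T ` ?B = {1..n}"
    proof (rule equalityI; rule subsetI)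
      fix i assume "i \<in> T ` ?B"
      then have "{s \<in> ?B. T s = i} \<noteq> {}" by auto
      then have "card {s \<in> ?B. T s = i} \<noteq> 0" using finite_boxes by simp
      then show "i \<in> {1..n}" unfolding C1 by (simp split: if_splits)
    next
      fix i assume "i \<in> {1..n}"
      then have "card {s \<in> ?B. T s = i} \<noteq> 0" unfolding C1 by simp
      then have "{s \<in> ?B. T s = i} \<noteq> {}" by (metis card.empty)
      then show "i \<in> T ` ?B" by auto
    qed
    ultimately show "bij_betw T ?B {1..n}" by (simp add: bij_betw_def)
  next
    assume bij: "bij_betw T ?B {1..n}"
    show ?C
    proof
      fix i
      show "card {s \<in> ?B. T s = i} = (if 1 \<le> i \<and> i \<le> length (replicate n (1::nat))
          then replicate n 1 ! (i - 1) else 0)"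
      proof (cases "i \<in> {1..n}")
        case True
        then have "i \<in> T ` ?B" using bij_betw_imp_surj_on[OF bij] by simp
        then obtain s where s: "s \<in> ?B" "T s = i" by blast
        then have "u = s" if "u \<in> ?B" "T u = i" for u
          using that inj_onD[OF bij_betw_imp_inj_on[OF bij]] by simp
        then have "{s \<in> ?B. T s = i} = {s}" using s by blast
        moreover have "i - Suc 0 < n" using True by auto
        ultimately show ?thesis using True by simp
      next
        case False
        then have "{s \<in> ?B. T s = i} = {}" using bij by (auto simp: bij_betw_def)
        then have "card {s \<in> ?B. T s = i} = 0" by (simp only: card.empty)
        then show ?thesis using False by auto
      qed
    qed
  qed
  have inj: "T s \<noteq> T s'" if "bij_betw T ?B {1..n}" "s \<in> ?B" "s' \<in> ?B" "s \<noteq> s'" for s s'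
    using that by (auto simp: bij_betw_def dest: inj_onD)
  show ?thesis
  proof
    assume L: ?L
    then have "?C" unfolding SYT_def SSYT_def len mem_Collect_eq by (elim conjE)
    then have bij: "bij_betw T ?B {1..n}" by (rule content[THEN iffD1])
    have le: "T (r, c) \<le> T (r, c')" if "(r, c) \<in> ?B" "(r, c') \<in> ?B" "c < c'" for r c c'
      using L that unfolding SYT_def SSYT_def by blast
    have strict: "T (r, c) < T (r, c')" if "(r, c) \<in> ?B" "(r, c') \<in> ?B" "c < c'" for r c c'
      using le[OF that] inj[OF bij that(1,2)] that(3) by auto
    have col: "T (0, c) < T (1, c)" if "(0, c) \<in> ?B" "(1, c) \<in> ?B" for c
      using L that unfolding SYT_def SSYT_def by blast
    have ext: "T \<in> extensional ?B" using L by (simp add: SYT_def SSYT_def)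
    show ?R
      using ext bij strict col by (auto simp: mem_boxes_two_row)
  next
    assume R: ?R
    then have "bij_betw T ?B {1..n}" by (elim conjE)
    then have C: "?C" by (rule content[THEN iffD2])
    have ext: "T \<in> extensional ?B" using R by (elim conjE)
    have rows: "\<forall>r c c'. (r, c) \<in> ?B \<longrightarrow> (r, c') \<in> ?B \<longrightarrow> c < c' \<longrightarrow> T (r, c) \<le> T (r, c')"
      using R by (auto simp: mem_boxes_two_row intro: less_imp_le)
    have cols: "\<forall>r r' c. (r, c) \<in> ?B \<longrightarrow> (r', c) \<in> ?B \<longrightarrow> r < r' \<longrightarrow> T (r, c) < T (r', c)"
      using R by (auto simp: mem_boxes_two_row)
    show ?L
      unfolding SYT_def SSYT_def len mem_Collect_eq by (intro conjI ext rows cols C)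
  qed
qed

context
  fixes n j :: nat
  assumes j_le: "j \<le> n - j" and n_pos: "n \<ge> 1"
begin

lemma j_le_n: "j \<le> n"
  using j_le by linarith

context
  fixes T :: "nat \<times> nat \<Rightarrow> nat"
  assumes bij: "bij_betw T (boxes (two_row_shape n j)) {1..n}"
begin

lemma filling_inj:
  "s \<in> boxes (two_row_shape n j) \<Longrightarrow> s' \<in> boxes (two_row_shape n j) \<Longrightarrow> T s = T s' \<longleftrightarrow> s = s'"
  using bij by (auto simp: bij_betw_def dest: inj_onD)

lemma filling_box0: "c < n - j \<Longrightarrow> T (0, c) \<in> {1..n}"
  and filling_box1: "c < j \<Longrightarrow> T (1, c) \<in> {1..n}"
  using bij unfolding bij_betw_def by (auto simp: mem_boxes_two_row simp del: atLeastAtMost_iff)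

lemma filling_cases:
  assumes "x \<in> {1..n}"
  obtains c where "c < n - j" "x = T (0, c)" | c where "c < j" "x = T (1, c)"
proof -
  obtain s where "s \<in> boxes (two_row_shape n j)" "x = T s"
    using assms bij_betw_imp_surj_on[OF bij] by blast
  then show thesis using that by (cases s) (auto simp: mem_boxes_two_row)
qed

lemma pairing_column_pairs: "pairing n (column_pairs j T)"
  and card_column_pairs: "card (column_pairs j T) = j"
proof -
  have eq: "T (0, c) = T (0, c') \<longleftrightarrow> c = c'" "T (1, c) = T (1, c') \<longleftrightarrow> c = c'" "T (0, c) \<noteq> T (1, c')"
    "T (1, c) \<noteq> T (0, c')"
    if "c < j" "c' < j" for c c'
    using that j_le filling_inj by (auto simp: mem_boxes_two_row)
  have "T (0, c) \<in> {1..n}" "T (1, c) \<in> {1..n}" if "c < j" for c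
    using that j_le filling_box0 filling_box1 by auto
  then show "pairing n (column_pairs j T)"
    unfolding pairing_def column_pairs_def using eq by (auto simp del: atLeastAtMost_iff)
  have "inj_on (\<lambda>c. (T (0, c), T (1, c))) {..<j}" using eq by (auto simp: inj_on_def)
  then show "card (column_pairs j T) = j" by (simp add: column_pairs_def card_image)
qed

lemma uncovered_column_pairs:
  "{1..n} - cover (column_pairs j T) = (\<lambda>c. T (0, c)) ` {j..<n - j}"
proof (rule equalityI; rule subsetI)
  fix x assume x: "x \<in> {1..n} - cover (column_pairs j T)"
  then have "x \<in> {1..n}" by simp
  then show "x \<in> (\<lambda>c. T (0, c)) ` {j..<n - j}"
  proof (cases rule: filling_cases)
    case (1 c)
    then have "\<not> c < j" using x by (auto simp: cover_def column_pairs_def image_image)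
    then show ?thesis using 1 by auto
  next
    case (2 c)
    then have "x \<in> cover (column_pairs j T)" by (auto simp: cover_def column_pairs_def image_image)
    then show ?thesis using x by simp
  qed
next
  fix x assume "x \<in> (\<lambda>c. T (0, c)) ` {j..<n - j}"
  then obtain c where c: "j \<le> c" "c < n - j" "x = T (0, c)" by auto
  have "T (0, c) \<noteq> T (0, c')" "T (0, c) \<noteq> T (1, c')" if "c' < j" for c'
    using that c j_le filling_inj by (auto simp: mem_boxes_two_row)
  then show "x \<in> {1..n} - cover (column_pairs j T)"
    using filling_box0[OF c(2)] c(3) by (auto simp: cover_def column_pairs_def image_image)
qed

lemma specht_poly_two_row: "specht_poly (two_row_shape n j) T = pair_poly (column_pairs j T)"
proof -
  let ?S = "{(r, r', c). (r, c) \<in> boxes (two_row_shape n j) \<and> (r', c) \<in> boxes (two_row_shape n j) \<and> r < r'}"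
  have "?S = (\<lambda>c. (0, 1, c)) ` {..<j}"
    using j_le by (auto simp: mem_boxes_two_row image_iff)
  then have "specht_poly (two_row_shape n j) T = (\<Prod>c<j. xvar (T (1, c)) - xvar (T (0, c)))"
    unfolding specht_poly_def by (simp add: prod.reindex inj_on_def)
  moreover have "inj_on (\<lambda>c. (T (0, c), T (1, c))) {..<j}"
    using card_column_pairs unfolding column_pairs_def by (intro eq_card_imp_inj_on) auto
  ultimately show ?thesis
    unfolding pair_poly_def column_pairs_def by (simp add: prod.reindex)
qed

text \<open>Preserving a column of height one means fixing its entry, so a column-stabilising
  permutation moves only numbers covered by the column pairs.\<close>

lemma col_stab_two_row: "col_stab n (two_row_shape n j) T = pair_stab (column_pairs j T)"
proof -
  let ?M = "column_pairs j T"
  have col: "{T (r, c) | r. (r, c) \<in> boxes (two_row_shape n j)} =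
      (if c < j then {T (0, c), T (1, c)} else if c < n - j then {T (0, c)} else {})" for c
    using j_le by (auto simp: mem_boxes_two_row)
  have cov: "cover ?M \<subseteq> {1..n}" by (rule pairing_cover[OF pairing_column_pairs])
  show ?thesis
  proof (rule equalityI; rule subsetI)
    fix \<tau> assume "\<tau> \<in> col_stab n (two_row_shape n j) T"
    then have perm: "\<tau> permutes {1..n}" and
      st: "\<tau> ` (if c < j then {T (0, c), T (1, c)} else if c < n - j then {T (0, c)} else {}) =
        (if c < j then {T (0, c), T (1, c)} else if c < n - j then {T (0, c)} else {})" for c
      unfolding col_stab_def col by auto
    have "\<tau> x = x" if "x \<in> {1..n} - cover ?M" for x
    proof -
      from that have "x \<in> (\<lambda>c. T (0, c)) ` {j..<n - j}" by (simp only: uncovered_column_pairs)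
      then obtain c where "j \<le> c" "c < n - j" "x = T (0, c)" by auto
      then show ?thesis using st[of c] by simp
    qed
    then have "\<tau> permutes cover ?M" by (rule permutes_superset[OF perm])
    moreover have "\<tau> ` {fst p, snd p} = {fst p, snd p}" if "p \<in> ?M" for p
    proof -
      from that obtain c where "c < j" "p = (T (0, c), T (1, c))" by (auto simp: column_pairs_def)
      then show ?thesis using st[of c] by simp
    qed
    ultimately show "\<tau> \<in> pair_stab ?M" unfolding pair_stab_def by blast
  next
    fix \<tau> assume \<tau>: "\<tau> \<in> pair_stab ?M"
    then have "\<tau> permutes cover ?M" by (simp add: pair_stab_def)
    then have perm: "\<tau> permutes {1..n}" using cov by (rule permutes_subset)
    have "\<tau> ` (if c < j then {T (0, c), T (1, c)} else if c < n - j then {T (0, c)} else {}) =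
        (if c < j then {T (0, c), T (1, c)} else if c < n - j then {T (0, c)} else {})" for c
    proof (cases "c < j")
      case True
      then have "(T (0, c), T (1, c)) \<in> ?M" by (auto simp: column_pairs_def)
      then have "\<tau> ` {T (0, c), T (1, c)} = {T (0, c), T (1, c)}"
        using \<tau> unfolding pair_stab_def by force
      then show ?thesis using True by (simp del: image_insert)
    next
      case False
      have "\<tau> (T (0, c)) = T (0, c)" if "c < n - j"
      proof (rule permutes_not_in[OF \<open>\<tau> permutes cover ?M\<close>])
        have "T (0, c) \<in> (\<lambda>c. T (0, c)) ` {j..<n - j}" using that False by auto
        then show "T (0, c) \<notin> cover ?M" unfolding uncovered_column_pairs[symmetric] by simp
      qed
      then show ?thesis using False by simp
    qed
    then show "\<tau> \<in> col_stab n (two_row_shape n j) T"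
      unfolding col_stab_def col using perm by blast
  qed
qed

text \<open>Row permutations permute the top row and hence fix its monomial, so the sum over them is
  multiplication by the order of the row group. What remains is the column antisymmetriser.\<close>

lemma eps_act_top_row:
  assumes p: "p = (\<Prod>c<j. xvar (T (1, c)))"
  shows "eps_act n (two_row_shape n j) T p =
    const_poly (of_nat (card (row_stab n (two_row_shape n j) T))) * pair_poly (column_pairs j T)"
    and "card (row_stab n (two_row_shape n j) T) \<noteq> 0"
proof -
  let ?M = "column_pairs j T" and ?R = "row_stab n (two_row_shape n j) T"
  have row1: "{T (1, c) | c. (1, c) \<in> boxes (two_row_shape n j)} = snd ` ?M"
    by (auto simp: mem_boxes_two_row column_pairs_def image_image)
  have fin: "finite ?M" by (simp add: column_pairs_def)
  have "inj_on (\<lambda>c. T (1, c)) {..<j}"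
    using filling_inj by (auto simp: inj_on_def mem_boxes_two_row)
  then have p_eq: "p = sqfree_mon (snd ` ?M)"
    unfolding p sqfree_mon_def column_pairs_def by (simp add: image_image prod.reindex)
  have fixed: "perm_act \<sigma> p = p" if "\<sigma> \<in> ?R" for \<sigma>
  proof -
    have "inj \<sigma>" using that permutes_inj by (auto simp: row_stab_def)
    moreover have "\<sigma> ` snd ` ?M = snd ` ?M"
      using that unfolding row_stab_def row1[symmetric] by blast
    ultimately show ?thesis unfolding p_eq by (simp add: perm_act_sqfree_mon)
  qed
  have "eps_act n (two_row_shape n j) T p =
      (\<Sum>\<tau>\<in>pair_stab ?M. \<Sum>\<sigma>\<in>?R. of_int (sign \<tau>) * perm_act \<tau> p)"
    unfolding eps_act_def col_stab_two_row
    by (intro sum.cong refl) (simp add: perm_act_comp[symmetric] fixed)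
  also have "\<dots> = of_nat (card ?R) * alternate ?M p"
    by (simp add: alternate_def sum_distrib_left)
  \<comment> \<open>The monomial takes the second entry of every pair, so its coefficient is +1 and
    no variable outside the cover is left over.\<close>
  also have "alternate ?M p = pair_poly ?M"
  proof -
    have "pair_coef ?M (snd ` ?M) = 1"
      unfolding pair_coef_def
    proof (rule prod.neutral, rule ballI)
      fix q assume q: "q \<in> ?M"
      then have "fst q \<notin> snd ` ?M"
        using pairing_fst_neq_snd[OF pairing_column_pairs q] by auto
      then show "of_bool (snd q \<in> snd ` ?M) - of_bool (fst q \<in> snd ` ?M) = (1 :: rat)"
        using q by simp
    qed
    moreover have "snd ` ?M - cover ?M = {}" by (auto simp: cover_def)
    then have "sqfree_mon (snd ` ?M - cover ?M) = 1" by (simp only: sqfree_mon_empty)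
    ultimately show ?thesis
      unfolding p_eq using alternate_sqfree_mon[OF pairing_column_pairs, of "snd ` ?M"] fin by simp
  qed
  finally show "eps_act n (two_row_shape n j) T p =
      const_poly (of_nat (card ?R)) * pair_poly ?M"
    by (simp add: const_poly_of_nat)
  have "finite ?R"
    by (rule finite_subset[OF _ finite_permutations[of "{1..n}"]]) (auto simp: row_stab_def)
  moreover have "id \<in> ?R" by (simp add: row_stab_def permutes_id)
  ultimately show "card ?R \<noteq> 0" by auto
qed

end

lemma SYT_bij:
  "T \<in> SYT (two_row_shape n j) \<Longrightarrow> bij_betw T (boxes (two_row_shape n j)) {1..n}"
  by (simp add: mem_SYT_two_row[OF j_le_n])

lemma standard_column_pairs:
  assumes "T \<in> SYT (two_row_shape n j)"
  shows "standard_pairing n (column_pairs j T)"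
proof -
  note bij = SYT_bij[OF assms]
  have T: "\<And>c c'. c < c' \<Longrightarrow> c' < n - j \<Longrightarrow> T (0, c) < T (0, c')"
    "\<And>c c'. c < c' \<Longrightarrow> c' < j \<Longrightarrow> T (1, c) < T (1, c')"
    "\<And>c. c < j \<Longrightarrow> T (0, c) < T (1, c)"
    using assms j_le unfolding mem_SYT_two_row[OF j_le_n] by auto
  have "fst p < snd p" if "p \<in> column_pairs j T" for p
    using that T(3) by (auto simp: column_pairs_def)
  moreover have "snd p < snd q" if "p \<in> column_pairs j T" "q \<in> column_pairs j T" "fst p < fst q" for p q
  proof -
    from that(1,2) obtain c c' where
      c: "c < j" "p = (T (0, c), T (1, c))" "c' < j" "q = (T (0, c'), T (1, c'))"
      by (auto simp: column_pairs_def)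
    then have "c < c'" using that(3) T(1)[of c' c] j_le by (cases c c' rule: linorder_cases) auto
    then show ?thesis using c T(2) by simp
  qed
  moreover have "fst p < s" if "p \<in> column_pairs j T" "s \<in> {1..n} - cover (column_pairs j T)" for p s
    using that T(1) unfolding uncovered_column_pairs[OF bij] by (auto simp: column_pairs_def)
  ultimately show ?thesis
    unfolding standard_pairing_def using pairing_column_pairs[OF bij] by blast
qed

text \<open>Increasing rows are determined by their sets of entries, and the two sets are
  complementary. Hence the column pairs, even though they omit the tail of the bottom row, determine
  the whole tableau.\<close>

lemma SYT_rows:
  assumes "T \<in> SYT (two_row_shape n j)"
  shows "map (\<lambda>c. T (1, c)) [0..<j] = sorted_list_of_set (snd ` column_pairs j T)"
    and "map (\<lambda>c. T (0, c)) [0..<n - j] = sorted_list_of_set ({1..n} - snd ` column_pairs j T)"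
proof -
  note bij = SYT_bij[OF assms]
  have T: "\<And>c c'. c < c' \<Longrightarrow> c' < n - j \<Longrightarrow> T (0, c) < T (0, c')"
    "\<And>c c'. c < c' \<Longrightarrow> c' < j \<Longrightarrow> T (1, c) < T (1, c')"
    using assms unfolding mem_SYT_two_row[OF j_le_n] by auto
  have snd_eq: "snd ` column_pairs j T = (\<lambda>c. T (1, c)) ` {..<j}"
    by (auto simp: column_pairs_def image_image)
  have "sorted_wrt (<) (map (\<lambda>c. T (1, c)) [0..<j])"
    unfolding sorted_wrt_map by (rule sorted_wrt_mono_rel[OF _ sorted_wrt_upt]) (simp add: T(2)[simplified])
  then show "map (\<lambda>c. T (1, c)) [0..<j] = sorted_list_of_set (snd ` column_pairs j T)"
    by (intro strict_sorted_equal) (simp_all add: snd_eq lessThan_atLeast0)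
  have "(\<lambda>c. T (0, c)) ` {..<n - j} = {1..n} - (\<lambda>c. T (1, c)) ` {..<j}"
  proof (rule equalityI; rule subsetI)
    fix x assume "x \<in> (\<lambda>c. T (0, c)) ` {..<n - j}"
    then obtain c where c: "c < n - j" "x = T (0, c)" by auto
    have "T (0, c) \<noteq> T (1, c')" if "c' < j" for c'
      using that c filling_inj[OF bij] by (auto simp: mem_boxes_two_row)
    then show "x \<in> {1..n} - (\<lambda>c. T (1, c)) ` {..<j}" using filling_box0[OF bij c(1)] c(2) by auto
  next
    fix x assume x: "x \<in> {1..n} - (\<lambda>c. T (1, c)) ` {..<j}"
    then have "x \<in> {1..n}" by simp
    then show "x \<in> (\<lambda>c. T (0, c)) ` {..<n - j}"
      using x by (cases rule: filling_cases[OF bij]) auto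
  qed
  then have "set (map (\<lambda>c. T (0, c)) [0..<n - j]) = {1..n} - snd ` column_pairs j T"
    by (simp add: snd_eq lessThan_atLeast0)
  moreover have "sorted_wrt (<) (map (\<lambda>c. T (0, c)) [0..<n - j])"
    unfolding sorted_wrt_map by (rule sorted_wrt_mono_rel[OF _ sorted_wrt_upt]) (simp add: T(1))
  ultimately show
    "map (\<lambda>c. T (0, c)) [0..<n - j] = sorted_list_of_set ({1..n} - snd ` column_pairs j T)"
    by (intro strict_sorted_equal) simp_all
qed

lemma column_pairs_inj_on: "inj_on (column_pairs j) (SYT (two_row_shape n j))"
proof (rule inj_onI)
  fix T T' assume T: "T \<in> SYT (two_row_shape n j)" "T' \<in> SYT (two_row_shape n j)"
    "column_pairs j T = column_pairs j T'"
  have "map (\<lambda>c. T (1, c)) [0..<j] = map (\<lambda>c. T' (1, c)) [0..<j]"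
    "map (\<lambda>c. T (0, c)) [0..<n - j] = map (\<lambda>c. T' (0, c)) [0..<n - j]"
    using SYT_rows[OF T(1)] SYT_rows[OF T(2)] T(3) by simp_all
  then have rows: "\<forall>c<j. T (1, c) = T' (1, c)" "\<forall>c<n - j. T (0, c) = T' (0, c)" by auto
  show "T = T'"
  proof (rule extensionalityI[of _ "boxes (two_row_shape n j)"])
    show "T \<in> extensional (boxes (two_row_shape n j))" "T' \<in> extensional (boxes (two_row_shape n j))"
      using T(1,2) by (simp_all add: mem_SYT_two_row[OF j_le_n])
    fix s assume "s \<in> boxes (two_row_shape n j)"
    then show "T s = T' s" using rows by (cases s) (auto simp: mem_boxes_two_row)
  qed
qed

text \<open>The bottom row lists the first entries of the pairs and then the uncovered numbers; the
  last clause of \<open>standard_pairing\<close> makes this concatenation increasing.\<close>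

lemma column_pairs_surj:
  assumes "standard_pairing n M" "card M = j"
  obtains T where "T \<in> SYT (two_row_shape n j)" "column_pairs j T = M"
proof -
  have pM: "pairing n M" using assms(1) by (simp add: standard_pairing_def)
  note fin = pairing_finite[OF pM]
  have cov: "cover M \<subseteq> {1..n}" by (rule pairing_cover[OF pM])
  define as where "as = sorted_list_of_set (fst ` M)"
  define bs where "bs = sorted_list_of_set (snd ` M)"
  define us where "us = sorted_list_of_set ({1..n} - cover M)"
  have zip: "M = set (zip as bs)" unfolding as_def bs_def by (rule standard_pairing_zip[OF assms(1)])
  have len: "length as = j" "length bs = j" "length us = n - 2 * j"
    using card_image[OF pairing_inj(1)[OF pM]] card_image[OF pairing_inj(2)[OF pM]] assms(2)
      card_cover[OF pM] card_Diff_subset[OF finite_subset[OF cov] cov]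
    by (simp_all add: as_def bs_def us_def)
  have sets: "set as = fst ` M" "set bs = snd ` M" "set us = {1..n} - cover M"
    using fin by (simp_all add: as_def bs_def us_def)
  have sorted: "sorted_wrt (<) (as @ us)" "sorted_wrt (<) bs"
  proof -
    have "x < y" if "x \<in> set as" "y \<in> set us" for x y
      using that assms(1) unfolding sets standard_pairing_def by blast
    then show "sorted_wrt (<) (as @ us)" by (simp add: sorted_wrt_append as_def us_def)
    show "sorted_wrt (<) bs" by (simp add: bs_def)
  qed
  define T where "T = restrict (\<lambda>(r, c). if r = 0 then (as @ us) ! c else bs ! c)
    (boxes (two_row_shape n j))"
  have T0: "T (0, c) = (as @ us) ! c" if "c < n - j" for c
    using that by (simp add: T_def mem_boxes_two_row)
  have T1: "T (1, c) = bs ! c" if "c < j" for c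
    using that by (simp add: T_def mem_boxes_two_row)
  have len_row: "length (as @ us) = n - j" using len j_le by simp
  have "T ` boxes (two_row_shape n j) = (\<lambda>c. (as @ us) ! c) ` {..<n - j} \<union> (\<lambda>c. bs ! c) ` {..<j}"
    unfolding boxes_two_row image_Un image_image using T0 T1 by simp
  also have "\<dots> = set (as @ us) \<union> set bs"
    using len_row len(2) by (auto simp: set_conv_nth simp del: set_append)
  also have "\<dots> = {1..n}" using cov by (auto simp: sets cover_def)
  finally have img: "T ` boxes (two_row_shape n j) = {1..n}" .
  have "inj_on T (boxes (two_row_shape n j))"
    by (rule eq_card_imp_inj_on[OF finite_boxes]) (simp add: img card_boxes_two_row[OF j_le_n])
  then have bij: "bij_betw T (boxes (two_row_shape n j)) {1..n}" using img by (simp add: bij_betw_def)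
  have col: "T (0, c) < T (1, c)" if c: "c < j" for c
  proof -
    have "(as ! c, bs ! c) \<in> M" unfolding zip using c len by (auto simp: set_zip)
    then have "as ! c < bs ! c" using assms(1) by (auto simp: standard_pairing_def)
    moreover have "T (0, c) = as ! c" using T0[of c] c len j_le by (simp add: nth_append)
    ultimately show ?thesis using T1[OF c] by simp
  qed
  have "T (0, c) < T (0, c')" if "c < c'" "c' < n - j" for c c'
    using that T0 sorted(1) len_row by (simp add: sorted_wrt_iff_nth_less)
  moreover have "T (1, c) < T (1, c')" if "c < c'" "c' < j" for c c'
    using that T1 sorted(2) len by (simp add: sorted_wrt_iff_nth_less)
  ultimately have "T \<in> SYT (two_row_shape n j)"
    unfolding mem_SYT_two_row[OF j_le_n] using bij col by (simp add: T_def)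
  moreover have "column_pairs j T = M"
  proof -
    have "column_pairs j T = (\<lambda>c. (as ! c, bs ! c)) ` {..<j}"
      unfolding column_pairs_def using T0 T1 len j_le
      by (intro image_cong) (auto simp: nth_append)
    also have "\<dots> = M" unfolding zip using len by (auto simp: set_zip)
    finally show ?thesis .
  qed
  ultimately show thesis by (rule that)
qed

end

section \<open>Cocharge labels of two-row tableaux\<close>

subsection \<open>The words \<open>2\<^sup>j 1\<^sup>p 2\<^sup>q\<close>\<close>

context
  fixes w :: "nat list" and j p q :: nat
  assumes len: "length w = j + p + q" and le: "j + q \<le> p"
    and w: "\<And>i. i < j + p + q \<Longrightarrow> w ! i = (if j \<le> i \<and> i < j + p then 1 else 2)"
begin

text \<open>The positions left after t rounds of extracting standard subwords. Each round takes the
  rightmost 1. The leading letters 2 go first, from right to left, and the final ones only after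
  \<open>j\<close> rounds; truncated subtraction expresses this switch.\<close>

definition unused :: "nat \<Rightarrow> nat set" where
  "unused t = {..<j - t} \<union> {j..<j + p - t} \<union> {j + p..<j + p + q - (t - j)}"

lemma unused_ones: "t \<le> j + q \<Longrightarrow> {i \<in> unused t. w ! i = 1} = {j..<j + p - t}"
  using le by (auto simp: unused_def w split: if_splits)

lemma unused_twos:
  "t \<le> j + q \<Longrightarrow> {i \<in> unused t. w ! i = 2} = {..<j - t} \<union> {j + p..<j + p + q - (t - j)}"
  using le by (auto simp: unused_def w split: if_splits)

lemma subword_pos_1:
  assumes "t < j + q"
  shows "subword_pos w (unused t) 0 = j + p - t - 1"
proof -
  have "Max {j..<j + p - t} = j + p - t - 1"
    using assms le by (intro Max_eqI) auto
  then show ?thesis using unused_ones[of t] assms by simp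
qed

lemma subword_pos_2:
  assumes "t < j + q"
  shows "subword_pos w (unused t) 1 = (if t < j then j - t - 1 else j + p + q - (t - j) - 1)"
proof -
  let ?m = "j + p - t - 1"
  have two: "{i \<in> unused t. i < ?m \<and> w ! i = 2} = {..<j - t}"
  proof -
    have "{i \<in> unused t. i < ?m \<and> w ! i = 2} = {i \<in> unused t. w ! i = 2} \<inter> {..<?m}" by auto
    also have "\<dots> = {..<j - t}" using assms le unfolding unused_twos[OF less_imp_le[OF assms]] by auto
    finally show ?thesis .
  qed
  have "subword_pos w (unused t) 1 =
      (if {..<j - t} \<noteq> {} then Max {..<j - t} else Max {i \<in> unused t. w ! i = 2})"
  proof -
    have "(\<exists>i\<in>unused t. i < ?m \<and> w ! i = 2) \<longleftrightarrow> {..<j - t} \<noteq> {}" unfolding two[symmetric] by blast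
    then show ?thesis
      using two subword_pos_1[OF assms] by (simp add: cprev_def numeral_2_eq_2)
  qed
  also have "\<dots> = (if t < j then j - t - 1 else j + p + q - (t - j) - 1)"
  proof (cases "t < j")
    case True
    then have "Max {..<j - t} = j - t - 1" by (intro Max_eqI) auto
    moreover have "0 \<in> {..<j - t}" using True by simp
    then have "{..<j - t} \<noteq> {}" by blast
    ultimately show ?thesis using True by (simp only: if_True not_False_eq_True)
  next
    case False
    then have "{i \<in> unused t. w ! i = 2} = {j + p..<j + p + q - (t - j)}"
      using unused_twos[of t] assms by auto
    moreover have "Max {j + p..<j + p + q - (t - j)} = j + p + q - (t - j) - 1"
      using False assms by (intro Max_eqI) auto
    ultimately show ?thesis using False by simp
  qed
  finally show ?thesis .
qed

text \<open>In each of these rounds both letters still occur, so the subword has length two. After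
  \<open>j + q\<close> rounds only letters 1 can be left.\<close>

lemma remaining_eq: "t \<le> j + q \<Longrightarrow> remaining w t = unused t"
proof (induction t)
  case 0
  then show ?case by (auto simp: unused_def len)
next
  case (Suc t)
  then have t: "t < j + q" and IH: "remaining w t = unused t" by auto
  have "(!) w ` unused t = {1, 2}"
  proof -
    have "j \<in> {i \<in> unused t. w ! i = 1}"
      unfolding unused_ones[OF less_imp_le[OF t]] using t le by auto
    moreover have "(if t < j then 0 else j + p) \<in> {i \<in> unused t. w ! i = 2}"
      unfolding unused_twos[OF less_imp_le[OF t]] using t le by auto
    ultimately have "1 \<in> (!) w ` unused t" "2 \<in> (!) w ` unused t" by force+
    moreover have "w ! i \<in> {1, 2}" if "i \<in> unused t" for i
      using that le t by (auto simp: unused_def w split: if_splits)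
    ultimately show ?thesis by blast
  qed
  then have "card ((!) w ` unused t) = 2" by simp
  moreover have "{..<2} = {0, 1 :: nat}" by auto
  ultimately have fs: "first_subword w (unused t) =
      {j + p - t - 1, if t < j then j - t - 1 else j + p + q - (t - j) - 1}"
    using subword_pos_1[OF t] subword_pos_2[OF t] by (simp add: first_subword_def)
  show ?case
  proof (cases "t < j")
    case True
    then show ?thesis
      unfolding remaining.simps IH fs using t le by (auto simp: unused_def)
  next
    case False
    then have "Suc t - j = Suc (t - j)" by (rule Suc_diff_le[OF leI])
    then show ?thesis
      unfolding remaining.simps IH fs using t le False by (auto simp: unused_def)
  qed
qed

lemma cocharge_label_eq:
  assumes "i < j + p + q"
  shows "cocharge_label w i = (if i < j then 1 else 0)"
proof (cases "j \<le> i \<and> i < j + p")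
  case True
  \<comment> \<open>A letter 1 has label 0 in whichever round it is extracted, so its round is not
    computed.\<close>
  then show ?thesis using w[OF assms] by (simp add: cocharge_label_def Let_def)
next
  case False
  \<comment> \<open>The round that uses up position \<open>i\<close>: the leading block is consumed
    from position \<open>j - 1\<close> downwards, and after \<open>j\<close> rounds the final block
    from position \<open>j + p + q - 1\<close> downwards.\<close>
  define t where "t = (if i < j then j - 1 - i else j + (j + p + q - 1 - i))"
  have t: "t < j + q" using False assms by (auto simp: t_def)
  have "(LEAST t. i \<notin> remaining w (Suc t)) = t"
  proof (rule Least_equality)
    show "i \<notin> remaining w (Suc t)"
    proof -
      have "i \<notin> unused (Suc t)"
      proof (cases "i < j")
        case True
        then have "j - Suc t = i" by (simp add: t_def)
        then show ?thesis using True by (simp add: unused_def)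
      next
        case i: False
        then have "j - Suc t = 0" "j + p + q - (Suc t - j) = i"
          using False assms by (auto simp: t_def)
        then show ?thesis using False i by (auto simp: unused_def)
      qed
      then show ?thesis using remaining_eq[of "Suc t"] t by (simp del: remaining.simps)
    qed
  next
    fix u assume u: "i \<notin> remaining w (Suc u)"
    show "t \<le> u"
    proof (rule ccontr)
      assume "\<not> t \<le> u"
      then have "Suc u \<le> t" by simp
      have "i \<in> unused (Suc u)"
      proof (cases "i < j")
        case True
        then have "i < j - Suc u" using \<open>Suc u \<le> t\<close> by (simp add: t_def)
        then show ?thesis by (simp add: unused_def)
      next
        case i: False
        then have "i < j + p + q - (Suc u - j)"
          using \<open>Suc u \<le> t\<close> assms by (simp add: t_def)
        then show ?thesis using False i by (simp add: unused_def)
      qed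
      then show False using u remaining_eq[of "Suc u"] \<open>Suc u \<le> t\<close> t by (simp del: remaining.simps)
    qed
  qed
  then have "cocharge_label w i = standard_label (subword_pos w (unused t)) 1"
    using w[OF assms] False remaining_eq[of t] t by (auto simp: cocharge_label_def Let_def)
  also have "\<dots> = (if subword_pos w (unused t) 0 < subword_pos w (unused t) 1 then 0 else 1)"
    by simp
  also have "\<dots> = (if i < j then 1 else 0)"
    unfolding subword_pos_1[OF t] subword_pos_2[OF t]
  proof (cases "i < j")
    case True
    then have "t < j" by (simp add: t_def)
    then show "(if j + p - t - 1 < (if t < j then j - t - 1 else j + p + q - (t - j) - 1)
        then 0 else 1 :: nat) = (if i < j then 1 else 0)" using True by simp
  next
    case i: False
    then have "\<not> t < j" "j + p + q - (t - j) - 1 = i" using assms by (simp_all add: t_def)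
    moreover have "j + p - t - 1 < i" using False i t le by linarith
    ultimately show "(if j + p - t - 1 < (if t < j then j - t - 1 else j + p + q - (t - j) - 1)
        then 0 else 1 :: nat) = (if i < j then 1 else 0)" using i by simp
  qed
  finally show ?thesis .
qed

end

subsection \<open>Semistandard tableaux of two-row content\<close>

lemma downward_closed_nat:
  fixes D :: "nat set"
  assumes "finite D" "\<And>x y. y \<in> D \<Longrightarrow> x < y \<Longrightarrow> x \<in> D"
  shows "D = {..<card D}"
proof (cases "D = {}")
  case False
  have "D = {..Max D}"
    using assms(2)[OF Max_in[OF assms(1) False]] Max_ge[OF assms(1)] Max_in[OF assms(1) False]
    by (auto simp: le_less)
  then show ?thesis by (metis card_atMost lessThan_Suc_atMost)
qed simp

context two_row
begin

lemma two_row_content: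
  "(if 1 \<le> i \<and> i \<le> length \<mu> then \<mu> ! (i - 1) else 0) = (if i = 1 then n - k else if i = 2 then k else 0)"
proof -
  have "i = 0 \<or> i = 1 \<or> i = 2 \<or> i > 2" by linarith
  then show ?thesis by (auto simp: \<mu>_eq)
qed

text \<open>Strict columns over the letters 1 and 2 allow at most two rows and force 2 throughout
  the top row. The letters 1 therefore sit in the bottom row, at its left end by weak increase, and
  their number is prescribed.\<close>

lemma SSYT_two_row:
  assumes "is_partition n \<nu>" "S \<in> SSYT \<nu> \<mu>"
  obtains j where "j \<le> k" "\<nu> = two_row_shape n j"
    "\<And>c. c < n - j \<Longrightarrow> S (0, c) = (if c < n - k then 1 else 2)"
    "\<And>c. c < j \<Longrightarrow> S (1, c) = 2"
proof -
  let ?B = "boxes \<nu>"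
  have row: "S (r, c) \<le> S (r, c')" if "(r, c) \<in> ?B" "(r, c') \<in> ?B" "c < c'" for r c c'
    using assms(2) that unfolding SSYT_def by blast
  have col: "S (r, c) < S (r', c)" if "(r, c) \<in> ?B" "(r', c) \<in> ?B" "r < r'" for r r' c
    using assms(2) that unfolding SSYT_def by blast
  have content: "card {s \<in> ?B. S s = i} = (if i = 1 then n - k else if i = 2 then k else 0)" for i
    using assms(2) unfolding SSYT_def two_row_content by blast
  have val: "S s \<in> {1, 2}" if "s \<in> ?B" for s
  proof (rule ccontr)
    assume "S s \<notin> {1, 2}"
    then have "card {s' \<in> ?B. S s' = S s} = 0" unfolding content by auto
    then have "{s' \<in> ?B. S s' = S s} = {}" using finite_boxes by simp
    then show False using that by blast
  qed
  have pos: "0 < \<nu> ! r" if "r < length \<nu>" for r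
    using assms(1) that unfolding is_partition_def by (metis gr0I nth_mem)
  have "length \<nu> < 3"
  proof (rule ccontr)
    assume "\<not> ?thesis"
    then have "0 < length \<nu>" "1 < length \<nu>" "2 < length \<nu>" by linarith+
    then have "(0, 0) \<in> ?B" "(1, 0) \<in> ?B" "(2, 0) \<in> ?B"
      using pos unfolding boxes_def by blast+
    then show False using col[of 0 0 1] col[of 1 0 2] val[of "(0, 0)"] val[of "(2, 0)"] by auto
  qed
  moreover have "\<nu> \<noteq> []" using assms(1) n_pos by (auto simp: is_partition_def)
  ultimately consider "length \<nu> = 1" | "length \<nu> = 2" by (cases \<nu>) (auto simp: less_Suc_eq numeral_3_eq_3)
  then obtain j where j: "\<nu> = two_row_shape n j" "j \<le> n - j"
  proof cases
    case 1
    then obtain a where "\<nu> = [a]" by (auto simp: length_Suc_conv)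
    then have "\<nu> = two_row_shape n 0" using assms(1) by (simp add: is_partition_def two_row_shape_def)
    then show ?thesis using that by blast
  next
    case 2
    then obtain a b where "\<nu> = [a, b]" by (auto simp: length_Suc_conv numeral_2_eq_2)
    then have "\<nu> = two_row_shape n b" "b \<le> n - b"
      using assms(1) by (auto simp: is_partition_def two_row_shape_def)
    then show ?thesis using that by blast
  qed
  have mem: "(r, c) \<in> ?B \<longleftrightarrow> r = 0 \<and> c < n - j \<or> r = 1 \<and> c < j" for r c
    by (simp add: j(1) mem_boxes_two_row)
  have top: "S (1, c) = 2" if "c < j" for c
    using col[of 0 c 1] val[of "(0, c)"] val[of "(1, c)"] that j(2) by (auto simp: mem)
  have "j \<le> k"
  proof -
    have "Pair 1 ` {..<j} \<subseteq> {s \<in> ?B. S s = 2}" using top mem by auto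
    then have "card (Pair (1::nat) ` {..<j}) \<le> card {s \<in> ?B. S s = 2}"
      by (rule card_mono[rotated]) (simp add: finite_boxes)
    then show ?thesis unfolding content by (simp add: card_image inj_on_def)
  qed
  moreover have "S (0, c) = (if c < n - k then 1 else 2)" if c: "c < n - j" for c
  proof -
    define D where "D = {c. c < n - j \<and> S (0, c) = 1}"
    have "{s \<in> ?B. S s = 1} = Pair 0 ` D"
    proof (rule equalityI; rule subsetI)
      fix s assume "s \<in> {s \<in> ?B. S s = 1}"
      then show "s \<in> Pair 0 ` D" using top by (cases s) (auto simp: mem D_def)
    qed (auto simp: mem D_def)
    then have "card D = n - k" using content[of 1] by (simp add: card_image inj_on_def)
    moreover have "D = {..<card D}"
    proof (rule downward_closed_nat)
      show "finite D" by (simp add: D_def)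
      fix x y assume "y \<in> D" "x < y"
      then show "x \<in> D" using row[of 0 x y] val[of "(0, x)"] by (auto simp: D_def mem)
    qed
    ultimately have "c \<in> D \<longleftrightarrow> c < n - k" by (metis lessThan_iff)
    then show ?thesis using val[of "(0, c)"] c by (auto simp: D_def mem)
  qed
  ultimately show thesis using that j(1) top by blast
qed

lemma SSYT_two_row_nonempty:
  assumes "j \<le> k"
  shows "SSYT (two_row_shape n j) \<mu> \<noteq> {}"
proof -
  let ?B = "boxes (two_row_shape n j)"
  define S where "S = restrict (\<lambda>(r, c). if r = 0 \<and> c < n - k then 1 else 2 :: nat) ?B"
  have S: "S (r, c) = (if r = 0 \<and> c < n - k then 1 else 2)" if "(r, c) \<in> ?B" for r c
    using that by (simp add: S_def)
  have le: "n - k \<le> n - j" "j \<le> n - k" using assms k_le by auto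
  have "card {s \<in> ?B. S s = i} = (if i = 1 then n - k else if i = 2 then k else 0)" for i
  proof -
    have S': "S s = (if fst s = 0 \<and> snd s < n - k then 1 else 2)" if "s \<in> ?B" for s
      using S[of "fst s" "snd s"] that by simp
    have "{s \<in> ?B. S s = 1} = {s \<in> ?B. fst s = 0 \<and> snd s < n - k}"
      by (intro Collect_cong conj_cong refl) (simp add: S')
    also have "\<dots> = Pair 0 ` {..<n - k}" using le by (auto simp: boxes_two_row)
    finally have one: "{s \<in> ?B. S s = 1} = Pair 0 ` {..<n - k}" .
    have "{s \<in> ?B. S s = 2} = {s \<in> ?B. \<not> (fst s = 0 \<and> snd s < n - k)}"
      by (intro Collect_cong conj_cong refl) (simp add: S')
    also have "\<dots> = Pair 1 ` {..<j} \<union> Pair 0 ` {n - k..<n - j}" by (auto simp: boxes_two_row)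
    finally have two: "{s \<in> ?B. S s = 2} = Pair 1 ` {..<j} \<union> Pair 0 ` {n - k..<n - j}" .
    have other: "{s \<in> ?B. S s = i} = {}" if "i \<noteq> 1" "i \<noteq> 2"
      using that S' by auto
    have "Pair 1 ` {..<j} \<inter> Pair (0::nat) ` {n - k..<n - j} = {}" by auto
    moreover have "j + (n - j - (n - k)) = k" using assms k_le by auto
    ultimately have card_two: "card {s \<in> ?B. S s = 2} = k"
      unfolding two by (simp add: card_image inj_on_def card_Un_disjoint)
    have card_one: "card {s \<in> ?B. S s = 1} = n - k"
      unfolding one by (simp add: card_image inj_on_def)
    consider "i = 1" | "i = 2" | "i \<noteq> 1" "i \<noteq> 2" by blast
    then show ?thesis
    proof cases
      case 3
      then show ?thesis by (simp only: other[OF 3] card.empty if_False)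
    qed (use card_one card_two in simp_all)
  qed
  moreover have "S \<in> extensional ?B" by (simp add: S_def)
  moreover have "S (r, c) \<le> S (r, c')" if "(r, c) \<in> ?B" "(r, c') \<in> ?B" "c < c'" for r c c'
    using that by (auto simp: S)
  moreover have "S (r, c) < S (r', c)" if "(r, c) \<in> ?B" "(r', c) \<in> ?B" "r < r'" for r r' c
  proof -
    \<comment> \<open>Since \<open>j \<le> n - k\<close>, the box below a top box carries a 1, while
      the top box carries a 2.\<close>
    have "r = 0" "r' = 1" "c < j" using that by (auto simp: mem_boxes_two_row)
    then show ?thesis using that le by (simp add: S)
  qed
  ultimately have "S \<in> SSYT (two_row_shape n j) \<mu>"
    unfolding SSYT_def mem_Collect_eq two_row_content by (intro conjI allI impI)
  then show ?thesis by blast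
qed

lemma reading_order_two_row:
  "reading_order (two_row_shape n j) = map (Pair 1) [0..<j] @ map (Pair 0) [0..<n - j]"
  by (simp add: reading_order_def two_row_shape_def)

lemma cw_two_row:
  assumes "j \<le> k" "\<And>c. c < n - j \<Longrightarrow> S (0, c) = (if c < n - k then 1 else 2)"
    "\<And>c. c < j \<Longrightarrow> S (1, c) = 2"
  shows "c < n - j \<Longrightarrow> cw (two_row_shape n j) S (0, c) = 0"
    and "c < j \<Longrightarrow> cw (two_row_shape n j) S (1, c) = 1"
proof -
  let ?ro = "reading_order (two_row_shape n j)"
  have len: "length ?ro = n" using assms(1) k_le by (simp add: reading_order_two_row)
  have total: "j + (n - k) + (k - j) = n" using assms(1) k_le by simp
  have dist: "distinct ?ro"
    by (auto simp: reading_order_two_row distinct_map inj_on_def)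
  have the: "(THE i. i < length ?ro \<and> ?ro ! i = s) = i" if "i < n" "?ro ! i = s" for i s
    using that dist len by (intro the_equality) (auto simp: nth_eq_iff_index_eq)
  have nth: "?ro ! i = (if i < j then (1, i) else (0, i - j))" if "i < n" for i
    using that by (simp add: reading_order_two_row nth_append)
  have w: "map S ?ro ! i = (if j \<le> i \<and> i < j + (n - k) then 1 else 2)" if "i < n" for i
    using that assms(1) len k_le by (auto simp: nth assms(2) assms(3)[unfolded One_nat_def])
  have label: "cocharge_label (map S ?ro) i = (if i < j then 1 else 0)" if "i < n" for i
  proof (rule cocharge_label_eq)
    show "length (map S ?ro) = j + (n - k) + (k - j)" by (simp only: length_map len total)
    show "j + (k - j) \<le> n - k" using assms(1) k_le by simp
    show "i < j + (n - k) + (k - j)" using that by (simp only: total)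
    show "map S ?ro ! i = (if j \<le> i \<and> i < j + (n - k) then 1 else 2)"
      if "i < j + (n - k) + (k - j)" for i using w that by (simp only: total)
  qed
  show "cw (two_row_shape n j) S (0, c) = 0" if "c < n - j"
    using the[of "j + c" "(0, c)"] nth[of "j + c"] label[of "j + c"] that by (simp add: cw_def)
  show "cw (two_row_shape n j) S (1, c) = 1" if "c < j"
    using the[of c "(1, c)"] nth[of c] label[of c] that assms(1) k_le by (simp add: cw_def)
qed

text \<open>The monomial is the product over the top row because of the cocharge labels, and nothing
  but the shape is left of \<open>S\<close>. This makes \<open>B_set\<close> a family indexed by
  standard tableaux alone.\<close>

lemma higher_specht_poly_two_row:
  assumes "is_partition n \<nu>" "S \<in> SSYT \<nu> \<mu>"
  obtains j where "j \<le> k" "\<nu> = two_row_shape n j"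
    "\<And>T. T \<in> SYT \<nu> \<Longrightarrow> higher_specht_poly n \<nu> S T =
      const_poly (of_nat (card (row_stab n \<nu> T))) * pair_poly (column_pairs j T)"
proof -
  obtain j where j: "j \<le> k" "\<nu> = two_row_shape n j"
    "\<And>c. c < n - j \<Longrightarrow> S (0, c) = (if c < n - k then 1 else 2)" "\<And>c. c < j \<Longrightarrow> S (1, c) = 2"
    by (rule SSYT_two_row[OF assms], rule that)
  have jn: "j \<le> n - j" using j(1) k_le by linarith
  have "higher_specht_poly n \<nu> S T =
      const_poly (of_nat (card (row_stab n \<nu> T))) * pair_poly (column_pairs j T)"
    if T: "T \<in> SYT \<nu>" for T
  proof -
    have "xmono \<nu> S T = (\<Prod>s\<in>Pair 0 ` {..<n - j}. xvar (T s) ^ cw \<nu> S s) *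
        (\<Prod>s\<in>Pair 1 ` {..<j}. xvar (T s) ^ cw \<nu> S s)"
      unfolding xmono_def j(2) boxes_two_row by (rule prod.union_disjoint) auto
    also have "(\<Prod>s\<in>Pair 0 ` {..<n - j}. xvar (T s) ^ cw \<nu> S s) = 1"
      unfolding j(2) using cw_two_row(1)[OF j(1) j(3,4)] by (intro prod.neutral) auto
    also have "(\<Prod>s\<in>Pair 1 ` {..<j}. xvar (T s) ^ cw \<nu> S s) = (\<Prod>c<j. xvar (T (1, c)))"
      unfolding j(2) using cw_two_row(2)[OF j(1) j(3,4)] by (simp add: prod.reindex inj_on_def)
    finally have "xmono \<nu> S T = (\<Prod>c<j. xvar (T (1, c)))" by simp
    then show ?thesis
      unfolding higher_specht_poly_def j(2)
      using eps_act_top_row(1)[OF jn n_pos SYT_bij[OF jn n_pos T[unfolded j(2)]]] by simp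
  qed
  then show thesis using that j(1,2) by blast
qed

end

section \<open>The quotient module\<close>

context two_row
begin

abbreviation V :: "(rat, qpoly set) module" where "V \<equiv> GP_module n \<mu>"

abbreviation proj :: "qpoly \<Rightarrow> qpoly set" where "proj \<equiv> GP_proj n \<mu>"

lemma proj_eq: "proj p = (\<lambda>i. i + p) ` I"
  unfolding GP_proj_def a_r_coset_def' by auto

lemma proj_eq_iff: "proj p = proj q \<longleftrightarrow> p - q \<in> I"
proof
  assume "proj p = proj q"
  moreover have "0 + p \<in> proj p" unfolding proj_eq using I_0 by (rule imageI)
  ultimately have "0 + p \<in> proj q" by simp
  then obtain i where "i \<in> I" "0 + p = i + q" unfolding proj_eq by (rule imageE)
  then show "p - q \<in> I" by simp
next
  have sub: "proj p \<subseteq> proj q" if "p - q \<in> I" for p q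
  proof
    fix x assume "x \<in> proj p"
    then obtain i where "i \<in> I" "x = i + p" unfolding proj_eq by (rule imageE)
    then have "x = (i + (p - q)) + q" "i + (p - q) \<in> I" using I_add that by auto
    then show "x \<in> proj q" unfolding proj_eq by (rule image_eqI)
  qed
  assume "p - q \<in> I"
  moreover then have "- (p - q) \<in> I" by (rule Q.subspace_neg[OF I_subspace])
  then have "q - p \<in> I" by simp
  ultimately show "proj p = proj q" using sub by blast
qed

lemma proj_0: "proj 0 = I"
  unfolding proj_eq by simp

lemma V_carrier: "carrier V = proj ` poly_carrier n"
  by (auto simp: GP_module_def FactRing_def A_RCOSETS_def' GP_proj_def Let_def)

lemma V_zero: "\<zero>\<^bsub>V\<^esub> = proj 0"
  by (simp add: GP_module_def FactRing_def Let_def proj_0)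

lemma V_add:
  assumes "p \<in> poly_carrier n" "q \<in> poly_carrier n"
  shows "proj p \<oplus>\<^bsub>V\<^esub> proj q = proj (p + q)"
proof -
  interpret ideal I "poly_ring n" by (rule I_ideal)
  show ?thesis using a_rcos_sum[of p q] assms
    by (simp add: GP_module_def FactRing_def Let_def GP_proj_def)
qed

lemma V_smult:
  assumes "p \<in> poly_carrier n"
  shows "c \<odot>\<^bsub>V\<^esub> proj p = proj (const_poly c * p)"
proof -
  interpret ideal I "poly_ring n" by (rule I_ideal)
  show ?thesis using rcoset_mult_add[of "const_poly c" p] assms
    by (simp add: GP_module_def FactRing_def Let_def GP_proj_def)
qed

subsection \<open>Subspaces and bases of the quotient\<close>

text \<open>With all polynomials in place of \<open>S\<close> this is the quotient itself, so one
  set of lemmas serves the quotient and its Specht submodules.\<close>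

abbreviation sub_module :: "qpoly set \<Rightarrow> (rat, qpoly set) module" where
  "sub_module S \<equiv> V\<lparr>carrier := proj ` S\<rparr>"

lemma sub_module_all: "sub_module (poly_carrier n) = V"
  by (simp flip: V_carrier)

lemma sub_module_simps:
  "carrier (sub_module S) = proj ` S" "\<zero>\<^bsub>sub_module S\<^esub> = proj 0"
  "p \<in> poly_carrier n \<Longrightarrow> q \<in> poly_carrier n \<Longrightarrow> proj p \<oplus>\<^bsub>sub_module S\<^esub> proj q = proj (p + q)"
  "p \<in> poly_carrier n \<Longrightarrow> c \<odot>\<^bsub>sub_module S\<^esub> proj p = proj (const_poly c * p)"
  by (simp_all add: V_zero V_add V_smult)

context
  fixes S
  assumes S: "S \<subseteq> poly_carrier n" "Q.subspace S"
begin

lemma S_mem: "p \<in> S \<Longrightarrow> p \<in> poly_carrier n"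
  using S(1) by blast

lemmas S_0 = Q.subspace_0[OF S(2)]
  and S_add = Q.subspace_add[OF S(2)]
  and S_scale = Q.subspace_scale[OF S(2)]
  and S_neg = Q.subspace_neg[OF S(2)]
  and S_sum = Q.subspace_sum[OF S(2)]

lemma sub_module_vectorspace: "vectorspace class_ring (sub_module S)"
proof (rule vs_criteria)
  show "field (class_ring :: rat ring)" by (rule class_field)
  show "\<forall>v\<in>carrier (sub_module S). \<exists>w\<in>carrier (sub_module S).
      v \<oplus>\<^bsub>sub_module S\<^esub> w = \<zero>\<^bsub>sub_module S\<^esub>"
  proof
    fix v assume "v \<in> carrier (sub_module S)"
    then obtain p where p: "p \<in> S" "v = proj p" by auto
    then have "v \<oplus>\<^bsub>sub_module S\<^esub> proj (- p) = \<zero>\<^bsub>sub_module S\<^esub>"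
      using S_mem S_neg by (simp add: V_add V_zero)
    then show "\<exists>w\<in>carrier (sub_module S). v \<oplus>\<^bsub>sub_module S\<^esub> w = \<zero>\<^bsub>sub_module S\<^esub>"
      using S_neg[OF p(1)] by (intro bexI[of _ "proj (- p)"]) auto
  qed
qed (auto simp: V_add V_zero V_smult S_mem S_0 S_add S_scale poly_carrier_add poly_carrier_scale
    const_poly_add distrib_left distrib_right add_ac poly_carrier_0 intro!: imageI)


lemma finsum_sub_module:
  assumes "finite A" "\<And>j. j \<in> A \<Longrightarrow> g j \<in> S"
  shows "finsum (sub_module S) (\<lambda>j. proj (g j)) A = proj (\<Sum>j\<in>A. g j)"
proof -
  interpret VS: vectorspace class_ring "sub_module S" by (rule sub_module_vectorspace)
  note am = VS.abelian_monoid_axioms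
  show ?thesis using assms
  proof (induction A rule: finite_induct)
    case empty
    then show ?case using abelian_monoid.finsum_empty[OF am] by (simp add: V_zero)
  next
    case (insert a A)
    then have g: "g a \<in> S" "\<And>j. j \<in> A \<Longrightarrow> g j \<in> S" by auto
    have "finsum (sub_module S) (\<lambda>j. proj (g j)) (insert a A) =
        proj (g a) \<oplus>\<^bsub>sub_module S\<^esub> finsum (sub_module S) (\<lambda>j. proj (g j)) A"
      using insert.hyps g by (intro abelian_monoid.finsum_insert[OF am]) auto
    also have "\<dots> = proj (g a + (\<Sum>j\<in>A. g j))"
    proof -
      have "sum g A \<in> S" by (rule S_sum) (rule g(2))
      then have "proj (g a) \<oplus>\<^bsub>sub_module S\<^esub> proj (sum g A) = proj (g a + sum g A)"
        by (intro sub_module_simps(3) S_mem g(1))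
      moreover have "finsum (sub_module S) (\<lambda>j. proj (g j)) A = proj (sum g A)"
        by (rule insert.IH) (rule g(2))
      ultimately show ?thesis by (simp only:)
    qed
    finally show ?case using insert.hyps by simp
  qed
qed

text \<open>Turns statements about cosets into congruences of polynomials: the hypotheses are
  spanning and independence modulo the ideal. Injectivity is concluded as well, because a basis is a
  set and equal cosets of different indices would merge.\<close>

lemma sub_module_basis:
  fixes b :: "'i \<Rightarrow> qpoly"
  assumes J: "finite J" "\<And>j. j \<in> J \<Longrightarrow> b j \<in> S"
    and span: "\<And>p. p \<in> S \<Longrightarrow> \<exists>c. p - (\<Sum>j\<in>J. const_poly (c j) * b j) \<in> I"
    and indep: "\<And>c. (\<Sum>j\<in>J. const_poly (c j) * b j) \<in> I \<Longrightarrow> \<forall>j\<in>J. c j = 0"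
  shows "inj_on (\<lambda>j. proj (b j)) J"
    and "vectorspace.basis class_ring (sub_module S) ((\<lambda>j. proj (b j)) ` J)"
proof -
  interpret VS: vectorspace class_ring "sub_module S" by (rule sub_module_vectorspace)
  note am = VS.abelian_monoid_axioms
  show inj: "inj_on (\<lambda>j. proj (b j)) J"
  proof (rule inj_onI, rule ccontr)
    fix i j assume ij: "i \<in> J" "j \<in> J" "proj (b i) = proj (b j)" "i \<noteq> j"
    \<comment> \<open>Two indices with the same coset give the relation
      \<open>b i - b j \<in> I\<close>; these are its coefficients.\<close>
    define c :: "'i \<Rightarrow> rat" where "c x = of_bool (x = i) - of_bool (x = j)" for x
    have single: "(\<Sum>x\<in>J. const_poly (of_bool (x = y)) * b x) = b y" if "y \<in> J" for y
    proof -
      have "(\<Sum>x\<in>J. const_poly (of_bool (x = y)) * b x) = (\<Sum>x\<in>J. if x = y then b x else 0)"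
        by (rule sum.cong) auto
      then show ?thesis using that J(1) by simp
    qed
    have "(\<Sum>x\<in>J. const_poly (c x) * b x) = b i - b j"
      unfolding c_def const_poly_diff left_diff_distrib sum_subtractf
      using single[OF ij(1)] single[OF ij(2)] by (simp only:)
    moreover have "b i - b j \<in> I" using ij(3) by (rule proj_eq_iff[THEN iffD1])
    ultimately have "\<forall>j\<in>J. c j = 0" by (intro indep) simp
    then have "c i = 0" using ij(1) by (rule bspec)
    then show False using ij(4) by (simp add: c_def)
  qed
  let ?B = "(\<lambda>j. proj (b j)) ` J"
  have lincomb: "VS.lincomb a ?B = proj (\<Sum>j\<in>J. const_poly (a (proj (b j))) * b j)" for a
  proof -
    have "VS.lincomb a ?B = finsum (sub_module S) (\<lambda>v. a v \<odot>\<^bsub>sub_module S\<^esub> v) ?B"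
      by (simp add: VS.lincomb_def)
    also have "\<dots> = finsum (sub_module S) (\<lambda>j. a (proj (b j)) \<odot>\<^bsub>sub_module S\<^esub> proj (b j)) J"
      using J(2) S_mem S_scale inj
      by (intro abelian_monoid.finsum_reindex[OF am]) (auto simp: V_smult)
    also have "\<dots> = finsum (sub_module S) (\<lambda>j. proj (const_poly (a (proj (b j))) * b j)) J"
      using J(2) S_mem S_scale
      by (intro abelian_monoid.finsum_cong'[OF am]) (auto simp: V_smult)
    also have "\<dots> = proj (\<Sum>j\<in>J. const_poly (a (proj (b j))) * b j)"
      using J S_scale by (intro finsum_sub_module) auto
    finally show ?thesis .
  qed
  have "\<exists>!a. a \<in> ?B \<rightarrow>\<^sub>E carrier class_ring \<and> VS.lincomb a ?B = v" if "v \<in> carrier (sub_module S)" for v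
  proof (rule ex_ex1I)
    obtain p where p: "p \<in> S" "v = proj p" using \<open>v \<in> carrier (sub_module S)\<close> by auto
    obtain c where c: "p - (\<Sum>j\<in>J. const_poly (c j) * b j) \<in> I" using span[OF p(1)] by blast
    define a where "a = restrict (\<lambda>v. c (inv_into J (\<lambda>j. proj (b j)) v)) ?B"
    have "a (proj (b j)) = c j" if "j \<in> J" for j
      using that inv_into_f_f[OF inj that] by (simp add: a_def)
    then have "VS.lincomb a ?B = v"
      unfolding lincomb p(2) using c
      by (intro sym[of "proj p"]) (simp add: proj_eq_iff)
    moreover have "a \<in> ?B \<rightarrow>\<^sub>E carrier class_ring" by (simp add: a_def)
    ultimately show "\<exists>a. a \<in> ?B \<rightarrow>\<^sub>E carrier class_ring \<and> VS.lincomb a ?B = v" by blast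
  next
    fix a a' assume a: "a \<in> ?B \<rightarrow>\<^sub>E carrier class_ring \<and> VS.lincomb a ?B = v"
      "a' \<in> ?B \<rightarrow>\<^sub>E carrier class_ring \<and> VS.lincomb a' ?B = v"
    then have "(\<Sum>j\<in>J. const_poly (a (proj (b j))) * b j) -
        (\<Sum>j\<in>J. const_poly (a' (proj (b j))) * b j) \<in> I"
      unfolding lincomb by (simp flip: proj_eq_iff)
    then have "(\<Sum>j\<in>J. const_poly (a (proj (b j)) - a' (proj (b j))) * b j) \<in> I"
      by (simp only: const_poly_diff left_diff_distrib sum_subtractf)
    then have "\<forall>j\<in>J. a (proj (b j)) - a' (proj (b j)) = 0" by (rule indep)
    then have eq: "a x = a' x" if "x \<in> ?B" for x using that by auto
    show "a = a'" using conjunct1[OF a(1)] conjunct1[OF a(2)] eq by (rule PiE_ext)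
  qed
  then show "VS.basis ?B"
    using J by (subst VS.basis_criterion) auto
qed

end

lemma V_vectorspace: "vectorspace class_ring V"
  using sub_module_vectorspace[OF order_refl poly_carrier_subspace] by (simp only: sub_module_all)

lemma sub_module_subspace:
  assumes "S \<subseteq> poly_carrier n" "Q.subspace S"
  shows "subspace class_ring (proj ` S) V"
proof -
  interpret VS: vectorspace class_ring V by (rule V_vectorspace)
  have "LinearCombinations.submodule class_ring (proj ` S) V"
    by (rule submodule.intro[OF VS.module_axioms])
      (use S_mem[OF assms] S_0[OF assms] S_add[OF assms] S_scale[OF assms] assms(1) in
        \<open>auto simp: V_carrier V_zero V_add V_smult\<close>)
  then show ?thesis by (intro subspace.intro V_vectorspace)
qed

lemma subspace_preimage:
  assumes "subspace class_ring U V"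
  shows "Q.subspace {p \<in> poly_carrier n. proj p \<in> U}"
proof -
  have "LinearCombinations.submodule class_ring U V" using assms by (simp add: subspace_def)
  then interpret U: submodule class_ring U V .
  show ?thesis
    unfolding Q.subspace_def
    using U.zero_closed U.m_closed[of "proj _" "proj _"] U.smult_closed[of _ "proj _"]
    by (auto simp: V_zero V_add[symmetric] V_smult[symmetric] poly_carrier_0 poly_carrier_add
        poly_carrier_scale)
qed

text \<open>The ideal is stable under \<sigma> and under its inverse, hence mapped onto itself, so
  the elementwise image of a coset is a full coset.\<close>

lemma coset_act_proj:
  assumes "\<sigma> permutes {1..n}"
  shows "coset_act \<sigma> (proj p) = proj (perm_act \<sigma> p)"
proof -
  have "perm_act \<sigma> ` I = I"
  proof (rule equalityI; rule subsetI)
    fix q assume "q \<in> I"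
    then have "perm_act (inv_into UNIV \<sigma>) q \<in> I" by (rule I_perm_act[OF permutes_inv[OF assms]])
    moreover have "q = perm_act \<sigma> (perm_act (inv_into UNIV \<sigma>) q)"
      by (simp only: perm_act_comp permutes_inv_o(1)[OF assms] perm_act_id)
    ultimately show "q \<in> perm_act \<sigma> ` I" by (rule rev_image_eqI)
  qed (use I_perm_act[OF assms] in blast)
  then have "proj (perm_act \<sigma> p) = (\<lambda>i. i + perm_act \<sigma> p) ` perm_act \<sigma> ` I"
    by (simp only: proj_eq)
  then show ?thesis
    unfolding coset_act_def proj_eq image_image by (simp add: perm_act_add)
qed

subsection \<open>The symmetric group action\<close>

lemma linear_mapI:
  fixes A :: "(rat, 'x) module" and B :: "(rat, 'y) module"
  assumes "vectorspace class_ring A" "vectorspace class_ring B"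
    and "\<And>v. v \<in> carrier A \<Longrightarrow> f v \<in> carrier B"
    and "\<And>v w. v \<in> carrier A \<Longrightarrow> w \<in> carrier A \<Longrightarrow> f (v \<oplus>\<^bsub>A\<^esub> w) = f v \<oplus>\<^bsub>B\<^esub> f w"
    and "\<And>c v. v \<in> carrier A \<Longrightarrow> f (c \<odot>\<^bsub>A\<^esub> v) = c \<odot>\<^bsub>B\<^esub> f v"
  shows "linear_map class_ring A B f"
proof -
  interpret A: vectorspace class_ring A by fact
  interpret B: vectorspace class_ring B by fact
  have "mod_hom class_ring A B f"
    by (rule mod_hom.intro[OF A.module_axioms B.module_axioms], unfold_locales)
      (use assms(3-5) in \<open>auto simp: LinearCombinations.module_hom_def\<close>)
  then show ?thesis by (intro linear_map.intro assms(1,2))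
qed

lemma V_rep: "Sn_rep n V coset_act"
  unfolding Sn_rep_def
proof (intro conjI allI impI ballI V_vectorspace)
  fix \<sigma> assume \<sigma>: "\<sigma> permutes {1..n}"
  show "linear_map class_ring V V (coset_act \<sigma>)"
    by (rule linear_mapI[OF V_vectorspace V_vectorspace])
      (auto simp: V_carrier coset_act_proj[OF \<sigma>] V_add V_smult poly_carrier_perm_act[OF \<sigma>]
        perm_act_add perm_act_mult)
next
  fix v assume "v \<in> carrier V"
  show "coset_act id v = v" by (simp add: coset_act_def)
next
  fix \<sigma> \<tau> v assume "\<sigma> permutes {1..n}" "\<tau> permutes {1..n}" "v \<in> carrier V"
  then show "coset_act (\<sigma> \<circ> \<tau>) v = coset_act \<sigma> (coset_act \<tau> v)"
    by (simp add: coset_act_def image_image perm_act_comp del: comp_apply)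
qed

subsection \<open>The Specht submodules\<close>

lemma specht_span_Int_I: "d \<le> k \<Longrightarrow> p \<in> specht_span n d \<Longrightarrow> p \<in> I \<Longrightarrow> p = 0"
  using specht_span_subset_H H_Int_I by blast

lemma proj_inj_on_specht_span:
  assumes "d \<le> k"
  shows "inj_on proj (specht_span n d)"
proof (rule inj_onI)
  fix p q assume pq: "p \<in> specht_span n d" "q \<in> specht_span n d" "proj p = proj q"
  then have "p - q \<in> specht_span n d" "p - q \<in> I"
    by (simp_all add: Q.subspace_diff proj_eq_iff)
  then show "p = q" using specht_span_Int_I[OF assms] by fastforce
qed

lemma specht_submodule_irreducible:
  assumes "d \<le> k" "specht_span n d \<noteq> {0}"
  shows "Sn_irreducible n V coset_act (proj ` specht_span n d)"
proof -
  note sub = specht_span_carrier[of n d] specht_span_subspace[of n d]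
  have "Sn_submodule n V coset_act (proj ` specht_span n d)"
    unfolding Sn_submodule_def
    using sub_module_subspace[OF sub] by (auto simp: coset_act_proj specht_span_perm_act)
  moreover have "proj ` specht_span n d \<noteq> {\<zero>\<^bsub>V\<^esub>}"
  proof
    assume eq: "proj ` specht_span n d = {\<zero>\<^bsub>V\<^esub>}"
    have "p = 0" if "p \<in> specht_span n d" for p
    proof -
      have "proj p = proj 0" using that eq by (auto simp: V_zero)
      then show ?thesis using specht_span_Int_I[OF assms(1) that] by (simp add: proj_eq_iff)
    qed
    then show False using assms(2) Q.subspace_0[OF sub(2)] by blast
  qed
  moreover have "U = {\<zero>\<^bsub>V\<^esub>} \<or> U = proj ` specht_span n d"
    if U: "Sn_submodule n V coset_act U" "U \<subseteq> proj ` specht_span n d" for U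
  proof -
    have Usub: "subspace class_ring U V"
      and Ust: "\<And>\<sigma> u. \<sigma> permutes {1..n} \<Longrightarrow> u \<in> U \<Longrightarrow> coset_act \<sigma> u \<in> U"
      using U(1) by (auto simp: Sn_submodule_def)
    \<comment> \<open>The submodule is pulled back to polynomials inside the Specht span, where
      irreducibility is already known; \<open>U\<close> is the image of this preimage.\<close>
    define U' where "U' = {p \<in> specht_span n d. proj p \<in> U}"
    have "U' = specht_span n d \<inter> {p \<in> poly_carrier n. proj p \<in> U}"
      using sub(1) by (auto simp: U'_def)
    then have "Q.subspace U'"
      using Q.subspace_inter[OF sub(2) subspace_preimage[OF Usub]] by simp
    moreover have "U' \<subseteq> specht_span n d" by (auto simp: U'_def)
    moreover have "perm_act \<sigma> u \<in> U'" if "\<sigma> permutes {1..n}" "u \<in> U'" for \<sigma> u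
      using that Ust[OF that(1), of "proj u"]
      by (auto simp: U'_def specht_span_perm_act coset_act_proj)
    ultimately have "U' = {0} \<or> U' = specht_span n d" by (rule specht_span_irreducible)
    moreover have "U = proj ` U'" using U(2) by (auto simp: U'_def)
    ultimately show ?thesis by (auto simp: V_zero)
  qed
  ultimately show ?thesis unfolding Sn_irreducible_def by blast
qed

end

lemma poly_module_vectorspace: "vectorspace class_ring (poly_module n)"
proof (rule vs_criteria)
  show "field (class_ring :: rat ring)" by (rule class_field)
  show "\<forall>v\<in>carrier (poly_module n). \<exists>w\<in>carrier (poly_module n).
      v \<oplus>\<^bsub>poly_module n\<^esub> w = \<zero>\<^bsub>poly_module n\<^esub>"
    by (auto simp: poly_module_def intro!: poly_carrier_neg bexI[of _ "- _"])
qed (auto simp: poly_module_def poly_carrier_0 poly_carrier_add poly_carrier_scale const_poly_add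
    distrib_left distrib_right add_ac)

text \<open>Links the carrier-based span in the definition of \<open>specht_module\<close> with the
  type-based span used everywhere else.\<close>

lemma poly_module_span:
  assumes "A \<subseteq> poly_carrier n"
  shows "LinearCombinations.module.span class_ring (poly_module n) A = Q.span A"
proof -
  interpret P: vectorspace class_ring "poly_module n" by (rule poly_module_vectorspace)
  note am = P.abelian_monoid_axioms
  have fs: "finsum (poly_module n) g X = sum g X" if "finite X" "\<And>x. x \<in> X \<Longrightarrow> g x \<in> poly_carrier n"
    for g and X :: "qpoly set"
    using that
  proof (induction X rule: finite_induct)
    case empty
    then show ?case using abelian_monoid.finsum_empty[OF am] by (simp add: poly_module_def)
  next
    case (insert x X)
    then show ?case
      using abelian_monoid.finsum_insert[OF am insert.hyps(1,2), of g]
      by (auto simp: poly_module_def)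
  qed
  have lincomb: "P.lincomb a X = (\<Sum>v\<in>X. const_poly (a v) * v)" if "finite X" "X \<subseteq> A" for a X
  proof -
    have "P.lincomb a X = finsum (poly_module n) (\<lambda>v. const_poly (a v) * v) X"
      unfolding P.lincomb_def by (simp add: poly_module_def)
    also have "\<dots> = (\<Sum>v\<in>X. const_poly (a v) * v)"
      using that assms by (intro fs) (auto intro: poly_carrier_scale)
    finally show ?thesis .
  qed
  show ?thesis
  proof (rule equalityI; rule subsetI)
    fix x assume "x \<in> P.span A"
    then obtain a X where X: "finite X" "X \<subseteq> A" "x = P.lincomb a X" unfolding P.span_def by blast
    then show "x \<in> Q.span A" unfolding lincomb[OF X(1,2)] Q.span_explicit by blast
  next
    fix x assume "x \<in> Q.span A"
    then obtain a X where X: "finite X" "X \<subseteq> A" "x = (\<Sum>v\<in>X. const_poly (a v) * v)"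
      unfolding Q.span_explicit by blast
    then have "x = P.lincomb a X" by (simp only: lincomb)
    then show "x \<in> P.span A" unfolding P.span_def using X(1,2) by auto
  qed
qed

text \<open>The generators come from all fillings and so are Specht polynomials of pairings. For the
  converse it is enough to reach standard pairings, since straightening supplies the rest of the
  span.\<close>

lemma specht_module_two_row:
  assumes "n \<ge> 1" "d \<le> n - d"
  shows "specht_module n (two_row_shape n d) = (poly_module n)\<lparr>carrier := specht_span n d\<rparr>"
proof -
  let ?G = "{specht_poly (two_row_shape n d) T | T. bij_betw T (boxes (two_row_shape n d)) {1..n}}"
  have gen: "specht_poly (two_row_shape n d) T = pair_poly (column_pairs d T)"
    "pairing n (column_pairs d T)" "card (column_pairs d T) = d"
    if "bij_betw T (boxes (two_row_shape n d)) {1..n}" for T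
    using specht_poly_two_row[OF assms(2,1) that] pairing_column_pairs[OF assms(2,1) that]
      card_column_pairs[OF assms(2,1) that] by auto
  have "?G \<subseteq> poly_carrier n" using gen(1,2) pair_poly_carrier by auto
  then have "LinearCombinations.module.span class_ring (poly_module n) ?G = Q.span ?G"
    by (rule poly_module_span)
  also have "\<dots> = specht_span n d"
  proof
    show "Q.span ?G \<subseteq> specht_span n d"
      unfolding specht_span_def using gen by (intro Q.span_mono) auto
    have "pair_poly M \<in> ?G" if M: "standard_pairing n M" "card M = d" for M
    proof -
      obtain T where T: "T \<in> SYT (two_row_shape n d)" "column_pairs d T = M"
        using column_pairs_surj[OF assms(2,1) M] .
      then have "bij_betw T (boxes (two_row_shape n d)) {1..n}" using SYT_bij[OF assms(2,1)] by blast
      then show ?thesis using gen(1) T(2) by (intro CollectI exI[of _ T]) simp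
    qed
    then show "specht_span n d \<subseteq> Q.span ?G"
      unfolding specht_span_standard by (intro Q.span_mono) auto
  qed
  finally show ?thesis by (simp add: specht_module_def)
qed

context two_row
begin

lemma specht_submodule_iso:
  assumes "d \<le> k"
  shows "Sn_iso n (sub_module (specht_span n d)) coset_act
    (specht_module n (two_row_shape n d)) perm_act"
proof -
  let ?S = "specht_span n d" and ?P = "(poly_module n)\<lparr>carrier := specht_span n d\<rparr>"
  \<comment> \<open>The isomorphism is the inverse of the projection, which is injective here
    because a Specht span of degree at most \<open>k\<close> meets the ideal in 0.\<close>
  define \<phi> where "\<phi> = inv_into ?S proj"
  have \<phi>: "\<phi> (proj p) = p" if "p \<in> ?S" for p
    unfolding \<phi>_def using proj_inj_on_specht_span[OF assms] that by (rule inv_into_f_f)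
  note sub = specht_span_carrier[of n d] specht_span_subspace[of n d]
  have mem: "p \<in> poly_carrier n" if "p \<in> ?S" for p using that sub(1) by blast
  interpret P: vectorspace class_ring "poly_module n" by (rule poly_module_vectorspace)
  have "LinearCombinations.submodule class_ring ?S (poly_module n)"
    by (rule submodule.intro[OF P.module_axioms])
      (use sub in \<open>auto simp: poly_module_def Q.subspace_0 Q.subspace_add Q.subspace_scale\<close>)
  then have vsP: "vectorspace class_ring ?P"
    by (intro P.subspace_is_vs subspace.intro poly_module_vectorspace)
  have "linear_map class_ring (sub_module ?S) ?P \<phi>"
    by (rule linear_mapI[OF sub_module_vectorspace[OF sub] vsP])
      (auto simp: \<phi> mem V_add V_smult poly_module_def Q.subspace_add[OF sub(2)]
        Q.subspace_scale[OF sub(2)])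
  moreover have "bij_betw \<phi> (carrier (sub_module ?S)) (carrier ?P)"
    using bij_betw_inv_into[OF inj_on_imp_bij_betw[OF proj_inj_on_specht_span[OF assms]]]
    by (simp add: \<phi>_def)
  moreover have "\<phi> (coset_act \<sigma> v) = perm_act \<sigma> (\<phi> v)"
    if "\<sigma> permutes {1..n}" "v \<in> carrier (sub_module ?S)" for \<sigma> v
    using that by (auto simp: coset_act_proj \<phi> specht_span_perm_act)
  moreover have "d \<le> n - d" using assms k_le by linarith
  ultimately show ?thesis
    unfolding Sn_iso_def specht_module_two_row[OF n_pos \<open>d \<le> n - d\<close>] by blast
qed

section \<open>Decomposition of the complement by degree\<close>

lemma H_decompose:
  assumes "h \<in> H"
  obtains s where "\<And>d. d \<le> k \<Longrightarrow> s d \<in> specht_span n d" "h = (\<Sum>d\<le>k. s d)"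
proof -
  let ?W = "{h. \<exists>s. (\<forall>d\<le>k. s d \<in> specht_span n d) \<and> h = (\<Sum>d\<le>k. s d)}"
  have "H \<subseteq> ?W"
    unfolding H_def
  proof (rule Q.span_minimal)
    show "{pair_poly M | M. standard_pairing n M \<and> card M \<le> k} \<subseteq> ?W"
    proof clarify
      fix M assume M: "standard_pairing n M" "card M \<le> k"
      have "(\<Sum>d\<le>k. if d = card M then pair_poly M else 0) = pair_poly M" using M(2) by simp
      moreover have "(if d = card M then pair_poly M else 0) \<in> specht_span n d" for d
        using pair_poly_in_specht_span[of n M] M(1) Q.subspace_0[OF specht_span_subspace]
        by (simp add: standard_pairing_def)
      ultimately show "\<exists>s. (\<forall>d\<le>k. s d \<in> specht_span n d) \<and> pair_poly M = (\<Sum>d\<le>k. s d)"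
        by (intro exI[of _ "\<lambda>d. if d = card M then pair_poly M else 0"]) simp
    qed
    show "Q.subspace ?W"
      unfolding Q.subspace_def
    proof (intro conjI ballI allI)
      show "0 \<in> ?W"
        using Q.subspace_0[OF specht_span_subspace] by (auto intro!: exI[of _ "\<lambda>_. 0"])
    next
      fix f g assume "f \<in> ?W" "g \<in> ?W"
      then obtain s t where "\<forall>d\<le>k. s d \<in> specht_span n d" "f = (\<Sum>d\<le>k. s d)"
        "\<forall>d\<le>k. t d \<in> specht_span n d" "g = (\<Sum>d\<le>k. t d)" by blast
      then show "f + g \<in> ?W"
        using Q.subspace_add[OF specht_span_subspace]
        by (auto simp: sum.distrib intro!: exI[of _ "\<lambda>d. s d + t d"])
    next
      fix c f assume "f \<in> ?W"
      then obtain s where "\<forall>d\<le>k. s d \<in> specht_span n d" "f = (\<Sum>d\<le>k. s d)" by blast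
      then show "const_poly c * f \<in> ?W"
        using Q.subspace_scale[OF specht_span_subspace]
        by (auto simp: sum_distrib_left intro!: exI[of _ "\<lambda>d. const_poly c * s d"])
    qed
  qed
  then show thesis using assms that by blast
qed

text \<open>Specht spans of different degrees share no monomial, so nothing can cancel between the
  summands.\<close>

lemma specht_span_independent:
  assumes s: "\<And>d. d \<le> k \<Longrightarrow> s d \<in> specht_span n d" and zero: "(\<Sum>d\<le>k. s d) = 0" and "d \<le> k"
  shows "s d = 0"
proof (rule poly_mapping_eqI)
  fix m
  have deg: "\<exists>A. finite A \<and> card A = e \<and> m = ind_exp A" if "e \<le> k" "coef (s e) m \<noteq> 0" for e
    using s[OF that(1)] specht_span_sqfree_homog[of n e] that(2)
    unfolding sqfree_homog_def by (auto simp: in_keys_iff)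
  have other: "coef (s e) m = 0" if "coef (s d) m \<noteq> 0" "e \<le> k" "e \<noteq> d" for e
  proof (rule ccontr)
    assume "coef (s e) m \<noteq> 0"
    from deg[OF that(2) this] obtain A where A: "finite A" "card A = e" "m = ind_exp A"
      by (elim exE conjE)
    from deg[OF \<open>d \<le> k\<close> that(1)] obtain B where "finite B" "card B = d" "m = ind_exp B"
      by (elim exE conjE)
    then show False using A that(3) by (simp add: ind_exp_inj)
  qed
  show "coef (s d) m = coef 0 m"
  proof (rule ccontr)
    assume nz: "\<not> ?thesis"
    then have "coef (\<Sum>e\<le>k. s e) m = coef (s d) m"
      unfolding lookup_sum using other \<open>d \<le> k\<close> by (subst sum.remove[of _ d]) auto
    then show False using zero nz by simp
  qed
qed

end

section \<open>The higher Specht basis\<close>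

lemma span_family_subset:
  assumes "finite J" "p \<in> Q.span (f ` J)"
  shows "\<exists>c. p = (\<Sum>j\<in>J. const_poly (c j) * f j)"
proof -
  let ?W = "{p. \<exists>c. p = (\<Sum>j\<in>J. const_poly (c j) * f j)}"
  have "Q.span (f ` J) \<subseteq> ?W"
  proof (rule Q.span_minimal)
    show "f ` J \<subseteq> ?W"
    proof clarify
      fix i assume "i \<in> J"
      have "(\<Sum>j\<in>J. const_poly (of_bool (j = i)) * f j) = (\<Sum>j\<in>J. if j = i then f j else 0)"
        by (rule sum.cong) auto
      also have "\<dots> = f i" using \<open>i \<in> J\<close> assms(1) by simp
      finally show "\<exists>c. f i = (\<Sum>j\<in>J. const_poly (c j) * f j)"
        by (intro exI[of _ "\<lambda>j. of_bool (j = i)"]) (rule sym)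
    qed
    show "Q.subspace ?W"
      unfolding Q.subspace_def
    proof (intro conjI ballI allI)
      show "0 \<in> ?W" by (intro CollectI exI[of _ "\<lambda>_. 0"]) simp
    next
      fix p q assume "p \<in> ?W" "q \<in> ?W"
      then obtain c d where "p = (\<Sum>j\<in>J. const_poly (c j) * f j)"
        "q = (\<Sum>j\<in>J. const_poly (d j) * f j)" by blast
      then show "p + q \<in> ?W"
        by (intro CollectI exI[of _ "\<lambda>j. c j + d j"])
          (simp add: const_poly_add distrib_right sum.distrib)
    next
      fix a p assume "p \<in> ?W"
      then obtain c where "p = (\<Sum>j\<in>J. const_poly (c j) * f j)" by blast
      then show "const_poly a * p \<in> ?W"
        by (intro CollectI exI[of _ "\<lambda>j. a * c j"]) (simp add: sum_distrib_left)
    qed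
  qed
  then show ?thesis using assms(2) by blast
qed

lemma two_row_shape_inj:
  assumes "two_row_shape n i = two_row_shape n j"
  shows "i = j"
  using assms by (auto simp: two_row_shape_def split: if_splits)

lemma standard_pairing_exists:
  assumes "2 * d \<le> n"
  obtains M where "standard_pairing n M" "card M = d"
proof -
  \<comment> \<open>The first \<open>d\<close> columns are filled row by row, with 1, ..., d below d
    + 1, ..., 2d; all uncovered numbers are larger than 2d.\<close>
  define M where "M = (\<lambda>i. (i, d + i)) ` {1..d}"
  have cover: "cover M = {1..2 * d}"
  proof (rule equalityI; rule subsetI)
    fix x assume "x \<in> {1..2 * d}"
    then consider "x \<in> {1..d}" | "x - d \<in> {1..d}" "x = d + (x - d)" by fastforce
    then show "x \<in> cover M" by cases (auto simp: cover_def M_def image_image image_iff)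
  qed (auto simp: cover_def M_def)
  have "pairing n M" using assms by (auto simp: pairing_def M_def)
  then have "standard_pairing n M"
    unfolding standard_pairing_def cover using assms by (auto simp: M_def)
  moreover have "card M = d" by (simp add: M_def card_image inj_on_def)
  ultimately show thesis by (rule that)
qed

context two_row
begin

section \<open>Indexing the basis by standard pairings\<close>

definition std :: "nat \<Rightarrow> (nat \<times> nat) set set" where
  "std d = {M. standard_pairing n M \<and> card M = d}"

definition std_upto :: "(nat \<times> nat) set set" where
  "std_upto = {M. standard_pairing n M \<and> card M \<le> k}"

definition tab :: "(nat \<times> nat) set \<Rightarrow> nat \<times> nat \<Rightarrow> nat" where
  "tab M = inv_into (SYT (two_row_shape n (card M))) (column_pairs (card M)) M"

definition scalar :: "(nat \<times> nat) set \<Rightarrow> rat" where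
  "scalar M = of_nat (card (row_stab n (two_row_shape n (card M)) (tab M)))"

text \<open>The higher Specht polynomial of the tableau with column pairs \<open>M\<close>, of which
  there is exactly one when \<open>M\<close> is standard with at most \<open>k\<close> pairs. The
  scalar, the order of its row group, is kept because \<open>B_set\<close> contains this very
  multiple.\<close>

definition vec :: "(nat \<times> nat) set \<Rightarrow> qpoly" where
  "vec M = const_poly (scalar M) * pair_poly M"

lemma le_half: "d \<le> k \<Longrightarrow> d \<le> n - d"
  using k_le by linarith

lemma tab:
  assumes "standard_pairing n M" "card M \<le> k"
  shows "tab M \<in> SYT (two_row_shape n (card M))" "column_pairs (card M) (tab M) = M"
proof -
  obtain T where "T \<in> SYT (two_row_shape n (card M))" "column_pairs (card M) T = M"
    by (rule column_pairs_surj[OF le_half[OF assms(2)] n_pos assms(1) refl])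
  then have "M \<in> column_pairs (card M) ` SYT (two_row_shape n (card M))" by blast
  then show "tab M \<in> SYT (two_row_shape n (card M))" "column_pairs (card M) (tab M) = M"
    unfolding tab_def by (rule inv_into_into, rule f_inv_into_f)
qed

lemma scalar_nonzero:
  assumes "standard_pairing n M" "card M \<le> k"
  shows "scalar M \<noteq> 0"
  using eps_act_top_row(2)[OF le_half[OF assms(2)] n_pos
      SYT_bij[OF le_half[OF assms(2)] n_pos tab(1)[OF assms]] refl]
  by (simp add: scalar_def)

text \<open>Standard pairings with at most \<open>k\<close> pairs correspond to the standard
  tableaux of the shapes that admit a semistandard filling. For the reverse inclusion any filling
  \<open>S\<close> of the shape will do, as the polynomial depends on its shape only.\<close>

lemma B_set_eq: "B_set n \<mu> = vec ` std_upto"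
proof (rule equalityI; rule subsetI)
  fix F assume "F \<in> B_set n \<mu>"
  then obtain \<nu> S T where F: "F = higher_specht_poly n \<nu> S T" "is_partition n \<nu>" "S \<in> SSYT \<nu> \<mu>"
    "T \<in> SYT \<nu>" unfolding B_set_def by blast
  obtain j where j: "j \<le> k" "\<nu> = two_row_shape n j"
    "\<And>T. T \<in> SYT \<nu> \<Longrightarrow> higher_specht_poly n \<nu> S T =
      const_poly (of_nat (card (row_stab n \<nu> T))) * pair_poly (column_pairs j T)"
    by (rule higher_specht_poly_two_row[OF F(2,3)], rule that)
  note half = le_half[OF j(1)]
  have T: "T \<in> SYT (two_row_shape n j)" using F(4) j(2) by simp
  define M where "M = column_pairs j T"
  have M: "standard_pairing n M" "card M = j"
    unfolding M_def using standard_column_pairs[OF half n_pos T]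
      card_column_pairs[OF half n_pos SYT_bij[OF half n_pos T]] by auto
  have "tab M = T"
    unfolding tab_def M(2) unfolding M_def by (rule inv_into_f_f[OF column_pairs_inj_on[OF half n_pos] T])
  moreover have "F = const_poly (of_nat (card (row_stab n (two_row_shape n j) T))) * pair_poly M"
    unfolding F(1) M_def using j(3)[OF F(4)] by (simp only: j(2))
  ultimately have "F = vec M" by (simp only: vec_def scalar_def M(2))
  moreover have "M \<in> std_upto" using M j(1) by (simp add: std_upto_def)
  ultimately show "F \<in> vec ` std_upto" by blast
next
  fix F assume "F \<in> vec ` std_upto"
  then obtain M where M: "F = vec M" "standard_pairing n M" "card M \<le> k"
    by (auto simp: std_upto_def)
  let ?\<nu> = "two_row_shape n (card M)"
  obtain S where S: "S \<in> SSYT ?\<nu> \<mu>" using SSYT_two_row_nonempty[OF M(3)] by blast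
  have part: "is_partition n ?\<nu>" by (rule is_partition_two_row_shape[OF n_pos le_half[OF M(3)]])
  obtain j where j: "j \<le> k" "?\<nu> = two_row_shape n j"
    "\<And>T. T \<in> SYT ?\<nu> \<Longrightarrow> higher_specht_poly n ?\<nu> S T =
      const_poly (of_nat (card (row_stab n ?\<nu> T))) * pair_poly (column_pairs j T)"
    by (rule higher_specht_poly_two_row[OF part S], rule that)
  have "card M = j" by (rule two_row_shape_inj[OF j(2)])
  then have "F = higher_specht_poly n ?\<nu> S (tab M)"
    using j(3)[OF tab(1)[OF M(2,3)]] tab(2)[OF M(2,3)] by (simp add: M(1) vec_def scalar_def)
  then show "F \<in> B_set n \<mu>"
    unfolding B_set_def using part S tab(1)[OF M(2,3)] by blast
qed

lemma finite_std_upto: "finite std_upto"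
proof -
  have "std_upto \<subseteq> Pow ({1..n} \<times> {1..n})"
    by (auto simp: std_upto_def standard_pairing_def pairing_def)
  then show ?thesis by (rule finite_subset) simp
qed

lemma std_subset: "d \<le> k \<Longrightarrow> std d \<subseteq> std_upto"
  by (auto simp: std_def std_upto_def)

lemma std_uptoD: "M \<in> std_upto \<Longrightarrow> standard_pairing n M" "M \<in> std_upto \<Longrightarrow> card M \<le> k"
  "M \<in> std_upto \<Longrightarrow> pairing n M"
  by (auto simp: std_upto_def standard_pairing_def)

lemma vec_specht_span:
  assumes "M \<in> std_upto"
  shows "vec M \<in> specht_span n (card M)"
  unfolding vec_def using pair_poly_in_specht_span[OF std_uptoD(3)[OF assms]]
  by (rule Q.subspace_scale[OF specht_span_subspace])

lemma vec_H: "M \<in> std_upto \<Longrightarrow> vec M \<in> H"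
  using vec_specht_span specht_span_subset_H std_uptoD(2) by blast

text \<open>A combination lying in the ideal also lies in \<open>H\<close>, so it is zero as a
  polynomial; then independence of the Specht polynomials applies, and the scalars can be divided
  out.\<close>

lemma vec_independent:
  assumes "X \<subseteq> std_upto" "(\<Sum>M\<in>X. const_poly (c M) * vec M) \<in> I"
  shows "\<forall>M\<in>X. c M = 0"
proof -
  have "(\<Sum>M\<in>X. const_poly (c M) * vec M) \<in> H"
    unfolding H_def using vec_H assms(1)
    by (intro Q.span_sum Q.span_scale) (auto simp: H_def)
  then have "(\<Sum>M\<in>X. const_poly (c M) * vec M) = 0" using assms(2) by (rule H_Int_I)
  then have "(\<Sum>M\<in>X. const_poly (c M * scalar M) * pair_poly M) = 0"
    unfolding vec_def by simp
  moreover have "finite X" using assms(1) finite_std_upto by (rule finite_subset)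
  ultimately have "\<forall>M\<in>X. c M * scalar M = 0"
    using assms(1) std_uptoD(1) by (intro standard_independent) auto
  then show ?thesis using scalar_nonzero std_uptoD(1,2) assms(1) by (meson mult_eq_0_iff subsetD)
qed

lemma vec_spanning:
  assumes "X \<subseteq> std_upto" "p \<in> Q.span (pair_poly ` X)"
  shows "\<exists>c. p = (\<Sum>M\<in>X. const_poly (c M) * vec M)"
proof -
  have "finite X" using assms(1) finite_std_upto by (rule finite_subset)
  then obtain c where c: "p = (\<Sum>M\<in>X. const_poly (c M) * pair_poly M)"
    using span_family_subset assms(2) by blast
  have "const_poly (c M / scalar M) * vec M = const_poly (c M) * pair_poly M" if "M \<in> X" for M
    using scalar_nonzero[OF std_uptoD(1,2)] that assms(1) unfolding vec_def by auto
  then have "p = (\<Sum>M\<in>X. const_poly (c M / scalar M) * vec M)"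
    unfolding c by (intro sum.cong) auto
  then show ?thesis by (intro exI[of _ "\<lambda>M. c M / scalar M"])
qed

lemma specht_span_std: "specht_span n d = Q.span (pair_poly ` std d)"
  unfolding specht_span_standard std_def by (rule arg_cong[where f = Q.span]) auto

lemma basis_V:
  shows "inj_on (\<lambda>M. proj (vec M)) std_upto"
    and "vectorspace.basis class_ring V ((\<lambda>M. proj (vec M)) ` std_upto)"
proof -
  have mem: "vec M \<in> poly_carrier n" if "M \<in> std_upto" for M
    using vec_specht_span[OF that] specht_span_carrier by blast
  have span: "\<exists>c. p - (\<Sum>M\<in>std_upto. const_poly (c M) * vec M) \<in> I" if p: "p \<in> poly_carrier n" for p
  proof -
    obtain h where h: "h \<in> H" "p - h \<in> I" using H_add_I[OF p] by blast
    have "H = Q.span (pair_poly ` std_upto)"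
      unfolding H_def std_upto_def by (rule arg_cong[where f = Q.span]) auto
    then obtain c where "h = (\<Sum>M\<in>std_upto. const_poly (c M) * vec M)"
      using vec_spanning[OF order_refl] h(1) by blast
    then show ?thesis using h(2) by blast
  qed
  note basis = sub_module_basis[OF order_refl poly_carrier_subspace finite_std_upto mem span
      vec_independent[OF order_refl]]
  show "inj_on (\<lambda>M. proj (vec M)) std_upto" by (rule basis(1))
  show "vectorspace.basis class_ring V ((\<lambda>M. proj (vec M)) ` std_upto)"
    using basis(2) by (simp only: sub_module_all)
qed

lemma basis_specht:
  assumes "d \<le> k"
  shows "vectorspace.basis class_ring (sub_module (specht_span n d)) ((\<lambda>M. proj (vec M)) ` std d)"
proof (rule sub_module_basis(2)[OF specht_span_carrier specht_span_subspace])
  show "finite (std d)" using std_subset[OF assms] finite_std_upto by (rule finite_subset)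
  show "vec M \<in> specht_span n d" if "M \<in> std d" for M
    using vec_specht_span[of M] that std_subset[OF assms] by (auto simp: std_def)
  show "\<exists>c. p - (\<Sum>M\<in>std d. const_poly (c M) * vec M) \<in> I" if "p \<in> specht_span n d" for p
  proof -
    obtain c where "p = (\<Sum>M\<in>std d. const_poly (c M) * vec M)"
      using vec_spanning[OF std_subset[OF assms]] \<open>p \<in> specht_span n d\<close> unfolding specht_span_std by blast
    then show ?thesis using I_0 by (intro exI[of _ c]) simp
  qed
  show "\<forall>M\<in>std d. c M = 0" if "(\<Sum>M\<in>std d. const_poly (c M) * vec M) \<in> I" for c
    using that by (rule vec_independent[OF std_subset[OF assms]])
qed

section \<open>Blocks of equal degree and the direct sum\<close>

definition block :: "nat \<Rightarrow> qpoly set set" where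
  "block d = (\<lambda>M. proj (vec M)) ` std d"

lemma std_nonempty:
  assumes "d \<le> k"
  shows "std d \<noteq> {}"
proof -
  have "2 * d \<le> n" using le_half[OF assms] by linarith
  then obtain M where "standard_pairing n M" "card M = d" by (rule standard_pairing_exists)
  then show ?thesis by (auto simp: std_def)
qed

lemma block_disjoint:
  assumes "d \<le> k" "e \<le> k" "d \<noteq> e"
  shows "block d \<inter> block e = {}"
proof -
  have "block d \<inter> block e = (\<lambda>M. proj (vec M)) ` (std d \<inter> std e)"
    unfolding block_def
    by (rule inj_on_image_Int[OF basis_V(1) std_subset[OF assms(1)] std_subset[OF assms(2)], symmetric])
  also have "std d \<inter> std e = {}" using assms(3) by (auto simp: std_def)
  finally show ?thesis by simp
qed

text \<open>Equal blocks of different degrees would be disjoint from themselves, hence empty. This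
  allows sums indexed by blocks to be reindexed by degrees.\<close>

lemma block_inj: "inj_on block {..k}"
proof (rule inj_onI, rule ccontr)
  fix d e assume de: "d \<in> {..k}" "e \<in> {..k}" "block d = block e" "d \<noteq> e"
  then have "block d = {}" using block_disjoint[of d e] by auto
  then show False using std_nonempty[of d] de(1) by (simp add: block_def)
qed

lemma blocks_partition: "partition_on ((\<lambda>M. proj (vec M)) ` std_upto) (block ` {..k})"
proof (rule partition_onI)
  have "std_upto = (\<Union>d\<le>k. std d)" by (auto simp: std_def std_upto_def)
  then show "\<Union>(block ` {..k}) = (\<lambda>M. proj (vec M)) ` std_upto" by (auto simp: block_def)
  show "disjnt C C'" if "C \<in> block ` {..k}" "C' \<in> block ` {..k}" "C \<noteq> C'" for C C'
    using that block_disjoint by (auto simp: disjnt_def)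
  show "{} \<notin> block ` {..k}" using std_nonempty by (auto simp: block_def)
qed

text \<open>Existence: reduce to an element of \<open>H\<close> and split it by degree. Uniqueness:
  two decompositions differ by an element of both \<open>H\<close> and the ideal, which is zero, and
  then its parts vanish degree by degree.\<close>

lemma specht_direct_sum:
  assumes W: "\<And>d. d \<le> k \<Longrightarrow> W (block d) = proj ` specht_span n d"
  shows "direct_sum_decomposition V (block ` {..k}) W"
  unfolding direct_sum_decomposition_def
proof (intro conjI ballI allI impI)
  show "finite (block ` {..k})" by simp
  fix C assume "C \<in> block ` {..k}"
  then obtain d where "d \<le> k" "C = block d" by auto
  then show "W C \<subseteq> carrier V"
    using image_mono[OF specht_span_carrier] W by (simp add: V_carrier)
next
  fix v assume v: "v \<in> carrier V"
  interpret VS: vectorspace class_ring V by (rule V_vectorspace)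
  note am = VS.abelian_monoid_axioms
  have sum: "finsum V w (block ` {..k}) = proj (\<Sum>d\<le>k. s d)"
    if s: "\<And>d. d \<le> k \<Longrightarrow> s d \<in> specht_span n d" "\<And>d. d \<le> k \<Longrightarrow> w (block d) = proj (s d)" for w s
  proof -
    have mem: "s d \<in> poly_carrier n" if "d \<le> k" for d using s(1)[OF that] specht_span_carrier by blast
    have "finsum V w (block ` {..k}) = finsum V (\<lambda>d. w (block d)) {..k}"
      using mem s(2) by (intro abelian_monoid.finsum_reindex[OF am] block_inj) (auto simp: V_carrier)
    also have "\<dots> = finsum V (\<lambda>d. proj (s d)) {..k}"
      using mem s(2) by (intro abelian_monoid.finsum_cong'[OF am]) (auto simp: V_carrier)
    also have "\<dots> = proj (\<Sum>d\<le>k. s d)"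
      using finsum_sub_module[OF order_refl poly_carrier_subspace, of "{..k}" s] mem
      by (simp add: sub_module_all)
    finally show ?thesis .
  qed
  show "\<exists>!w. w \<in> (\<Pi>\<^sub>E C\<in>block ` {..k}. W C) \<and> v = finsum V w (block ` {..k})"
  proof (rule ex_ex1I)
    obtain p where p: "p \<in> poly_carrier n" "v = proj p" using v by (auto simp: V_carrier)
    obtain h where h: "h \<in> H" "p - h \<in> I" using H_add_I[OF p(1)] by blast
    obtain s where s: "\<And>d. d \<le> k \<Longrightarrow> s d \<in> specht_span n d" "h = (\<Sum>d\<le>k. s d)"
      by (rule H_decompose[OF h(1)], rule that)
    define w where "w = restrict (\<lambda>C. proj (s (inv_into {..k} block C))) (block ` {..k})"
    have w: "w (block d) = proj (s d)" if "d \<le> k" for d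
      using that inv_into_f_f[OF block_inj, of d] by (simp add: w_def)
    have "w \<in> (\<Pi>\<^sub>E C\<in>block ` {..k}. W C)"
    proof (rule PiE_I)
      fix C assume "C \<in> block ` {..k}"
      then obtain d where "d \<le> k" "C = block d" by auto
      then show "w C \<in> W C" using w W s(1) by simp
    qed (simp add: w_def)
    moreover have "v = finsum V w (block ` {..k})"
      using sum[OF s(1) w] h(2) by (simp add: p(2) proj_eq_iff s(2))
    ultimately show "\<exists>w. w \<in> (\<Pi>\<^sub>E C\<in>block ` {..k}. W C) \<and> v = finsum V w (block ` {..k})" by blast
  next
    fix w w' assume w: "w \<in> (\<Pi>\<^sub>E C\<in>block ` {..k}. W C) \<and> v = finsum V w (block ` {..k})"
      and w': "w' \<in> (\<Pi>\<^sub>E C\<in>block ` {..k}. W C) \<and> v = finsum V w' (block ` {..k})"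
    have ex: "\<exists>s. \<forall>d\<le>k. s d \<in> specht_span n d \<and> u (block d) = proj (s d)"
      if u: "u \<in> (\<Pi>\<^sub>E C\<in>block ` {..k}. W C)" for u
    proof -
      have "\<exists>q. q \<in> specht_span n d \<and> u (block d) = proj q" if "d \<le> k" for d
        using PiE_mem[OF u, of "block d"] W[OF that] that by auto
      then show ?thesis by metis
    qed
    obtain s where s: "\<forall>d\<le>k. s d \<in> specht_span n d \<and> w (block d) = proj (s d)"
      using ex[OF conjunct1[OF w]] by blast
    obtain t where t: "\<forall>d\<le>k. t d \<in> specht_span n d \<and> w' (block d) = proj (t d)"
      using ex[OF conjunct1[OF w']] by blast
    have diff: "s d - t d \<in> specht_span n d" if "d \<le> k" for d
      using s t that by (intro Q.subspace_diff[OF specht_span_subspace]) auto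
    have "proj (\<Sum>d\<le>k. s d) = proj (\<Sum>d\<le>k. t d)"
      using sum[of s w] sum[of t w'] s t conjunct2[OF w] conjunct2[OF w'] by simp
    then have "(\<Sum>d\<le>k. s d - t d) \<in> I" by (simp add: proj_eq_iff sum_subtractf)
    moreover have "(\<Sum>d\<le>k. s d - t d) \<in> H"
      unfolding H_def using diff specht_span_subset_H
      by (intro Q.span_sum) (auto simp: H_def)
    ultimately have "(\<Sum>d\<le>k. s d - t d) = 0" by (intro H_Int_I)
    then have "s d = t d" if "d \<le> k" for d
      using specht_span_independent[OF diff _ that] by simp
    then have eq: "w C = w' C" if "C \<in> block ` {..k}" for C
      using that s t by auto
    show "w = w'" using conjunct1[OF w] conjunct1[OF w'] eq by (rule PiE_ext)
  qed
qed

lemma descends: "descends_to_higher_specht_basis n \<mu> (B_set n \<mu>)"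
proof -
  have "B_set n \<mu> \<subseteq> carrier (poly_ring n)"
    unfolding B_set_eq using vec_specht_span specht_span_carrier by auto
  moreover have "inj_on proj (B_set n \<mu>)"
    unfolding B_set_eq by (rule inj_on_imageI) (use basis_V(1) in \<open>simp add: comp_def\<close>)
  moreover have "higher_specht_basis n V coset_act (proj ` B_set n \<mu>)"
  proof -
    have img: "proj ` B_set n \<mu> = (\<lambda>M. proj (vec M)) ` std_upto"
      unfolding B_set_eq image_image ..
    \<comment> \<open>The decomposition is indexed by the blocks of the basis, so the degree has to
      be recovered from the block by inverting \<open>block\<close>.\<close>
    define W where "W C = proj ` specht_span n (inv_into {..k} block C)" for C
    have W: "W (block d) = proj ` specht_span n d" if "d \<le> k" for d
      using that inv_into_f_f[OF block_inj, of d] by (simp add: W_def)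
    have "Sn_irreducible n V coset_act (W C) \<and> vectorspace.basis class_ring (V\<lparr>carrier := W C\<rparr>) C \<and>
        (\<exists>\<nu>. is_partition n \<nu> \<and>
          Sn_iso n (V\<lparr>carrier := W C\<rparr>) coset_act (specht_module n \<nu>) perm_act)"
      if "C \<in> block ` {..k}" for C
    proof -
      from that obtain d where d: "d \<le> k" "C = block d" by auto
      obtain M where M: "M \<in> std d" using std_nonempty[OF d(1)] by blast
      then have "pairing n M" "card M = d" by (simp_all add: std_def standard_pairing_def)
      then have "specht_span n d \<noteq> {0}"
        using pair_poly_in_specht_span[of n M] pair_poly_nonzero[of n M] by auto
      then have "Sn_irreducible n V coset_act (W C)"
        unfolding d(2) W[OF d(1)] by (rule specht_submodule_irreducible[OF d(1)])
      moreover have "vectorspace.basis class_ring (V\<lparr>carrier := W C\<rparr>) C"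
        unfolding d(2) W[OF d(1)] using basis_specht[OF d(1)] by (simp only: block_def)
      moreover have "is_partition n (two_row_shape n d)"
        by (rule is_partition_two_row_shape[OF n_pos le_half[OF d(1)]])
      moreover have "Sn_iso n (V\<lparr>carrier := W C\<rparr>) coset_act
          (specht_module n (two_row_shape n d)) perm_act"
        unfolding d(2) W[OF d(1)] by (rule specht_submodule_iso[OF d(1)])
      ultimately show ?thesis by blast
    qed
    then show ?thesis
      unfolding higher_specht_basis_def img
      using V_rep basis_V(2) blocks_partition specht_direct_sum[of W, OF W] by blast
  qed
  ultimately show ?thesis unfolding descends_to_higher_specht_basis_def by blast
qed

end

theorem theorem1p9:
  fixes n k :: nat and \<mu> :: "nat list"
  assumes "n \<ge> 1" and "k \<le> n" and "k \<le> n - k"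
    and "\<mu> = (if k = 0 then [n] else [n - k, k])"
  shows "descends_to_higher_specht_basis n \<mu> (B_set n \<mu>)"
proof -
  interpret two_row n k \<mu> using assms by unfold_locales
  show ?thesis by (rule descends)
qed

end
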